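(* Let $L=(\ell_\rho,U_\rho)$ with coefficients $Q_0,Q_1,h_0,h_1$ and $\tilde L=(\tilde\ell_\rho,\tilde U_\rho)$ with coefficients $\tilde Q_0,\tilde Q_1,\tilde h_0,\tilde h_1$ be two pencils of class $\mathcal V$ with $\det(I\pm h_1)\neq0$ and $\det(I\pm\tilde h_1)\ne0$, and let $M(\rho)$, $\tilde M(\rho)$ be their Weyl matrices. If $M(\rho)=\tilde M(\rho)$ (identically in $\rho\in\Pi_+\cup\Pi_-$, wherever both are defined), then $L=\tilde L$, that is, $Q_1=\tilde Q_1$, $Q_0=\tilde Q_0$ (almost everywhere) on $(0,\infty)$, $h_0=\tilde h_0$ and $h_1=\tilde h_1$. Hence the Weyl matrix determines the coefficients of the pencil uniquely.
   Context: Fix $m\ge1$; $I$ is the $m\times m$ unit matrix. A pencil $L=L(\ell_\rho,U_\rho)$ is given by $$\ell_\rho(Y):=Y''+(\rho^2I+2i\rho Q_1(x)+Q_0(x))Y,\quad x>0,\qquad U_\rho(Y):=Y'(0)+(i\rho h_1+h_0)Y(0),$$ where $\rho\in\mathbb C$ is the spectral parameter, $Q_0,Q_1$ are complex $m\times m$ matrix functions and $h_0,h_1\in\mathbb C^{m\times m}$. Here $Y$ is a column vector function, or a matrix function treated columnwise. It is always assumed that $\det(I\pm h_1)\neq0$ (both signs) and that $L$ belongs to the class $\mathcal V$: the entries of $Q_1$ are absolutely continuous on $[0,T]$ for each $T>0$, and $Q_0,Q_1,Q_1'$ are (entrywise) Lebesgue integrable on $(0,\infty)$. Let $\Pi_\pm=\{\rho\in\mathbb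 C:\pm\operatorname{Im}\rho>0\}$. The Weyl solution $\Phi(x,\rho)$ is the $m\times m$ matrix solution of $\ell_\rho(\Phi)=0$ satisfying $U_\rho(\Phi)=I$ and $\Phi(x,\rho)=O(\exp(\pm i\rho x))$ as $x\to\infty$ for $\rho\in\Pi_\pm$; it is defined for $\rho\in\Pi_+\cup\Pi_-$ outside an at most countable bounded set. The Weyl matrix is $M(\rho):=\Phi(0,\rho)$. Objects with a tilde are the corresponding objects for $\tilde L$. *)

theory Defs
  imports "HOL-Analysis.Analysis"
begin

text \<open>Absolute continuity of a function on a compact interval \<open>[a, b]\<close>. (The library constant
  of a similar name, \<open>absolutely_continuous\<close>, is about measures.)\<close>

definition abs_cont_on :: "real \<Rightarrow> real \<Rightarrow> (real \<Rightarrow> 'a::metric_space) \<Rightarrow> bool" where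
  "abs_cont_on a b f \<longleftrightarrow>
     (\<forall>\<epsilon>>0. \<exists>\<delta>>0. \<forall>(n::nat) (u::nat \<Rightarrow> real) (v::nat \<Rightarrow> real).
        (\<forall>k<n. a \<le> u k \<and> u k \<le> v k \<and> v k \<le> b) \<and>
        disjoint_family_on (\<lambda>k. {u k<..<v k}) {..<n} \<and>
        (\<Sum>k<n. v k - u k) < \<delta> \<longrightarrow>
        (\<Sum>k<n. dist (f (u k)) (f (v k))) < \<epsilon>)"

text \<open>Coefficients are functions on the whole real line whose values at negative arguments are
  irrelevant. An absolutely continuous function is differentiable almost everywhere, so that
  asking for the derivative \<open>Q1'\<close> to exist almost everywhere is no additional restriction.\<close>

definition class_V ::
  "(real \<Rightarrow> complex^'m::finite^'m) \<Rightarrow> (real \<Rightarrow> complex^'m^'m) \<Rightarrow> bool" where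
  "class_V Q0 Q1 \<longleftrightarrow>
     (\<forall>T>0. \<forall>i j. abs_cont_on 0 T (\<lambda>x. Q1 x $ i $ j)) \<and>
     (\<forall>i j. (\<lambda>x. Q0 x $ i $ j) absolutely_integrable_on {0<..}) \<and>
     (\<forall>i j. (\<lambda>x. Q1 x $ i $ j) absolutely_integrable_on {0<..}) \<and>
     (\<exists>Q1'. (AE x in lebesgue. x > 0 \<longrightarrow> (Q1 has_vector_derivative Q1' x) (at x)) \<and>
            (\<forall>i j. (\<lambda>x. Q1' x $ i $ j) absolutely_integrable_on {0<..}))"

text \<open>The derivative on the closed half-line; it is one-sided at \<open>0\<close>.\<close>

definition deriv_half_line :: "(real \<Rightarrow> 'a::real_normed_vector) \<Rightarrow> real \<Rightarrow> 'a" where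
  "deriv_half_line Y x = vector_derivative Y (at x within {0..})"

text \<open>In the next two definitions \<open>mat c\<close> is \<open>c\<close> times the unit matrix, so that
  \<open>mat c ** A\<close> is the scalar multiple \<open>c A\<close>.\<close>

definition pencil_ell ::
  "(real \<Rightarrow> complex^'m::finite^'m) \<Rightarrow> (real \<Rightarrow> complex^'m^'m) \<Rightarrow> complex \<Rightarrow>
   (real \<Rightarrow> complex^'m^'m) \<Rightarrow> real \<Rightarrow> complex^'m^'m" where
  "pencil_ell Q0 Q1 \<rho> Y x =
     vector_derivative (deriv_half_line Y) (at x) +
     (mat (\<rho>\<^sup>2) + mat (2 * \<i> * \<rho>) ** Q1 x + Q0 x) ** Y x"

definition pencil_U ::
  "complex^'m::finite^'m \<Rightarrow> complex^'m^'m \<Rightarrow> complex \<Rightarrow>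
   (real \<Rightarrow> complex^'m^'m) \<Rightarrow> complex^'m^'m" where
  "pencil_U h0 h1 \<rho> Y = deriv_half_line Y 0 + (mat (\<i> * \<rho>) ** h1 + h0) ** Y 0"

text \<open>Since \<open>Q0\<close> is only integrable, solutions are taken in the Caratheodory sense: \<open>Y\<close> is
  differentiable, \<open>Y'\<close> is locally absolutely continuous (whence \<open>Y''\<close> exists almost everywhere),
  and the equation holds almost everywhere.\<close>

definition pencil_solution ::
  "(real \<Rightarrow> complex^'m::finite^'m) \<Rightarrow> (real \<Rightarrow> complex^'m^'m) \<Rightarrow> complex \<Rightarrow>
   (real \<Rightarrow> complex^'m^'m) \<Rightarrow> bool" where
  "pencil_solution Q0 Q1 \<rho> Y \<longleftrightarrow>
     (\<forall>x\<ge>0. Y differentiable (at x within {0..})) \<and>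
     (\<forall>T>0. abs_cont_on 0 T (deriv_half_line Y)) \<and>
     (AE x in lebesgue. x > 0 \<longrightarrow>
        deriv_half_line Y differentiable (at x) \<and> pencil_ell Q0 Q1 \<rho> Y x = 0)"

definition Pi_plus :: "complex set" where
  "Pi_plus = {\<rho>. Im \<rho> > 0}"

definition Pi_minus :: "complex set" where
  "Pi_minus = {\<rho>. Im \<rho> < 0}"

definition weyl_solution ::
  "(real \<Rightarrow> complex^'m::finite^'m) \<Rightarrow> (real \<Rightarrow> complex^'m^'m) \<Rightarrow>
   complex^'m^'m \<Rightarrow> complex^'m^'m \<Rightarrow> complex \<Rightarrow> (real \<Rightarrow> complex^'m^'m) \<Rightarrow> bool" where
  "weyl_solution Q0 Q1 h0 h1 \<rho> \<Phi> \<longleftrightarrow>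
     pencil_solution Q0 Q1 \<rho> \<Phi> \<and>
     pencil_U h0 h1 \<rho> \<Phi> = mat 1 \<and>
     (\<rho> \<in> Pi_plus \<longrightarrow>
        (\<forall>i j. (\<lambda>x. \<Phi> x $ i $ j) \<in> O[at_top](\<lambda>x. exp (\<i> * \<rho> * of_real x)))) \<and>
     (\<rho> \<in> Pi_minus \<longrightarrow>
        (\<forall>i j. (\<lambda>x. \<Phi> x $ i $ j) \<in> O[at_top](\<lambda>x. exp (- \<i> * \<rho> * of_real x))))"

text \<open>The set of \<open>\<rho>\<close> for which the Weyl solution, and hence the Weyl matrix, is defined. Where
  a Weyl solution exists it is unique on \<open>[0, \<infinity>)\<close>: the solutions satisfying the growth condition
  form an \<open>m\<close>-dimensional space, which \<open>U\<close> then maps onto \<open>m\<close>-space.\<close>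

definition weyl_domain ::
  "(real \<Rightarrow> complex^'m::finite^'m) \<Rightarrow> (real \<Rightarrow> complex^'m^'m) \<Rightarrow>
   complex^'m^'m \<Rightarrow> complex^'m^'m \<Rightarrow> complex set" where
  "weyl_domain Q0 Q1 h0 h1 =
     {\<rho> \<in> Pi_plus \<union> Pi_minus. \<exists>\<Phi>. weyl_solution Q0 Q1 h0 h1 \<rho> \<Phi>}"

definition weyl_matrix ::
  "(real \<Rightarrow> complex^'m::finite^'m) \<Rightarrow> (real \<Rightarrow> complex^'m^'m) \<Rightarrow>
   complex^'m^'m \<Rightarrow> complex^'m^'m \<Rightarrow> complex \<Rightarrow> complex^'m^'m" where
  "weyl_matrix Q0 Q1 h0 h1 \<rho> = (THE M. \<exists>\<Phi>. weyl_solution Q0 Q1 h0 h1 \<rho> \<Phi> \<and> M = \<Phi> 0)"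

end

theory Submission
  imports Defs "HOL-Complex_Analysis.Complex_Analysis"
begin

text \<open>Put \<open>V = Y' - \<i> \<rho> Y + Q\<^sub>1 Y\<close>. This turns the pencil into a first order system for \<open>(Y, V)\<close> whose
  coefficients do not involve \<open>Q\<^sub>1'\<close> or \<open>Q\<^sub>0\<close> except through the integrable function
  \<open>q = Q\<^sub>0 - Q\<^sub>1' + Q\<^sub>1\<^sup>2\<close>. For large \<open>Im \<rho>\<close> it has a solution \<open>(Pm z, w) exp (\<i> \<rho> x)\<close> with
  \<open>z = I + O(1 / Im \<rho>)\<close> and \<open>w\<close> bounded, where \<open>Pm\<close> solves \<open>P' = - Q\<^sub>1 P\<close>, and \<open>M\<^sup>-\<^sup>1\<close> is
  \<open>\<i> \<rho> (I + h\<^sub>1) + w(0) - Q\<^sub>1(0) + h\<^sub>0\<close>. Hence \<open>M\<close> determines \<open>h\<^sub>1\<close>, and equality of the Weyl matrices means that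
  a lower triangular initial matrix independent of \<open>\<rho>\<close> matches the decaying solutions of the two systems at \<open>x = 0\<close>.
  Let \<open>(A E; C D)\<close> be the transfer matrix with this initial value that carries solutions of the second
  system to solutions of the first. For each \<open>x\<close> it is entire of exponential type in \<open>\<rho>\<close>. Matching the
  decaying solutions makes \<open>A\<close> bounded and \<open>E = O(1 / \<bar>Im \<rho>\<bar>)\<close> for large \<open>Im \<rho>\<close>, with \<open>A \<rightarrow> Pm Pm\<^sup>~\<^sup>-\<^sup>1\<close> along
  the imaginary axis; the reflection \<open>(\<rho>, Q\<^sub>1, h\<^sub>1) \<mapsto> (- \<rho>, - Q\<^sub>1, - h\<^sub>1)\<close> gives the same in the
  lower half-plane (for \<open>A\<close> up to a multiple of \<open>E\<close>), with the limit \<open>Pp Pp\<^sup>~\<^sup>-\<^sup>1\<close> where \<open>Pp\<close> solves \<open>P' = Q\<^sub>1 P\<close>. By Phragmen-Lindelof and Liouville, \<open>E = 0\<close> and \<open>A\<close> does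
  not depend on \<open>\<rho>\<close>, so \<open>A = Pm Pm\<^sup>~\<^sup>-\<^sup>1 = Pp Pp\<^sup>~\<^sup>-\<^sup>1\<close>. Differentiating both expressions gives
  \<open>A' = A Q\<^sub>1\<^sup>~ - Q\<^sub>1 A\<close> and \<open>A' = Q\<^sub>1 A - A Q\<^sub>1\<^sup>~\<close>, hence \<open>A = I\<close>, \<open>Q\<^sub>1 = Q\<^sub>1\<^sup>~\<close>, and then \<open>Q\<^sub>0 = Q\<^sub>0\<^sup>~\<close>
  almost everywhere.\<close>

unbundle no fps_syntax

section \<open>Indefinite integrals on the half-line\<close>

text \<open>All bounds depend on Im \<rho> alone, uniformly in Re \<rho>, so they say nothing on a
  strip around the real axis; this is why the comparison must go through entire functions.
  Normalising the decaying solution to I at x = 0 rather than at infinity makes its boundary value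
  equal to the inverse of M. Once h1 is known, equal Weyl matrices therefore force the two values
  w(0) to differ by a matrix free of \<rho>, and this matrix fills the lower left corner of the
  initial value. The growing solution with Y(0) = 0 and V(0) = I is matched automatically, because
  that corner acts on Y(0) only. The two matched pairs give two equations for A and E, and no
  fundamental matrix with growing entries has to be inverted. Under the reflection the second
  component changes by a multiple of Y that contains 2i\<rho>; the reflected estimates thus control
  E and A + E(2 Q1~ - 2i\<rho>) instead of A. Hence E = 0 has to be established before A can be
  shown to be constant.\<close>

lemma abs_cont_onD_tagged:
  fixes F :: "real \<Rightarrow> 'a::real_normed_vector"
  assumes ac: "abs_cont_on a b F" and "\<epsilon> > 0"
  shows "\<exists>\<delta>>0. \<forall>p T. p tagged_partial_division_of {a..b} \<longrightarrow> T \<in> lmeasurable \<longrightarrow>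
       measure lebesgue T < \<delta> \<longrightarrow> (\<forall>(x, K)\<in>p. K \<subseteq> T) \<longrightarrow>
       (\<Sum>(x, K)\<in>p. norm (F (Sup K) - F (Inf K))) < \<epsilon>"
proof -
  obtain \<delta> where "\<delta> > 0" and \<delta>: "\<And>(n::nat) u v.
      \<lbrakk>\<forall>k<n. a \<le> u k \<and> u k \<le> v k \<and> v k \<le> b; disjoint_family_on (\<lambda>k. {u k<..<v k}) {..<n};
       (\<Sum>k<n. v k - u k) < \<delta>\<rbrakk> \<Longrightarrow> (\<Sum>k<n. dist (F (u k)) (F (v k))) < \<epsilon>"
  proof -
    note * = ac[unfolded abs_cont_on_def, THEN spec, THEN mp, OF \<open>\<epsilon> > 0\<close>]
    show thesis
      using * that by blast
  qed
  show ?thesis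
  proof (intro exI[of _ \<delta>] conjI allI impI \<open>\<delta> > 0\<close>)
    fix p T
    assume p: "p tagged_partial_division_of {a..b}" and T: "T \<in> lmeasurable" "measure lebesgue T < \<delta>"
      and "\<forall>(x, K)\<in>p. K \<subseteq> T"
    then have sub: "\<And>x K. (x, K) \<in> p \<Longrightarrow> K \<subseteq> T" by blast
    have "finite p"
      using p by (rule tagged_partial_division_ofD(1))
    \<comment> \<open>\<open>abs_cont_on\<close> speaks of numbered intervals, so the blocks of the
      division are enumerated. Blocks may be degenerate; what is disjoint are their
      interiors.\<close>
    then obtain h and n :: nat where h: "bij_betw h {..<n} p"
      using bij_betw_from_nat_into_finite[of p] by blast
    define u where "u k = Inf (snd (h k))" for k
    define v where "v k = Sup (snd (h k))" for k
    have hp: "h k \<in> p" if "k < n" for k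
      using h that by (auto simp: bij_betw_def)
    have K: "u k \<le> v k \<and> snd (h k) = {u k..v k} \<and> a \<le> u k \<and> v k \<le> b" if "k < n" for k
    proof -
      obtain x K where xK: "h k = (x, K)" by (cases "h k")
      have "(x, K) \<in> p" using hp[OF that] xK by simp
      then have xk: "x \<in> K" "K \<subseteq> {a..b}" and "\<exists>c d. K = cbox c d"
        using tagged_partial_division_ofD[OF p] by blast+
      then obtain c d where cd: "K = {c..d}" by auto
      then have "c \<le> d" using xk by auto
      then show ?thesis
        using xK xk cd by (auto simp: u_def v_def)
    qed
    have disj: "disjoint_family_on (\<lambda>k. {u k<..<v k}) {..<n}"
      unfolding disjoint_family_on_def
    proof (intro ballI impI)
      fix i j assume ij: "i \<in> {..<n}" "j \<in> {..<n}" "i \<noteq> j"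
      obtain x K where xK: "h i = (x, K)" by (cases "h i")
      obtain y L where yL: "h j = (y, L)" by (cases "h j")
      have ne: "h i \<noteq> h j" using h ij by (auto simp: bij_betw_def inj_on_def)
      have "interior K \<inter> interior L = {}"
        using tagged_partial_division_ofD(5)[OF p, of x K y L] hp[of i] hp[of j] ij xK yL ne by auto
      then show "{u i<..<v i} \<inter> {u j<..<v j} = {}"
        using K[of i] K[of j] ij xK yL by (auto simp: interior_atLeastAtMost_real)
    qed
    have "(\<Sum>k<n. v k - u k) = (\<Sum>k<n. measure lebesgue {u k<..<v k})"
      by (rule sum.cong) (use K in auto)
    \<comment> \<open>Disjointness turns the total length into a single measure, which is small
      because all blocks lie in \<open>T\<close>.\<close>
    also have "\<dots> = measure lebesgue (\<Union>k\<in>{..<n}. {u k<..<v k})"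
      by (rule measure_UNION'[symmetric]) (use disj in \<open>auto simp: disjoint_family_on_def pairwise_def disjnt_def\<close>)
    also have "\<dots> \<le> measure lebesgue T"
    proof (rule measure_mono_fmeasurable)
      show "(\<Union>k\<in>{..<n}. {u k<..<v k}) \<subseteq> T"
      proof
        fix x assume "x \<in> (\<Union>k\<in>{..<n}. {u k<..<v k})"
        then obtain k where k: "k < n" "x \<in> {u k<..<v k}" by auto
        then have "x \<in> snd (h k)" using K[OF k(1)] by auto
        then show "x \<in> T" using sub[of "fst (h k)" "snd (h k)"] hp[OF k(1)] by auto
      qed
    qed (use T in auto)
    finally have "(\<Sum>k<n. v k - u k) < \<delta>" using T by simp
    then have "(\<Sum>k<n. dist (F (u k)) (F (v k))) < \<epsilon>"
      using \<delta>[OF _ disj] K by blast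
    moreover have "(\<Sum>k<n. dist (F (u k)) (F (v k))) = (\<Sum>(x, K)\<in>p. norm (F (Sup K) - F (Inf K)))"
      unfolding sum.reindex_bij_betw[OF h, symmetric]
      by (rule sum.cong) (auto simp: u_def v_def dist_norm norm_minus_commute split: prod.split)
    ultimately show "(\<Sum>(x, K)\<in>p. norm (F (Sup K) - F (Inf K))) < \<epsilon>" by simp
  qed
qed

lemma negligible_open_superset:
  fixes N :: "real set"
  assumes "negligible N" "e > 0"
  obtains T where "open T" "N \<subseteq> T" "T \<in> lmeasurable" "measure lebesgue T < e"
proof -
  obtain T where T: "open T" "N \<subseteq> T" "T - N \<in> lmeasurable" "emeasure lebesgue (T - N) < ennreal e"
    using sets_lebesgue_outer_open[of N e] assms negligible_imp_sets by blast
  have "T = (T - N) \<union> N" using T by auto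
  then have Tm: "T \<in> lmeasurable"
    using T(3) negligible_imp_measurable[OF assms(1)] fmeasurable.Un by metis
  have "measure lebesgue (T - N) = measure lebesgue T"
    by (metis Tm assms(1) fmeasurableD measure_Diff_null_set negligible_iff_null_sets)
  moreover have "measure lebesgue (T - N) < e"
    using T(3,4) assms(2) by (simp add: emeasure_eq_measure2 ennreal_less_iff)
  ultimately show thesis using that T Tm by metis
qed

text \<open>The gauge is a fine neighbourhood at points of differentiability and an open set of
  small measure at the points of the exceptional set \<open>N\<close>.\<close>

lemma abs_cont_on_has_integral:
  fixes F f :: "real \<Rightarrow> 'a::euclidean_space"
  assumes "a \<le> b" and ac: "abs_cont_on a b F" and N: "negligible N"
    and deriv: "\<And>x. x \<in> {a..b} - N \<Longrightarrow> (F has_vector_derivative f x) (at x within {a..b})"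
  shows "(f has_integral (F b - F a)) {a..b}"
proof -
  \<comment> \<open>Setting the integrand to 0 on \<open>N\<close> reduces the blocks tagged in
    \<open>N\<close> to bare increments of \<open>F\<close>, which absolute continuity
    controls.\<close>
  define g where "g x = (if x \<in> N then 0 else f x)" for x
  have "(g has_integral (F b - F a)) {a..b}"
    unfolding has_integral_real
  proof (intro allI impI)
    fix e :: real assume "e > 0"
    \<comment> \<open>The summand 1 keeps the denominator positive when \<open>a = b\<close>; the
      differentiable part then costs less than \<open>e/2\<close> over the whole interval.\<close>
    define e' where "e' = e / (2 * (b - a + 1))"
    have e': "e' > 0" "e' * (b - a) < e/2"
    proof -
      show "e' > 0" using \<open>e > 0\<close> \<open>a \<le> b\<close> by (simp add: e'_def)
      have "e' * (b - a + 1) = e/2" using \<open>a \<le> b\<close> by (simp add: e'_def field_simps)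
      then show "e' * (b - a) < e/2" using \<open>e' > 0\<close> by (simp add: algebra_simps)
    qed
    obtain \<delta> where "\<delta> > 0" and \<delta>: "\<forall>p T. p tagged_partial_division_of {a..b} \<longrightarrow> T \<in> lmeasurable \<longrightarrow>
        measure lebesgue T < \<delta> \<longrightarrow> (\<forall>(x, K)\<in>p. K \<subseteq> T) \<longrightarrow>
       (\<Sum>(x, K)\<in>p. norm (F (Sup K) - F (Inf K))) < e/2"
      using abs_cont_onD_tagged[OF ac half_gt_zero[OF \<open>e > 0\<close>]] by (elim exE conjE)
    obtain T where T: "open T" "N \<subseteq> T" "T \<in> lmeasurable" "measure lebesgue T < \<delta>"
      using negligible_open_superset[OF N \<open>\<delta> > 0\<close>] .
    have "\<exists>d>0. \<forall>y\<in>{a..b}. norm (y-x) < d \<longrightarrow> norm (F y - F x - (y-x) *\<^sub>R f x) \<le> e' * norm (y-x)"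
      if "x \<in> {a..b} - N" for x
      using deriv[OF that, unfolded has_vector_derivative_def has_derivative_within_alt,
          THEN conjunct2, THEN spec, THEN mp, OF e'(1)] .
    then have "\<forall>x. \<exists>d. 0 < d \<and> (x \<in> {a..b} - N \<longrightarrow>
         (\<forall>y\<in>{a..b}. norm (y-x) < d \<longrightarrow> norm (F y - F x - (y-x) *\<^sub>R f x) \<le> e' * norm (y-x)))"
      using zero_less_one by blast
    from choice[OF this] obtain d where dd: "\<forall>x. 0 < d x \<and> (x \<in> {a..b} - N \<longrightarrow>
         (\<forall>y\<in>{a..b}. norm (y-x) < d x \<longrightarrow> norm (F y - F x - (y-x) *\<^sub>R f x) \<le> e' * norm (y-x)))"
      by (elim exE)
    have d: "0 < d x" "\<lbrakk>x \<in> {a..b} - N; y \<in> {a..b}; norm (y-x) < d x\<rbrakk>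
                        \<Longrightarrow> norm (F y - F x - (y-x) *\<^sub>R f x) \<le> e' * norm (y-x)" for x y
      using dd[THEN spec, of x] by simp_all
    define \<gamma> where "\<gamma> x = (if x \<in> N then T else ball x (d x))" for x
    have "gauge \<gamma>"
      unfolding gauge_def \<gamma>_def using T d(1) by auto
    moreover have "norm ((\<Sum>(x, k)\<in>p. measure lborel k *\<^sub>R g x) - (F b - F a)) < e"
      if p: "p tagged_division_of {a..b}" and fine: "\<gamma> fine p" for p
    proof -
      have fp: "finite p" using p by auto
      have sumF: "F b - F a = (\<Sum>(x,K)\<in>p. F(Sup K) - F(Inf K))"
        and sumx: "b - a = (\<Sum>(x,K)\<in>p. Sup K - Inf K)"
        using additive_tagged_division_1[of a b p F] additive_tagged_division_1[of a b p "\<lambda>x. x"]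
          p \<open>a \<le> b\<close> by auto
      have K: "\<exists>u v. u \<le> v \<and> K = {u..v} \<and> x \<in> K \<and> K \<subseteq> {a..b}" if xK: "(x, K) \<in> p" for x K
      proof -
        obtain c d where "K = {c..d}"
          using tagged_division_ofD(4)[OF p xK] by auto
        then show ?thesis
          using tagged_division_ofD(2,3)[OF p xK] by (intro exI[of _ c] exI[of _ d]) auto
      qed
      let ?p1 = "{xK \<in> p. fst xK \<in> N}" and ?p2 = "{xK \<in> p. fst xK \<notin> N}"
      let ?w = "\<lambda>(x::real, K). e' * (Sup K - Inf K)"
      let ?h = "\<lambda>(x, K). measure lborel K *\<^sub>R g x - (F (Sup K) - F (Inf K))"
      have split: "p = ?p1 \<union> ?p2" "?p1 \<inter> ?p2 = {}" by auto
      have "norm (sum ?h ?p1) \<le> (\<Sum>(x, K)\<in>?p1. norm (F (Sup K) - F (Inf K)))"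
        by (rule sum_norm_le) (auto simp: g_def norm_minus_commute)
      also have "\<dots> < e/2"
      proof (rule \<delta>[rule_format, OF _ T(3,4)])
        show "?p1 tagged_partial_division_of {a..b}"
          by (rule tagged_partial_division_subset[OF tagged_division_of_def[THEN iffD1, THEN conjunct1, OF p]]) simp
        show "case xK of (x, K) \<Rightarrow> K \<subseteq> T" if "xK \<in> ?p1" for xK
        proof (cases xK)
          case (Pair x K)
          then have "(x, K) \<in> p" "x \<in> N" using that by auto
          then show ?thesis using fineD[OF fine, of x K] Pair by (simp add: \<gamma>_def)
        qed
      qed
      finally have 1: "norm (sum ?h ?p1) < e/2" .
      have le2: "norm (sum ?h ?p2) \<le> sum ?w ?p2"
      proof (rule sum_norm_le)
        fix xK assume "xK \<in> ?p2"
        then obtain x K where xKeq: "xK = (x, K)" and xK: "(x, K) \<in> p" "x \<notin> N" by (cases xK) auto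
        obtain u v where uv: "u \<le> v" "K = {u..v}" "x \<in> K" "K \<subseteq> {a..b}" using K[OF xK(1)] by blast
        have ball: "\<And>y. y \<in> K \<Longrightarrow> norm (y - x) < d x"
        proof -
          have "K \<subseteq> ball x (d x)" using fineD[OF fine xK(1)] xK(2) by (simp add: \<gamma>_def)
          then show "\<And>y. y \<in> K \<Longrightarrow> norm (y - x) < d x" by (auto simp: dist_norm norm_minus_commute)
        qed
        have uvK: "u \<in> K" "v \<in> K" using uv by auto
        have x: "x \<in> {a..b} - N" using xK uv by auto
        have "norm ((v - u) *\<^sub>R f x - (F v - F u)) = norm (F u - F x - (u - x) *\<^sub>R f x - (F v - F x - (v - x) *\<^sub>R f x))"
          by (auto simp: algebra_simps)
        also have "\<dots> \<le> norm (F u - F x - (u - x) *\<^sub>R f x) + norm (F v - F x - (v - x) *\<^sub>R f x)"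
          by (rule norm_triangle_ineq4)
        also have "\<dots> \<le> e' * norm (u - x) + e' * norm (v - x)"
          by (intro add_mono d(2) x ball uvK) (use uvK uv in auto)
        also have "\<dots> = e' * (v - u)"
          using uv by (auto simp: algebra_simps)
        finally have "norm (measure lborel K *\<^sub>R g x - (F (Sup K) - F (Inf K))) \<le> e' * (Sup K - Inf K)"
          using uv xK by (simp add: g_def)
        then show "norm (?h xK) \<le> ?w xK"
          by (simp add: xKeq)
      qed
      have "sum ?w ?p2 \<le> sum ?w p"
      proof (rule sum_mono2[OF fp])
        show "?p2 \<subseteq> p" by auto
        fix xK assume "xK \<in> p - ?p2"
        then obtain x L where "xK = (x, L)" "(x, L) \<in> p" by (cases xK) auto
        moreover from K[OF this(2)] have "0 \<le> Sup L - Inf L" by auto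
        ultimately show "0 \<le> ?w xK" using e' by simp
      qed
      moreover have "sum ?w p = e' * (b - a)"
        unfolding sumx sum_distrib_left by (rule sum.cong) auto
      ultimately have 2: "norm (sum ?h ?p2) < e/2" using e' le2 by linarith
      have "(\<Sum>(x, k)\<in>p. measure lborel k *\<^sub>R g x) - (F b - F a) = sum ?h p"
        by (simp add: sumF sum_subtractf split_def)
      also have "\<dots> = sum ?h ?p1 + sum ?h ?p2"
        using sum.union_disjoint[of ?p1 ?p2 ?h] fp split by simp
      finally show ?thesis using 1 2 norm_triangle_ineq[of "sum ?h ?p1" "sum ?h ?p2"] by simp
    qed
    ultimately show "\<exists>\<gamma>. gauge \<gamma> \<and> (\<forall>\<D>. \<D> tagged_division_of {a..b} \<and> \<gamma> fine \<D> \<longrightarrow>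
              norm ((\<Sum>(x, k)\<in>\<D>. measure lborel k *\<^sub>R g x) - (F b - F a)) < e)"
      by (intro exI[of _ \<gamma>]) simp
  qed
  then show ?thesis
    by (rule has_integral_spike[OF N, rotated]) (simp add: g_def)
qed

text \<open>Truncation at a height \<open>m\<close>: norm f is at most \<open>m\<close> plus its
  excess over \<open>m\<close>. The excess has a small integral for large \<open>m\<close> by
  dominated convergence, and the bounded part contributes at most \<open>m\<close> times the total
  length of the intervals.\<close>

lemma abs_cont_on_indefinite_integral:
  fixes f :: "real \<Rightarrow> 'a::euclidean_space"
  assumes f: "f absolutely_integrable_on {a..b}"
  shows "abs_cont_on a b (\<lambda>x. integral {a..x} f)"
  unfolding abs_cont_on_def
proof (intro allI impI)
  fix \<epsilon> :: real assume "\<epsilon> > 0"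
  let ?m = "\<lambda>m x. max (norm (f x) - real m) 0"
  have nf: "(\<lambda>x. norm (f x)) absolutely_integrable_on {a..b}"
    using absolutely_integrable_norm[OF f] by (simp add: o_def)
  have m_int: "?m m absolutely_integrable_on {a..b}" for m
    by (intro absolutely_integrable_max_1 set_integral_diff(1) nf) auto
  have "(\<lambda>m. integral {a..b} (?m m)) \<longlonglongrightarrow> integral {a..b} (\<lambda>x. 0::real)"
  proof (rule dominated_convergence(2))
    show "?m m integrable_on {a..b}" for m
      using m_int set_lebesgue_integral_eq_integral(1) by blast
    show "(\<lambda>x. norm (f x)) integrable_on {a..b}"
      using nf set_lebesgue_integral_eq_integral(1) by blast
    show "norm (?m m x) \<le> norm (f x)" for m x by simp
    show "(\<lambda>m. ?m m x) \<longlonglongrightarrow> 0" for x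
    proof (rule tendsto_eventually)
      obtain n :: nat where "norm (f x) \<le> n" using real_arch_simple by blast
      then have "?m m x = 0" if "m \<ge> n" for m using that by (simp add: max_def)
      then show "\<forall>\<^sub>F m in sequentially. ?m m x = 0"
        by (rule eventually_sequentiallyI)
    qed
  qed
  then have "\<forall>\<^sub>F m in sequentially. integral {a..b} (?m m) < \<epsilon>/2"
    by (rule order_tendstoD(2)) (use \<open>\<epsilon> > 0\<close> in simp)
  then obtain m where m: "integral {a..b} (?m m) < \<epsilon>/2"
    by (auto simp: eventually_sequentially)
  define \<delta> where "\<delta> = \<epsilon> / (2 * (real m + 1))"
  have "\<delta> > 0" using \<open>\<epsilon> > 0\<close> by (auto simp: \<delta>_def)
  moreover have "(\<Sum>k<n. dist (integral {a..u k} f) (integral {a..v k} f)) < \<epsilon>"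
    if uv: "\<forall>k<n. a \<le> u k \<and> u k \<le> v k \<and> v k \<le> b" and disj: "disjoint_family_on (\<lambda>k. {u k<..<v k}) {..<n}"
      and s: "(\<Sum>k<n. v k - u k) < \<delta>" for n :: nat and u v
  proof -
    let ?i = "\<lambda>k x. if x \<in> {u k<..<v k} then ?m m x else 0"
    have iint: "(?i k) integrable_on {a..b}" "integral {a..b} (?i k) = integral {u k..v k} (?m m)" if "k < n" for k
    proof -
      have sub: "{u k<..<v k} \<inter> {a..b} = {u k<..<v k}" "{u k..v k} \<subseteq> {a..b}" using uv that by fastforce+
      have "?m m integrable_on {u k..v k}"
        using m_int sub by (meson absolutely_integrable_on_subinterval set_lebesgue_integral_eq_integral(1))
      then have "?m m integrable_on {u k<..<v k}" by (simp add: integrable_on_Icc_iff_Ioo)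
      then show "(?i k) integrable_on {a..b}"
        using integrable_restrict_Int[of "{u k<..<v k}" "?m m" "{a..b}"] sub by metis
      show "integral {a..b} (?i k) = integral {u k..v k} (?m m)"
        unfolding integral_restrict_Int sub using integral_open_interval[of "u k" "v k" "?m m"] by simp
    qed
    have le: "dist (integral {a..u k} f) (integral {a..v k} f) \<le> m * (v k - u k) + integral {a..b} (?i k)" if "k < n" for k
    proof -
      have k: "a \<le> u k" "u k \<le> v k" "v k \<le> b" using uv that by auto
      have fi: "f absolutely_integrable_on {a..v k}" "f absolutely_integrable_on {u k..v k}"
        "?m m absolutely_integrable_on {u k..v k}"
        using absolutely_integrable_on_subinterval[OF f] absolutely_integrable_on_subinterval[OF m_int, of "u k" "v k"] k
        by (simp_all add: subset_iff)
      have "integral {a..u k} f + integral {u k..v k} f = integral {a..v k} f"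
        by (rule Henstock_Kurzweil_Integration.integral_combine) (use fi k in \<open>auto simp: absolutely_integrable_on_def\<close>)
      then have "dist (integral {a..u k} f) (integral {a..v k} f) = norm (integral {u k..v k} f)"
        by (metis add_diff_cancel_left' dist_norm norm_minus_commute)
      also have "\<dots> \<le> integral {u k..v k} (\<lambda>x. real m + ?m m x)"
        using fi by (intro Henstock_Kurzweil_Integration.integral_norm_bound_integral
            Henstock_Kurzweil_Integration.integrable_add)
          (auto simp: absolutely_integrable_on_def)
      also have "\<dots> = m * (v k - u k) + integral {u k..v k} (?m m)"
        using fi k by (subst Henstock_Kurzweil_Integration.integral_add) (auto simp: absolutely_integrable_on_def)
      finally show ?thesis using iint(2)[OF that] by simp
    qed
    have 1: "(\<Sum>k<n. dist (integral {a..u k} f) (integral {a..v k} f)) \<le>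
        (\<Sum>k<n. m * (v k - u k) + integral {a..b} (?i k))"
      by (rule sum_mono) (use le in auto)
    have 2: "(\<Sum>k<n. m * (v k - u k) + integral {a..b} (?i k)) = m * (\<Sum>k<n. v k - u k) + integral {a..b} (\<lambda>x. \<Sum>k<n. ?i k x)"
      using iint by (subst Henstock_Kurzweil_Integration.integral_sum) (auto simp: sum.distrib sum_distrib_left)
    have 3: "integral {a..b} (\<lambda>x. \<Sum>k<n. ?i k x) \<le> integral {a..b} (?m m)"
    proof (rule integral_le)
      show "(\<lambda>x. \<Sum>k<n. ?i k x) integrable_on {a..b}"
        by (rule integrable_sum) (use iint in auto)
      show "?m m integrable_on {a..b}"
        using m_int set_lebesgue_integral_eq_integral(1) by blast
      fix x
      show "(\<Sum>k<n. ?i k x) \<le> ?m m x"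
      proof (cases "\<exists>k<n. x \<in> {u k<..<v k}")
        case True
        then obtain k where k: "k < n" "x \<in> {u k<..<v k}" by blast
        have "x \<notin> {u l<..<v l}" if "l < n" "l \<noteq> k" for l
          using disj that k unfolding disjoint_family_on_def by blast
        then have "?i l x = 0" if "l < n" "l \<noteq> k" for l
          using that by (intro if_not_P) auto
        then have "(\<Sum>l<n. ?i l x) = (\<Sum>l\<in>{k}. ?i l x)"
          by (intro sum.mono_neutral_right) (use k in auto)
        then show ?thesis using k by simp
      next
        case False
        then have "(\<Sum>k<n. ?i k x) = 0" by (intro sum.neutral) auto
        then show ?thesis by simp
      qed
    qed
    have 4: "m * (\<Sum>k<n. v k - u k) \<le> m * \<delta>" using s by (intro mult_left_mono) auto
    have 5: "m * \<delta> < \<epsilon>/2"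
    proof -
      have "(real m + 1) * \<delta> = \<epsilon>/2" by (simp add: \<delta>_def field_simps)
      then show ?thesis using \<open>\<delta> > 0\<close> by (simp add: algebra_simps)
    qed
    show ?thesis using 1 2 3 4 5 m by linarith
  qed
  ultimately show "\<exists>\<delta>>0. \<forall>(n::nat) u v.
          (\<forall>k<n. a \<le> u k \<and> u k \<le> v k \<and> v k \<le> b) \<and> disjoint_family_on (\<lambda>k. {u k<..<v k}) {..<n} \<and>
          (\<Sum>k<n. v k - u k) < \<delta> \<longrightarrow>
          (\<Sum>k<n. dist (integral {a..u k} f) (integral {a..v k} f)) < \<epsilon>"
    by blast
qed

text \<open>Products, exponentials and functions that agree with a primitive on the half-line are
  all reduced to this comparison of increments.\<close>

lemma abs_cont_on_dominated:
  fixes F :: "real \<Rightarrow> 'a::metric_space" and G :: "real \<Rightarrow> 'b::metric_space" and H :: "real \<Rightarrow> 'c::metric_space"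
  assumes "abs_cont_on a b F" "abs_cont_on a b G" "C \<ge> 0"
    and le: "\<And>u v. u \<in> {a..b} \<Longrightarrow> v \<in> {a..b} \<Longrightarrow> dist (H u) (H v) \<le> C * (dist (F u) (F v) + dist (G u) (G v))"
  shows "abs_cont_on a b H"
  unfolding abs_cont_on_def
proof (intro allI impI)
  fix \<epsilon> :: real assume "\<epsilon> > 0"
  define e where "e = \<epsilon> / (2 * (C + 1))"
  have "e > 0" and e: "2 * (C + 1) * e = \<epsilon>" using \<open>\<epsilon> > 0\<close> \<open>C \<ge> 0\<close> by (auto simp: e_def)
  obtain d1 where "d1 > 0" and d1: "\<forall>(n::nat) u v. (\<forall>k<n. a \<le> u k \<and> u k \<le> v k \<and> v k \<le> b) \<and>
        disjoint_family_on (\<lambda>k. {u k<..<v k}) {..<n} \<and> (\<Sum>k<n. v k - u k) < d1 \<longrightarrow>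
        (\<Sum>k<n. dist (F (u k)) (F (v k))) < e"
    using assms(1)[unfolded abs_cont_on_def, THEN spec, THEN mp, OF \<open>e > 0\<close>] by (elim exE conjE)
  obtain d2 where "d2 > 0" and d2: "\<forall>(n::nat) u v. (\<forall>k<n. a \<le> u k \<and> u k \<le> v k \<and> v k \<le> b) \<and>
        disjoint_family_on (\<lambda>k. {u k<..<v k}) {..<n} \<and> (\<Sum>k<n. v k - u k) < d2 \<longrightarrow>
        (\<Sum>k<n. dist (G (u k)) (G (v k))) < e"
    using assms(2)[unfolded abs_cont_on_def, THEN spec, THEN mp, OF \<open>e > 0\<close>] by (elim exE conjE)
  show "\<exists>\<delta>>0. \<forall>(n::nat) u v. (\<forall>k<n. a \<le> u k \<and> u k \<le> v k \<and> v k \<le> b) \<and>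
        disjoint_family_on (\<lambda>k. {u k<..<v k}) {..<n} \<and> (\<Sum>k<n. v k - u k) < \<delta> \<longrightarrow>
        (\<Sum>k<n. dist (H (u k)) (H (v k))) < \<epsilon>"
  proof (intro exI[of _ "min d1 d2"] conjI allI impI)
    show "min d1 d2 > 0" using \<open>d1 > 0\<close> \<open>d2 > 0\<close> by simp
    fix n :: nat and u v
    assume *: "(\<forall>k<n. a \<le> u k \<and> u k \<le> v k \<and> v k \<le> b) \<and>
        disjoint_family_on (\<lambda>k. {u k<..<v k}) {..<n} \<and> (\<Sum>k<n. v k - u k) < min d1 d2"
    have "(\<Sum>k<n. dist (H (u k)) (H (v k))) \<le> (\<Sum>k<n. C * (dist (F (u k)) (F (v k)) + dist (G (u k)) (G (v k))))"
    proof (rule sum_mono)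
      fix k assume "k \<in> {..<n}"
      then show "dist (H (u k)) (H (v k)) \<le> C * (dist (F (u k)) (F (v k)) + dist (G (u k)) (G (v k)))"
        using * by (intro le) force+
    qed
    moreover have "(\<Sum>k<n. C * (dist (F (u k)) (F (v k)) + dist (G (u k)) (G (v k)))) =
        C * ((\<Sum>k<n. dist (F (u k)) (F (v k))) + (\<Sum>k<n. dist (G (u k)) (G (v k))))"
      by (simp add: sum_distrib_left sum.distrib algebra_simps)
    moreover have "(\<Sum>k<n. dist (F (u k)) (F (v k))) + (\<Sum>k<n. dist (G (u k)) (G (v k))) \<le> 2 * e"
      using * d1[THEN spec, of n, THEN spec, of u, THEN spec, of v] d2[THEN spec, of n, THEN spec, of u, THEN spec, of v]
      by simp
    then have "C * ((\<Sum>k<n. dist (F (u k)) (F (v k))) + (\<Sum>k<n. dist (G (u k)) (G (v k)))) \<le> C * (2 * e)"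
      using \<open>C \<ge> 0\<close> by (rule mult_left_mono)
    moreover have "C * (2 * e) < \<epsilon>" using e \<open>e > 0\<close> by (simp add: algebra_simps)
    ultimately show "(\<Sum>k<n. dist (H (u k)) (H (v k))) < \<epsilon>" by linarith
  qed
qed

lemma continuous_on_Icc_bounded:
  fixes f :: "real \<Rightarrow> 'a::real_normed_vector"
  assumes "continuous_on {a..b} f"
  shows "\<exists>B. \<forall>x\<in>{a..b}. norm (f x) \<le> B"
  using compact_imp_bounded[OF compact_continuous_image[OF assms compact_Icc]]
  unfolding bounded_iff by simp

lemma continuous_on_half_lineI:
  fixes f :: "real \<Rightarrow> 'a::topological_space"
  assumes "\<And>T. T > 0 \<Longrightarrow> continuous_on {0..T} f"
  shows "continuous_on {0..} f"
  unfolding continuous_on_eq_continuous_within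
proof
  fix x :: real assume "x \<in> {0..}"
  then have "continuous (at x within {0..x+1}) f"
    using assms[of "x + 1"] by (simp add: continuous_on_eq_continuous_within)
  moreover have "at x within {0..x+1} = at x within {0..}"
    by (rule at_within_nhd[of _ "{..<x+1}"]) auto
  ultimately show "continuous (at x within {0..}) f" by simp
qed

text \<open>\<open>F\<close> is an indefinite integral of \<open>f\<close> on the closed half-line; values at negative
  arguments are irrelevant.\<close>

definition primitive :: "(real \<Rightarrow> 'a::euclidean_space) \<Rightarrow> (real \<Rightarrow> 'a) \<Rightarrow> bool" where
  "primitive F f \<longleftrightarrow> (\<forall>x\<ge>0. f absolutely_integrable_on {0..x} \<and> F x = F 0 + integral {0..x} f)"

section \<open>Calculus of indefinite integrals\<close>

lemma primitive_eq:
  assumes "primitive F f" "0 \<le> x"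
  shows "F x = F 0 + integral {0..x} f"
  by (rule primitive_def[THEN iffD1, THEN spec, THEN mp, THEN conjunct2, OF assms])

lemma primitive_integrable:
  assumes "primitive F f" "0 \<le> a"
  shows "f absolutely_integrable_on {a..b}"
proof (cases "b \<ge> 0")
  case True
  then have "f absolutely_integrable_on {0..b}"
    by (rule primitive_def[THEN iffD1, THEN spec, THEN mp, THEN conjunct1, OF assms(1)])
  then show ?thesis by (rule absolutely_integrable_on_subinterval) (use assms in auto)
next
  case False
  then show ?thesis using assms by simp
qed

lemma primitive_integrable_on:
  assumes "primitive F f" "0 \<le> a"
  shows "f integrable_on {a..b}"
  by (rule absolutely_integrable_on_def[THEN iffD1, THEN conjunct1, OF primitive_integrable[OF assms]])

lemma primitive_diff_eq:
  assumes "primitive F f" "0 \<le> a" "a \<le> b"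
  shows "F b - F a = integral {a..b} f"
proof -
  have "f integrable_on {0..b}"
    by (rule primitive_integrable_on[OF assms(1)]) simp
  then have "integral {0..a} f + integral {a..b} f = integral {0..b} f"
    by (rule Henstock_Kurzweil_Integration.integral_combine[OF assms(2,3)])
  moreover have "F a = F 0 + integral {0..a} f" "F b = F 0 + integral {0..b} f"
    by (rule primitive_eq[OF assms(1)], use assms in simp)+
  ultimately show ?thesis by (simp add: algebra_simps)
qed

lemma primitive_integral:
  assumes "\<And>T. T \<ge> 0 \<Longrightarrow> f absolutely_integrable_on {0..T}"
  shows "primitive (\<lambda>x. c + integral {0..x} f) f"
  using assms by (auto simp: primitive_def)

lemma primitive_continuous_on:
  assumes "primitive F f"
  shows "continuous_on {0..} F"
proof (rule continuous_on_half_lineI)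
  fix T :: real assume "T > 0"
  have "continuous_on {0..T} (\<lambda>x. F 0 + integral {0..x} f)"
    by (intro continuous_on_add continuous_on_const indefinite_integral_continuous_1 primitive_integrable_on[OF assms]) simp
  then show "continuous_on {0..T} F"
    by (rule continuous_on_eq) (rule primitive_eq[OF assms, symmetric], simp)
qed

lemma primitive_continuous_on_Icc:
  assumes "primitive F f"
  shows "continuous_on {0..T} F"
  by (rule continuous_on_subset[OF primitive_continuous_on[OF assms]]) auto

lemma primitive_abs_cont_on:
  assumes "primitive F f"
  shows "abs_cont_on 0 T F"
proof (rule abs_cont_on_dominated[of 0 T "\<lambda>x. integral {0..x} f" "\<lambda>x. integral {0..x} f" 1])
  show *: "abs_cont_on 0 T (\<lambda>x. integral {0..x} f)"
    by (rule abs_cont_on_indefinite_integral[OF primitive_integrable[OF assms]]) simp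
  show "abs_cont_on 0 T (\<lambda>x. integral {0..x} f)" by (rule *)
  fix u v assume uv: "u \<in> {0..T}" "v \<in> {0..T}"
  then have "F u = F 0 + integral {0..u} f" "F v = F 0 + integral {0..v} f"
    using primitive_eq[OF assms, of u] primitive_eq[OF assms, of v] by auto
  then have "dist (F u) (F v) = dist (integral {0..u} f) (integral {0..v} f)"
    by (simp add: dist_norm)
  then show "dist (F u) (F v) \<le> 1 * (dist (integral {0..u} f) (integral {0..v} f) + dist (integral {0..u} f) (integral {0..v} f))"
    by simp
qed simp

lemma AE_lebesgue_iff_negligible:
  "(AE x in lebesgue. P x) \<longleftrightarrow> (\<exists>N. negligible N \<and> (\<forall>x. x \<notin> N \<longrightarrow> P x))"
  by (subst eventually_ae_filter_negligible) auto

lemma abs_cont_on_imp_primitive: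
  fixes F :: "real \<Rightarrow> 'a::euclidean_space"
  assumes ac: "\<And>T. T > 0 \<Longrightarrow> abs_cont_on 0 T F"
    and ae: "AE x in lebesgue. x > 0 \<longrightarrow> (F has_vector_derivative f x) (at x)"
    and int: "\<And>T. T > 0 \<Longrightarrow> f absolutely_integrable_on {0..T}"
  shows "primitive F f"
  unfolding primitive_def
proof (intro allI impI)
  fix x :: real assume "x \<ge> 0"
  show "f absolutely_integrable_on {0..x} \<and> F x = F 0 + integral {0..x} f"
  proof (cases "x = 0")
    case False
    then have "x > 0" using \<open>x \<ge> 0\<close> by simp
    obtain N where N: "negligible N" "\<forall>y. y \<notin> N \<longrightarrow> y > 0 \<longrightarrow> (F has_vector_derivative f y) (at y)"
      using ae unfolding AE_lebesgue_iff_negligible by (elim exE conjE)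
    have "(f has_integral (F x - F 0)) {0..x}"
    proof (rule abs_cont_on_has_integral[OF \<open>x \<ge> 0\<close> ac[OF \<open>x > 0\<close>]])
      \<comment> \<open>The point 0 joins the exceptional set, since derivatives are assumed only at
        positive arguments.\<close>
      show "negligible (insert 0 N)" using N(1) by simp
      show "(F has_vector_derivative f y) (at y within {0..x})" if "y \<in> {0..x} - insert 0 N" for y
      proof -
        have y: "y \<notin> N" "y > 0" using that by auto
        show ?thesis
          by (rule has_vector_derivative_at_within[OF N(2)[THEN spec, THEN mp, OF y(1), THEN mp, OF y(2)]])
      qed
    qed
    from integral_unique[OF this] show ?thesis using int[OF \<open>x > 0\<close>] by simp
  next
    case True
    then show ?thesis using absolutely_integrable_on_subinterval[OF int[of 1], of 0 0] by simp
  qed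
qed

lemma negligible_uminus_image:
  fixes N :: "real set"
  assumes "negligible N"
  shows "negligible (uminus ` N)"
  by (rule negligible_differentiable_image_negligible[OF _ assms])
    (auto intro!: derivative_intros simp: differentiable_on_def)

text \<open>The one-dimensional case of Lebesgue differentiation over cubes with a fixed corner. It
  sees only increments \<open>h > 0\<close>; left increments are reached by applying it to the
  reflected function.\<close>

lemma integrable_right_derivative:
  fixes f :: "real \<Rightarrow> 'a::euclidean_space"
  assumes "\<And>a b. f integrable_on {a..b}"
  shows "\<exists>N. negligible N \<and> (\<forall>x e. x \<notin> N \<longrightarrow> 0 < e \<longrightarrow>
     (\<exists>d>0. \<forall>h. 0 < h \<and> h < d \<longrightarrow> norm (integral {x..x + h} f /\<^sub>R h - f x) < e))"
proof (rule integrable_ccontinuous_explicit[of f])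
  show "f integrable_on cbox a b" for a b
    using assms by simp
  fix N assume "negligible N" and N: "\<And>x e. x \<notin> N \<Longrightarrow> 0 < e \<Longrightarrow>
    \<exists>d>0. \<forall>h. 0 < h \<and> h < d \<longrightarrow> norm (integral (cbox x (x + h *\<^sub>R One)) f /\<^sub>R h ^ DIM(real) - f x) < e"
  show ?thesis
  proof (intro exI[of _ N] conjI allI impI \<open>negligible N\<close>)
    fix x e :: real assume "x \<notin> N" "0 < e"
    from N[OF this] show "\<exists>d>0. \<forall>h. 0 < h \<and> h < d \<longrightarrow> norm (integral {x..x + h} f /\<^sub>R h - f x) < e"
      by simp
  qed
qed

text \<open>Lebesgue differentiation from both sides: right quotients come from \<open>f\<close> at
  x, left ones from the reflected integrand at -x. Extension by zero makes the integrand integrable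
  on every compact interval, as the one-sided lemma demands.\<close>

lemma primitive_AE_deriv:
  assumes F: "primitive F f"
  shows "AE x in lebesgue. x > 0 \<longrightarrow> (F has_vector_derivative f x) (at x)"
proof -
  define f' where "f' x = (if x \<in> {0..} then f x else 0)" for x
  have f': "f' integrable_on {a..b}" for a b
  proof -
    have "{0..} \<inter> {a..b} = {max 0 a..b}" by auto
    moreover have "f integrable_on {max 0 a..b}"
      by (rule primitive_integrable_on[OF F]) simp
    ultimately show ?thesis
      using integrable_restrict_Int[of "{0..}" f "{a..b}"] by (simp add: f'_def[abs_def])
  qed
  obtain N1 where N1: "negligible N1" "\<forall>x e. x \<notin> N1 \<longrightarrow> 0 < e \<longrightarrow>
     (\<exists>d>0. \<forall>h. 0 < h \<and> h < d \<longrightarrow> norm (integral {x..x + h} f' /\<^sub>R h - f' x) < e)"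
    using integrable_right_derivative[of f', OF f'] by (elim exE conjE)
  have g': "(\<lambda>x. f' (- x)) integrable_on {a..b}" for a b
    using f'[of "- b" "- a"] Henstock_Kurzweil_Integration.integrable_reflect_real[of f' "-a" "-b"] by simp
  obtain N2 where N2: "negligible N2" "\<forall>x e. x \<notin> N2 \<longrightarrow> 0 < e \<longrightarrow>
     (\<exists>d>0. \<forall>h. 0 < h \<and> h < d \<longrightarrow> norm (integral {x..x + h} (\<lambda>x. f' (- x)) /\<^sub>R h - f' (- x)) < e)"
    using integrable_right_derivative[of "\<lambda>x. f' (- x)", OF g'] by (elim exE conjE)
  have "(F has_vector_derivative f x) (at x)" if x: "x \<notin> N1 \<union> uminus ` N2" "x > 0" for x
    unfolding has_vector_derivative_def has_derivative_at_alt
  proof (intro conjI allI impI)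
    show "bounded_linear (\<lambda>h. h *\<^sub>R f x)" by (rule bounded_linear_scaleR_left)
    fix e :: real assume "e > 0"
    have x1: "x \<notin> N1" and x': "- x \<notin> N2" using x by (auto dest: imageI[of _ _ uminus])
    obtain d1 where d1: "d1 > 0" "\<forall>h. 0 < h \<and> h < d1 \<longrightarrow> norm (integral {x..x + h} f' /\<^sub>R h - f' x) < e"
      using N1(2)[THEN spec, of x, THEN spec, of e, THEN mp, OF x1, THEN mp, OF \<open>e > 0\<close>] by (elim exE conjE)
    obtain d2 where d2: "d2 > 0" "\<forall>h. 0 < h \<and> h < d2 \<longrightarrow>
        norm (integral {-x..-x + h} (\<lambda>x. f' (- x)) /\<^sub>R h - f' (- (- x))) < e"
      using N2(2)[THEN spec, of "-x", THEN spec, of e, THEN mp, OF x', THEN mp, OF \<open>e > 0\<close>] by (elim exE conjE)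
    have est: "norm (I - h *\<^sub>R f x) \<le> e * h" if "norm (I /\<^sub>R h - f x) < e" "h > 0" for I :: 'a and h :: real
    proof -
      have "I - h *\<^sub>R f x = h *\<^sub>R (I /\<^sub>R h - f x)" using \<open>h > 0\<close> by (simp add: algebra_simps)
      then have "norm (I - h *\<^sub>R f x) = h * norm (I /\<^sub>R h - f x)"
        using \<open>h > 0\<close> by (metis abs_of_pos norm_scaleR)
      then show ?thesis using that by simp
    qed
    have I: "integral {a..b} f' = integral {a..b} f" if "a > 0" for a b :: real
      by (rule Henstock_Kurzweil_Integration.integral_cong) (use that in \<open>auto simp: f'_def\<close>)
    have f'x: "f' x = f x" using x by (simp add: f'_def)
    show "\<exists>d>0. \<forall>y. norm (y - x) < d \<longrightarrow> norm (F y - F x - (y - x) *\<^sub>R f x) \<le> e * norm (y - x)"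
    proof (intro exI[of _ "min x (min d1 d2)"] conjI allI impI)
      show "0 < min x (min d1 d2)" using x d1 d2 by simp
      fix y assume y: "norm (y - x) < min x (min d1 d2)"
      then have "y > 0" by (auto simp: abs_if split: if_splits)
      consider "y = x" | "y > x" | "y < x" by linarith
      then show "norm (F y - F x - (y - x) *\<^sub>R f x) \<le> e * norm (y - x)"
      proof cases
        case 2
        have "F y - F x = integral {x..y} f" by (rule primitive_diff_eq[OF F]) (use x 2 in auto)
        moreover have "norm (integral {x..y} f' /\<^sub>R (y - x) - f' x) < e"
          using d1(2)[THEN spec, of "y - x"] y 2 by simp
        ultimately show ?thesis
          using est[where I="F y - F x" and h="y - x"] I[of x y] x 2 f'x by simp
      next
        case 3
        have "F x - F y = integral {y..x} f" by (rule primitive_diff_eq[OF F]) (use \<open>y > 0\<close> 3 in auto)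
        moreover have "norm (integral {-x..-y} (\<lambda>x. f' (- x)) /\<^sub>R (x - y) - f' x) < e"
          using d2(2)[THEN spec, of "x - y"] y 3 by simp
        ultimately have "norm ((F x - F y) - (x - y) *\<^sub>R f x) \<le> e * (x - y)"
          using est[where I="F x - F y" and h="x - y"] I[of y x] \<open>y > 0\<close> 3 f'x by simp
        moreover have "F y - F x - (y - x) *\<^sub>R f x = - ((F x - F y) - (x - y) *\<^sub>R f x)"
          by (simp add: algebra_simps)
        then have "norm (F y - F x - (y - x) *\<^sub>R f x) = norm ((F x - F y) - (x - y) *\<^sub>R f x)"
          by (metis norm_minus_cancel)
        ultimately show ?thesis using 3 by simp
      qed simp
    qed
  qed
  moreover have "negligible (N1 \<union> uminus ` N2)"
    using N1 N2 negligible_uminus_image by auto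
  ultimately show ?thesis
    unfolding AE_lebesgue_iff_negligible by (intro exI[of _ "N1 \<union> uminus ` N2"]) simp
qed

lemma primitive_AE_unique:
  assumes "primitive F f" "primitive F g"
  shows "AE x in lebesgue. x > 0 \<longrightarrow> f x = g x"
  using primitive_AE_deriv[OF assms(1)] primitive_AE_deriv[OF assms(2)]
  by eventually_elim (auto dest: vector_derivative_unique_at)

lemma primitive_AE_cong:
  assumes "primitive F f" "AE x in lebesgue. x > 0 \<longrightarrow> f x = g x"
  shows "primitive F g"
proof -
  obtain N where N: "negligible N" "\<forall>x. x \<notin> N \<longrightarrow> x > 0 \<longrightarrow> f x = g x"
    using assms(2) unfolding AE_lebesgue_iff_negligible by (elim exE conjE)
  have N0: "negligible (insert 0 N)" using N by simp
  show ?thesis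
    unfolding primitive_def
  proof (intro allI impI conjI)
    fix x :: real assume "x \<ge> 0"
    have f: "f absolutely_integrable_on {0..x}" "F x = F 0 + integral {0..x} f"
      using primitive_integrable[OF assms(1), of 0 x] primitive_eq[OF assms(1) \<open>x \<ge> 0\<close>] by auto
    have eq: "g y = f y" if "y \<in> {0..x} - insert 0 N" for y
      using N(2) that by auto
    show "g absolutely_integrable_on {0..x}"
      by (rule absolutely_integrable_spike[OF f(1) N0 eq])
    show "F x = F 0 + integral {0..x} g"
    proof -
      have "integral {0..x} f = integral {0..x} g" by (rule integral_spike[OF N0]) (rule eq)
      then show ?thesis using f(2) by simp
    qed
  qed
qed

lemma primitive_cong:
  assumes "primitive F f" "\<And>x. x \<ge> 0 \<Longrightarrow> F x = G x" "\<And>x. x \<ge> 0 \<Longrightarrow> f x = g x"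
  shows "primitive G g"
proof -
  have "primitive G f"
    unfolding primitive_def
  proof (intro allI impI conjI)
    fix x :: real assume "x \<ge> 0"
    show "f absolutely_integrable_on {0..x}" by (rule primitive_integrable[OF assms(1)]) simp
    show "G x = G 0 + integral {0..x} f"
      using primitive_eq[OF assms(1) \<open>x \<ge> 0\<close>] assms(2)[OF \<open>x \<ge> 0\<close>] assms(2)[of 0] by simp
  qed
  then show ?thesis by (rule primitive_AE_cong) (use assms(3) in auto)
qed

lemma primitive_const [simp]: "primitive (\<lambda>x. c) (\<lambda>x. 0)"
  by (simp add: primitive_def)

lemma primitive_zero_imp_const:
  assumes "primitive F (\<lambda>x. 0)" "x \<ge> 0"
  shows "F x = F 0"
  using primitive_eq[OF assms] by simp

lemma primitive_linear:
  assumes "bounded_linear L" "primitive F f"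
  shows "primitive (\<lambda>x. L (F x)) (\<lambda>x. L (f x))"
  unfolding primitive_def
proof (intro allI impI conjI)
  fix x :: real assume "x \<ge> 0"
  then have f: "f absolutely_integrable_on {0..x}" "F x = F 0 + integral {0..x} f"
    using primitive_integrable[OF assms(2), of 0 x] primitive_eq[OF assms(2), of x] by auto
  then show "(\<lambda>x. L (f x)) absolutely_integrable_on {0..x}"
    using absolutely_integrable_linear[OF f(1) assms(1)] by (simp add: o_def)
  have "integral {0..x} (\<lambda>x. L (f x)) = L (integral {0..x} f)"
    using integral_linear[OF _ assms(1), of f "{0..x}"] f(1) by (simp add: o_def absolutely_integrable_on_def)
  then show "L (F x) = L (F 0) + integral {0..x} (\<lambda>x. L (f x))"
    using f(2) by (simp add: linear_add[OF bounded_linear.linear[OF assms(1)]])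
qed

lemma primitive_add:
  assumes "primitive F f" "primitive G g"
  shows "primitive (\<lambda>x. F x + G x) (\<lambda>x. f x + g x)"
  unfolding primitive_def
proof (intro allI impI conjI)
  fix x :: real assume "x \<ge> 0"
  then have f: "f absolutely_integrable_on {0..x}" "F x = F 0 + integral {0..x} f"
     and g: "g absolutely_integrable_on {0..x}" "G x = G 0 + integral {0..x} g"
    using primitive_integrable[OF assms(1), of 0 x] primitive_eq[OF assms(1), of x]
      primitive_integrable[OF assms(2), of 0 x] primitive_eq[OF assms(2), of x] by auto
  then show "(\<lambda>x. f x + g x) absolutely_integrable_on {0..x}" by simp
  show "F x + G x = F 0 + G 0 + integral {0..x} (\<lambda>x. f x + g x)"
    using f g by (subst Henstock_Kurzweil_Integration.integral_add) (auto simp: absolutely_integrable_on_def)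
qed

lemma primitive_minus: "primitive F f \<Longrightarrow> primitive (\<lambda>x. - F x) (\<lambda>x. - f x)"
  by (rule primitive_linear[OF bounded_linear_minus[OF bounded_linear_ident]])

lemma primitive_diff:
  assumes "primitive F f" "primitive G g"
  shows "primitive (\<lambda>x. F x - G x) (\<lambda>x. f x - g x)"
  using primitive_add[OF assms(1) primitive_minus[OF assms(2)]] by simp

lemma primitive_Pair:
  assumes "primitive F f" "primitive G g"
  shows "primitive (\<lambda>x. (F x, G x)) (\<lambda>x. (f x, g x))"
proof -
  have "bounded_linear (\<lambda>a. (a, 0::'d))" "bounded_linear (\<lambda>b. (0::'c, b))" 
    for x :: "'c::euclidean_space" and y :: "'d::euclidean_space"
    by (auto intro!: bounded_linear_intros)
  from primitive_add[OF primitive_linear[OF this(1) assms(1)] primitive_linear[OF this(2) assms(2)]]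
  show ?thesis by simp
qed

lemma primitive_fst: "primitive F f \<Longrightarrow> primitive (\<lambda>x. fst (F x)) (\<lambda>x. fst (f x))"
  and primitive_snd: "primitive F f \<Longrightarrow> primitive (\<lambda>x. snd (F x)) (\<lambda>x. snd (f x))"
  by (auto intro: primitive_linear bounded_linear_fst bounded_linear_snd)

lemma absolutely_integrable_bilinear:
  fixes h :: "'a::euclidean_space \<Rightarrow> 'b::euclidean_space \<Rightarrow> 'c::euclidean_space"
  assumes "bounded_bilinear h" "continuous_on {a..b::real} F" "g absolutely_integrable_on {a..b}"
  shows "(\<lambda>x. h (F x) (g x)) absolutely_integrable_on {a..b}"
proof (rule absolutely_integrable_bounded_measurable_product[of h])
  show "bilinear h" using assms(1) by (simp add: bilinear_conv_bounded_bilinear)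
  show "F \<in> borel_measurable (lebesgue_on {a..b})"
    by (rule continuous_imp_measurable_on_sets_lebesgue[OF assms(2)]) simp
  show "bounded (F ` {a..b})"
    by (rule compact_imp_bounded[OF compact_continuous_image[OF assms(2)]]) simp
qed (use assms in auto)

lemma absolutely_integrable_bilinear':
  fixes h :: "'a::euclidean_space \<Rightarrow> 'b::euclidean_space \<Rightarrow> 'c::euclidean_space"
  assumes "bounded_bilinear h" "g absolutely_integrable_on {a..b}" "continuous_on {a..b::real} F"
  shows "(\<lambda>x. h (g x) (F x)) absolutely_integrable_on {a..b}"
  using absolutely_integrable_bilinear[OF bounded_bilinear.flip[OF assms(1)] assms(3,2)] .

text \<open>On compact intervals the factors are bounded, so the increments of the product are
  dominated by those of the factors and the product is absolutely continuous; almost everywhere its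
  derivative is given by the classical product rule. It is applied to matrix products and to complex
  scalars alike.\<close>

lemma primitive_bilinear:
  fixes h :: "'a::euclidean_space \<Rightarrow> 'b::euclidean_space \<Rightarrow> 'c::euclidean_space"
  assumes h: "bounded_bilinear h" and F: "primitive F f" and G: "primitive G g"
  shows "primitive (\<lambda>x. h (F x) (G x)) (\<lambda>x. h (F x) (g x) + h (f x) (G x))"
proof (rule abs_cont_on_imp_primitive)
  interpret bounded_bilinear h by fact
  fix T :: real assume "T > 0"
  have cF: "continuous_on {0..T} F" and cG: "continuous_on {0..T} G"
    by (rule primitive_continuous_on_Icc[OF F], rule primitive_continuous_on_Icc[OF G])
  show "(\<lambda>x. h (F x) (g x) + h (f x) (G x)) absolutely_integrable_on {0..T}"
    by (intro set_integral_add absolutely_integrable_bilinear[OF h cF] absolutely_integrable_bilinear'[OF h _ cG]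
        primitive_integrable[OF F] primitive_integrable[OF G]) auto
  obtain K where K: "K \<ge> 0" "\<And>a b. norm (h a b) \<le> norm a * norm b * K"
    using nonneg_bounded by blast
  obtain BF where "\<forall>x\<in>{0..T}. norm (F x) \<le> BF"
    using continuous_on_Icc_bounded[OF cF] by (elim exE)
  then have BF: "\<And>x. x \<in> {0..T} \<Longrightarrow> norm (F x) \<le> BF" by (rule bspec)
  obtain BG where "\<forall>x\<in>{0..T}. norm (G x) \<le> BG"
    using continuous_on_Icc_bounded[OF cG] by (elim exE)
  then have BG: "\<And>x. x \<in> {0..T} \<Longrightarrow> norm (G x) \<le> BG" by (rule bspec)
  have "BF \<ge> 0" "BG \<ge> 0" using \<open>T > 0\<close>
    by (auto intro: order_trans[OF norm_ge_zero BF[of 0]] order_trans[OF norm_ge_zero BG[of 0]])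
  show "abs_cont_on 0 T (\<lambda>x. h (F x) (G x))"
  proof (rule abs_cont_on_dominated[OF primitive_abs_cont_on[OF F] primitive_abs_cont_on[OF G], of "(BF + BG) * K"])
    show "0 \<le> (BF + BG) * K" using K \<open>BF \<ge> 0\<close> \<open>BG \<ge> 0\<close> by simp
    fix u v assume uv: "u \<in> {0..T}" "v \<in> {0..T}"
    have "h (F u) (G u) - h (F v) (G v) = h (F u) (G u - G v) + h (F u - F v) (G v)"
      by (simp add: diff_left diff_right)
    then have "dist (h (F u) (G u)) (h (F v) (G v)) \<le> norm (h (F u) (G u - G v)) + norm (h (F u - F v) (G v))"
      unfolding dist_norm by (simp add: norm_triangle_ineq)
    also have "\<dots> \<le> BF * dist (G u) (G v) * K + dist (F u) (F v) * BG * K"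
    proof (rule add_mono)
      show "norm (h (F u) (G u - G v)) \<le> BF * dist (G u) (G v) * K"
        by (rule order_trans[OF K(2)]) (intro mult_right_mono K(1), auto simp: dist_norm intro!: mult_right_mono BF uv)
      show "norm (h (F u - F v) (G v)) \<le> dist (F u) (F v) * BG * K"
        by (rule order_trans[OF K(2)]) (intro mult_right_mono K(1), auto simp: dist_norm intro!: mult_left_mono BG uv)
    qed
    also have "\<dots> \<le> (BF + BG) * K * (dist (F u) (F v) + dist (G u) (G v))"
      using K(1) \<open>BF \<ge> 0\<close> \<open>BG \<ge> 0\<close> by (simp add: algebra_simps)
    finally show "dist (h (F u) (G u)) (h (F v) (G v)) \<le> (BF + BG) * K * (dist (F u) (F v) + dist (G u) (G v))" .
  qed
next
  show "AE x in lebesgue. x > 0 \<longrightarrow> ((\<lambda>x. h (F x) (G x)) has_vector_derivative h (F x) (g x) + h (f x) (G x)) (at x)"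
    using primitive_AE_deriv[OF F] primitive_AE_deriv[OF G]
    by eventually_elim (auto intro: bounded_bilinear.has_vector_derivative[OF h])
qed

lemma primitive_of_derivative:
  fixes F :: "real \<Rightarrow> 'a::euclidean_space"
  assumes "\<And>x. x \<ge> 0 \<Longrightarrow> (F has_vector_derivative f x) (at x within {0..})" "continuous_on {0..} f"
  shows "primitive F f"
  unfolding primitive_def
proof (intro allI impI conjI)
  fix x :: real assume "x \<ge> 0"
  show "f absolutely_integrable_on {0..x}"
    by (rule absolutely_integrable_continuous_real) (rule continuous_on_subset[OF assms(2)], auto)
  have "(f has_integral (F x - F 0)) {0..x}"
    by (rule fundamental_theorem_of_calculus[OF \<open>x \<ge> 0\<close>])
      (rule has_vector_derivative_within_subset[OF assms(1)], auto)
  from integral_unique[OF this] show "F x = F 0 + integral {0..x} f" by simp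
qed

lemma primitive_has_vector_derivative:
  assumes F: "primitive F f" and f: "continuous_on {0..} f" and "x \<ge> 0"
  shows "(F has_vector_derivative f x) (at x within {0..})"
proof -
  have "continuous_on {0..x+1} f" by (rule continuous_on_subset[OF f]) auto
  then have "((\<lambda>u. integral {0..u} f) has_vector_derivative f x) (at x within {0..x+1})"
    using \<open>x \<ge> 0\<close> by (intro integral_has_vector_derivative) auto
  then have "((\<lambda>u. F 0 + integral {0..u} f) has_vector_derivative f x) (at x within {0..x+1})"
    by (auto intro!: derivative_eq_intros)
  then have "(F has_vector_derivative f x) (at x within {0..x+1})"
    by (rule has_vector_derivative_transform[rotated 2])
      (use primitive_eq[OF F, symmetric] \<open>x \<ge> 0\<close> in auto)
  moreover have "at x within {0..x+1} = at x within {0..}"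
    using \<open>x \<ge> 0\<close> by (intro at_within_nhd[of _ "{..<x+1}"]) auto
  ultimately show ?thesis by simp
qed

lemma primitive_norm_le:
  assumes F: "primitive F f" and G: "primitive G g" and "0 \<le> a" "a \<le> b"
    and le: "\<And>t. t \<in> {a..b} \<Longrightarrow> norm (f t) \<le> g t"
  shows "norm (F b - F a) \<le> G b - G a"
  unfolding primitive_diff_eq[OF F \<open>0 \<le> a\<close> \<open>a \<le> b\<close>] primitive_diff_eq[OF G \<open>0 \<le> a\<close> \<open>a \<le> b\<close>]
  by (rule Henstock_Kurzweil_Integration.integral_norm_bound_integral[OF primitive_integrable_on[OF F \<open>0 \<le> a\<close>]
        primitive_integrable_on[OF G \<open>0 \<le> a\<close>] le])

text \<open>Chain rule for the weights of the Volterra estimates, where \<sigma> is only absolutely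
  continuous: exp is Lipschitz on the bounded range of \<open>c * \<sigma>\<close>.\<close>

lemma primitive_exp:
  fixes \<sigma> a :: "real \<Rightarrow> real"
  assumes \<sigma>: "primitive \<sigma> a"
  shows "primitive (\<lambda>x. exp (c * \<sigma> x)) (\<lambda>x. exp (c * \<sigma> x) * (c * a x))"
proof (rule abs_cont_on_imp_primitive)
  have c\<sigma>: "primitive (\<lambda>x. c * \<sigma> x) (\<lambda>x. c * a x)"
    by (rule primitive_linear[OF bounded_linear_mult_right \<sigma>])
  fix T :: real assume "T > 0"
  have cont: "continuous_on {0..T} (\<lambda>x. c * \<sigma> x)"
    using primitive_continuous_on_Icc[OF c\<sigma>] .
  then have "continuous_on {0..T} (\<lambda>x. exp (c * \<sigma> x))" by (rule continuous_on_exp)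
  then show "(\<lambda>x. exp (c * \<sigma> x) * (c * a x)) absolutely_integrable_on {0..T}"
    by (intro absolutely_integrable_bilinear[OF bounded_bilinear_mult] primitive_integrable[OF c\<sigma>]) auto
  obtain B where "\<forall>x\<in>{0..T}. norm (c * \<sigma> x) \<le> B"
    using continuous_on_Icc_bounded[OF cont] by (elim exE)
  then have B: "\<And>x. x \<in> {0..T} \<Longrightarrow> norm (c * \<sigma> x) \<le> B" by (rule bspec)
  show "abs_cont_on 0 T (\<lambda>x. exp (c * \<sigma> x))"
  proof (rule abs_cont_on_dominated[OF primitive_abs_cont_on[OF c\<sigma>] primitive_abs_cont_on[OF c\<sigma>], of "exp B"])
    fix u v assume uv: "u \<in> {0..T}" "v \<in> {0..T}"
    have lip: "\<bar>exp s - exp t\<bar> \<le> exp B * \<bar>s - t\<bar>" if "s \<le> B" "t \<le> B" for s t :: real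
    proof -
      have key: "exp t - exp s \<le> exp B * (t - s)" if "s \<le> t" "t \<le> B" for s t :: real
      proof -
        have "1 + (s - t) \<le> exp (s - t)" by (rule exp_ge_add_one_self)
        then have "1 - exp (s - t) \<le> t - s" by linarith
        then have "exp t * (1 - exp (s - t)) \<le> exp t * (t - s)" by (rule mult_left_mono) simp
        also have "\<dots> \<le> exp B * (t - s)" using that by (intro mult_right_mono) auto
        finally show ?thesis by (simp add: algebra_simps exp_diff)
      qed
      show ?thesis using key[of s t] key[of t s] that by (cases "s \<le> t") (auto simp: abs_if)
    qed
    have "\<bar>exp (c * \<sigma> u) - exp (c * \<sigma> v)\<bar> \<le> exp B * \<bar>c * \<sigma> u - c * \<sigma> v\<bar>"
      by (rule lip) (use B[OF uv(1)] B[OF uv(2)] in auto)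
    also have "\<dots> \<le> exp B * (\<bar>c * \<sigma> u - c * \<sigma> v\<bar> + \<bar>c * \<sigma> u - c * \<sigma> v\<bar>)" by simp
    finally show "dist (exp (c * \<sigma> u)) (exp (c * \<sigma> v)) \<le> exp B * (dist (c * \<sigma> u) (c * \<sigma> v) + dist (c * \<sigma> u) (c * \<sigma> v))"
      by (simp add: dist_real_def)
  qed simp
next
  show "AE x in lebesgue. x > 0 \<longrightarrow> ((\<lambda>x. exp (c * \<sigma> x)) has_vector_derivative exp (c * \<sigma> x) * (c * a x)) (at x)"
    using primitive_AE_deriv[OF \<sigma>]
    by eventually_elim (auto simp flip: has_real_derivative_iff_has_vector_derivative intro!: derivative_eq_intros)
qed

section \<open>Linear Volterra and differential equations\<close>

text \<open>Applied to the least upper bound \<open>M\<close> itself, the step gives M \<le> k + M /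
  2. The a priori bound serves to make \<open>M\<close> finite; its size is then forgotten.\<close>

lemma self_improving_bound:
  fixes f :: "'a \<Rightarrow> real"
  assumes "\<exists>B. \<forall>x\<in>S. f x \<le> B"
    and step: "\<And>B. (\<And>x. x \<in> S \<Longrightarrow> f x \<le> B) \<Longrightarrow> (\<And>x. x \<in> S \<Longrightarrow> f x \<le> k + B / 2)"
    and "x \<in> S"
  shows "f x \<le> 2 * k"
proof -
  obtain B where "\<forall>x\<in>S. f x \<le> B" using assms(1) by (elim exE)
  then have bdd: "bdd_above (f ` S)" by (intro bdd_aboveI2[of _ _ B]) simp
  have ne: "f ` S \<noteq> {}" using \<open>x \<in> S\<close> by auto
  define M where "M = Sup (f ` S)"
  have M: "f y \<le> M" if "y \<in> S" for y
    unfolding M_def using that bdd by (intro cSup_upper) auto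
  have "M \<le> k + M / 2"
    unfolding M_def by (rule cSup_least[OF ne]) (use step[OF M] in \<open>auto simp: M_def\<close>)
  then show ?thesis using M[OF \<open>x \<in> S\<close>] by simp
qed

text \<open>A family of seminorms, with one constant \<open>k\<close> per set of
  \<open>\<S>\<close>. Volterra equations use all intervals {0..T} with an exponential weight; the
  decaying solutions use the single set {0..} with weight 1.\<close>

definition weighted_space :: "real set set \<Rightarrow> (real \<Rightarrow> real) \<Rightarrow> (real \<Rightarrow> 'a::real_normed_vector) set" where
  "weighted_space \<S> \<omega> = {y. \<forall>S\<in>\<S>. continuous_on S y \<and> (\<exists>k. \<forall>x\<in>S. norm (y x) \<le> k * \<omega> x)}"

text \<open>Picard iteration from the zero function. Every weighted seminorm contracts by 1/2, so on
  each set separately the iterates converge uniformly at rate 2^-n, and continuity passes to the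
  limit.\<close>

lemma weighted_contraction_fixpoint:
  fixes T :: "(real \<Rightarrow> 'a::banach) \<Rightarrow> (real \<Rightarrow> 'a)"
  assumes T: "\<And>y. y \<in> weighted_space \<S> \<omega> \<Longrightarrow> T y \<in> weighted_space \<S> \<omega>"
    and contr: "\<And>y z S k. y \<in> weighted_space \<S> \<omega> \<Longrightarrow> z \<in> weighted_space \<S> \<omega> \<Longrightarrow> S \<in> \<S> \<Longrightarrow>
        (\<And>x. x \<in> S \<Longrightarrow> norm (y x - z x) \<le> k * \<omega> x) \<Longrightarrow> (\<And>x. x \<in> S \<Longrightarrow> norm (T y x - T z x) \<le> k / 2 * \<omega> x)"
    and \<omega>: "\<And>S. S \<in> \<S> \<Longrightarrow> \<exists>B. \<forall>x\<in>S. 0 \<le> \<omega> x \<and> \<omega> x \<le> B"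
  shows "\<exists>y \<in> weighted_space \<S> \<omega>. \<forall>S\<in>\<S>. \<forall>x\<in>S. y x = T y x"
proof -
  define Y where "Y n = (T ^^ n) (\<lambda>x. 0)" for n
  have Y0: "Y 0 = (\<lambda>x. 0)" and YSuc: "\<And>n. Y (Suc n) = T (Y n)" by (simp_all add: Y_def)
  have 0: "(\<lambda>x. 0) \<in> weighted_space \<S> \<omega>"
    by (auto simp: weighted_space_def intro!: exI[of _ 0])
  have Yw: "Y n \<in> weighted_space \<S> \<omega>" for n
    by (induction n) (simp_all add: Y0 YSuc T 0)
  define y where "y x = lim (\<lambda>n. Y n x)" for x
  have key: "\<exists>k\<ge>0. \<forall>n. \<forall>x\<in>S. norm (y x - Y n x) \<le> k / 2 ^ n * \<omega> x" if S: "S \<in> \<S>" for S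
  proof -
    obtain k0 where "\<forall>x\<in>S. norm (Y 1 x) \<le> k0 * \<omega> x"
      using Yw[of 1] S unfolding weighted_space_def by auto
    moreover define k where "k = max k0 0"
    ultimately have k: "k \<ge> 0" "norm (Y 1 x) \<le> k * \<omega> x" if "x \<in> S" for x
      using \<omega>[OF S] that by (auto intro: order_trans[OF _ mult_right_mono])
    have step: "norm (Y (Suc n) x - Y n x) \<le> k / 2 ^ n * \<omega> x" if "x \<in> S" for n x
      using that
    proof (induction n arbitrary: x)
      case 0
      then show ?case using k by (simp add: Y0)
    next
      case (Suc n)
      have "norm (T (Y (Suc n)) x - T (Y n) x) \<le> k / 2 ^ n / 2 * \<omega> x"
        by (rule contr[OF Yw Yw S Suc.IH Suc.prems])
      then show ?case by (simp add: YSuc mult.commute)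
    qed
    \<comment> \<open>The factor \<open>1 - 1 / 2 ^ j\<close> is the exact partial sum of the
      geometric series, which lets the induction on \<open>j\<close> close.\<close>
    have diff: "norm (Y (n + j) x - Y n x) \<le> 2 * k / 2 ^ n * (1 - 1 / 2 ^ j) * \<omega> x" if "x \<in> S" for n j x
    proof (induction j)
      case (Suc j)
      have "norm (Y (n + Suc j) x - Y n x) \<le> norm (Y (Suc (n + j)) x - Y (n + j) x) + norm (Y (n + j) x - Y n x)"
        using norm_triangle_ineq[of "Y (Suc (n + j)) x - Y (n + j) x" "Y (n + j) x - Y n x"] by simp
      also have "\<dots> \<le> k / 2 ^ (n + j) * \<omega> x + 2 * k / 2 ^ n * (1 - 1 / 2 ^ j) * \<omega> x"
        by (intro add_mono step Suc.IH that)
      also have "\<dots> = 2 * k / 2 ^ n * (1 - 1 / 2 ^ Suc j) * \<omega> x"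
        by (simp add: field_simps power_add)
      finally show ?case .
    qed simp
    have diff': "norm (Y m x - Y n x) \<le> 2 * k / 2 ^ n * \<omega> x" if "x \<in> S" "m \<ge> n" for m n x
    proof -
      have "\<omega> x \<ge> 0" using \<omega>[OF S] that by auto
      have "2 * k / 2 ^ n * (1 - 1 / 2 ^ (m - n)) \<le> 2 * k / 2 ^ n * 1"
        using k(1)[OF that(1)] by (intro mult_left_mono) auto
      then have "2 * k / 2 ^ n * (1 - 1 / 2 ^ (m - n)) * \<omega> x \<le> 2 * k / 2 ^ n * 1 * \<omega> x"
        using \<open>\<omega> x \<ge> 0\<close> by (rule mult_right_mono)
      with diff[OF that(1), of n "m - n"] have "norm (Y (n + (m - n)) x - Y n x) \<le> 2 * k / 2 ^ n * 1 * \<omega> x"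
        by (rule order_trans)
      then show ?thesis using that by simp
    qed
    have lim: "(\<lambda>n. Y n x) \<longlonglongrightarrow> y x" if "x \<in> S" for x
    proof -
      have "Cauchy (\<lambda>n. Y n x)"
      proof (rule CauchyI')
        fix e :: real assume "e > 0"
        have "(\<lambda>n. 2 * k * \<omega> x * (1/2) ^ n) \<longlonglongrightarrow> 2 * k * \<omega> x * 0"
          by (intro tendsto_mult tendsto_const LIMSEQ_power_zero) simp
        then have "\<forall>\<^sub>F n in sequentially. 2 * k * \<omega> x * (1/2) ^ n < e"
          using \<open>e > 0\<close> by (intro order_tendstoD(2)[of _ "2 * k * \<omega> x * 0"]) auto
        then obtain M where M: "\<And>n. n \<ge> M \<Longrightarrow> 2 * k * \<omega> x * (1/2) ^ n < e"
          unfolding eventually_sequentially by auto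
        show "\<exists>M. \<forall>m\<ge>M. \<forall>n>m. dist (Y m x) (Y n x) < e"
        proof (intro exI[of _ M] allI impI)
          fix m n assume "m \<ge> M" "n > m"
          then have "norm (Y n x - Y m x) \<le> 2 * k * \<omega> x * (1/2) ^ m"
            using diff'[OF that, of m n] by (simp add: field_simps power_one_over)
          then show "dist (Y m x) (Y n x) < e"
            using M[OF \<open>m \<ge> M\<close>] by (simp add: dist_norm norm_minus_commute)
        qed
      qed
      then show ?thesis
        unfolding y_def by (simp add: Cauchy_convergent_iff convergent_LIMSEQ_iff)
    qed
    show ?thesis
    proof (intro exI[of _ "2 * max k 0"] conjI allI ballI)
      fix n x assume x: "x \<in> S"
      have "norm (y x - Y n x) \<le> 2 * k / 2 ^ n * \<omega> x"
      proof (rule LIMSEQ_le_const2)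
        show "(\<lambda>m. norm (Y m x - Y n x)) \<longlonglongrightarrow> norm (y x - Y n x)"
          by (intro tendsto_intros lim x)
        show "\<exists>N. \<forall>m\<ge>N. norm (Y m x - Y n x) \<le> 2 * k / 2 ^ n * \<omega> x"
          using diff'[OF x] by blast
      qed
      then show "norm (y x - Y n x) \<le> 2 * max k 0 / 2 ^ n * \<omega> x"
        using k(1)[OF x] by simp
    qed simp
  qed
  have yw: "y \<in> weighted_space \<S> \<omega>"
    unfolding weighted_space_def
  proof (intro CollectI ballI conjI)
    fix S assume S: "S \<in> \<S>"
    obtain k where k: "k \<ge> 0" "\<forall>n. \<forall>x\<in>S. norm (y x - Y n x) \<le> k / 2 ^ n * \<omega> x"
      using key[OF S] by (elim exE conjE)
    obtain B where B: "\<forall>x\<in>S. 0 \<le> \<omega> x \<and> \<omega> x \<le> B" using \<omega>[OF S] by (elim exE)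
    show "\<exists>k. \<forall>x\<in>S. norm (y x) \<le> k * \<omega> x"
      using k(2)[THEN spec, of 0] by (auto simp: Y0)
    have "uniform_limit S Y y sequentially"
    proof (rule uniform_limitI)
      fix e :: real assume "e > 0"
      have "(\<lambda>n. k * B * (1/2) ^ n) \<longlonglongrightarrow> k * B * 0"
        by (intro tendsto_mult tendsto_const LIMSEQ_power_zero) simp
      then have "\<forall>\<^sub>F n in sequentially. k * B * (1/2) ^ n < e"
        using \<open>e > 0\<close> by (intro order_tendstoD(2)[of _ "k * B * 0"]) auto
      then show "\<forall>\<^sub>F n in sequentially. \<forall>x\<in>S. dist (Y n x) (y x) < e"
      proof eventually_elim
        case (elim n)
        show ?case
        proof
          fix x assume x: "x \<in> S"
          have "norm (y x - Y n x) \<le> k / 2 ^ n * \<omega> x" using k x by blast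
          also have "\<dots> \<le> k / 2 ^ n * B" using k(1) B x by (intro mult_left_mono) auto
          also have "\<dots> < e" using elim by (simp add: power_one_over)
          finally show "dist (Y n x) (y x) < e" by (simp add: dist_norm norm_minus_commute)
        qed
      qed
    qed
    moreover have "\<forall>\<^sub>F n in sequentially. continuous_on S (Y n)"
      using Yw S by (auto simp: weighted_space_def)
    ultimately show "continuous_on S y"
      by (intro uniform_limit_theorem) auto
  qed
  moreover have "y x = T y x" if S: "S \<in> \<S>" and x: "x \<in> S" for S x
  proof -
    obtain k where k: "k \<ge> 0" "\<forall>n. \<forall>x\<in>S. norm (y x - Y n x) \<le> k / 2 ^ n * \<omega> x"
      using key[OF S] by (elim exE conjE)
    have "norm (y x - T y x) \<le> (k / 2 ^ n) * \<omega> x" for n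
    proof -
      have 1: "norm (T y x - T (Y n) x) \<le> k / 2 ^ n / 2 * \<omega> x"
        by (rule contr[OF yw Yw S _ x]) (use k in blast)
      have 2: "norm (y x - Y (Suc n) x) \<le> k / 2 ^ Suc n * \<omega> x" using k x by blast
      have "norm (y x - T y x) \<le> norm (y x - Y (Suc n) x) + norm (T y x - T (Y n) x)"
        unfolding YSuc[symmetric] using norm_triangle_ineq4[of "y x - Y (Suc n) x" "T y x - Y (Suc n) x"] by simp
      also have "\<dots> \<le> k / 2 ^ Suc n * \<omega> x + k / 2 ^ n / 2 * \<omega> x" using 1 2 by linarith
      finally show ?thesis by (simp add: field_simps)
    qed
    moreover have "(\<lambda>n. k * \<omega> x * (1/2) ^ n) \<longlonglongrightarrow> k * \<omega> x * 0"
      by (intro tendsto_mult tendsto_const LIMSEQ_power_zero) simp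
    ultimately have "norm (y x - T y x) \<le> k * \<omega> x * 0"
      by (intro LIMSEQ_le_const) (auto simp: power_one_over)
    then show ?thesis by simp
  qed
  ultimately show ?thesis by blast
qed

section \<open>Volterra equations with integrable coefficients\<close>

lemma primitive_norm_integral:
  fixes q :: "real \<Rightarrow> 'a::euclidean_space"
  assumes "\<And>T. T \<ge> 0 \<Longrightarrow> q absolutely_integrable_on {0..T}"
  shows "primitive (\<lambda>x. integral {0..x} (\<lambda>t. norm (q t))) (\<lambda>t. norm (q t) :: real)"
proof -
  have "(\<lambda>t. norm (q t)) absolutely_integrable_on {0..T}" if "T \<ge> 0" for T
    using absolutely_integrable_norm[OF assms[OF that]] by (simp add: o_def)
  then show ?thesis using primitive_integral[of "\<lambda>t. norm (q t)" 0] by simp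
qed

lemma primitive_mono:
  fixes F f :: "real \<Rightarrow> real"
  assumes "primitive F f" "\<And>t. t \<ge> 0 \<Longrightarrow> f t \<ge> 0" "0 \<le> a" "a \<le> b"
  shows "F a \<le> F b"
  using primitive_norm_le[OF primitive_const[of "0::real"] assms(1,3,4)] assms(2,3) by simp

context
  fixes h :: "'c::euclidean_space \<Rightarrow> 'e::euclidean_space \<Rightarrow> 'e" and K :: real and q :: "real \<Rightarrow> 'c"
  assumes h: "bounded_bilinear h" and K: "K \<ge> 0" "\<And>a b. norm (h a b) \<le> K * norm a * norm b"
    and q: "\<And>T. T \<ge> 0 \<Longrightarrow> q absolutely_integrable_on {0..T}"
begin

text \<open>Let \<sigma>(x) be \<open>K\<close> times the integral of norm q over [0, x]. The
  integral of 2 \<sigma>' exp(2 \<sigma>) is explicit, so the factor 2 in the weight makes the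
  Volterra operator halve the weighted norm on every interval, without any smallness of
  \<open>q\<close>.\<close>

lemma volterra_weighted_estimate:
  assumes X: "continuous_on {0..T} X" and "x \<in> {0..T}"
    and le: "\<And>t. t \<in> {0..T} \<Longrightarrow> norm (X t) \<le> k * exp (2 * (K * integral {0..t} (\<lambda>s. norm (q s))))"
  shows "norm (integral {0..x} (\<lambda>t. h (q t) (X t))) \<le> k / 2 * exp (2 * (K * integral {0..x} (\<lambda>s. norm (q s))))"
proof -
  let ?\<sigma> = "\<lambda>x. K * integral {0..x} (\<lambda>s. norm (q s))"
  have \<sigma>: "primitive ?\<sigma> (\<lambda>t. K * norm (q t))"
    by (rule primitive_linear[OF bounded_linear_mult_right primitive_norm_integral[OF q]])
  have G: "primitive (\<lambda>x. k / 2 * exp (2 * ?\<sigma> x)) (\<lambda>t. k / 2 * (exp (2 * ?\<sigma> t) * (2 * (K * norm (q t)))))"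
    by (rule primitive_linear[OF bounded_linear_mult_right primitive_exp[OF \<sigma>]])
  have "0 \<le> norm (X 0)" by simp
  also have "\<dots> \<le> k" using le[of 0] assms(2) by simp
  finally have "k \<ge> 0" .
  have x: "0 \<le> x" "x \<le> T" using assms(2) by auto
  have hq: "(\<lambda>t. h (q t) (X t)) absolutely_integrable_on {0..x}"
    by (rule absolutely_integrable_bilinear'[OF h q[OF x(1)] continuous_on_subset[OF X]]) (use x in auto)
  have "norm (integral {0..x} (\<lambda>t. h (q t) (X t))) \<le> integral {0..x} (\<lambda>t. k / 2 * (exp (2 * ?\<sigma> t) * (2 * (K * norm (q t)))))"
  proof (rule Henstock_Kurzweil_Integration.integral_norm_bound_integral)
    show "(\<lambda>t. h (q t) (X t)) integrable_on {0..x}" using hq by (simp add: absolutely_integrable_on_def)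
    show "(\<lambda>t. k / 2 * (exp (2 * ?\<sigma> t) * (2 * (K * norm (q t))))) integrable_on {0..x}"
      by (rule primitive_integrable_on[OF G]) simp
    fix t assume t: "t \<in> {0..x}"
    have "norm (h (q t) (X t)) \<le> K * norm (q t) * norm (X t)" by (rule K)
    also have "\<dots> \<le> K * norm (q t) * (k * exp (2 * ?\<sigma> t))"
      using t x K by (intro mult_left_mono le) auto
    finally show "norm (h (q t) (X t)) \<le> k / 2 * (exp (2 * ?\<sigma> t) * (2 * (K * norm (q t))))"
      by (simp add: mult_ac)
  qed
  also have "\<dots> = k / 2 * exp (2 * ?\<sigma> x) - k / 2 * exp (2 * ?\<sigma> 0)"
    by (rule primitive_diff_eq[OF G, symmetric]) (use x in auto)
  also have "\<dots> \<le> k / 2 * exp (2 * ?\<sigma> x)" using \<open>k \<ge> 0\<close> by simp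
  finally show ?thesis .
qed

text \<open>Dividing by the weight turns the contraction estimate into a self-improving bound. The
  outcome is a Gronwall inequality with an extra factor 2 in front and in the exponent.\<close>

lemma volterra_bound:
  assumes X: "continuous_on {0..T} X"
    and eq: "\<And>x. x \<in> {0..T} \<Longrightarrow> X x = F x + integral {0..x} (\<lambda>t. h (q t) (X t))"
    and F: "\<And>x. x \<in> {0..T} \<Longrightarrow> norm (F x) \<le> k" and x: "x \<in> {0..T}"
  shows "norm (X x) \<le> 2 * k * exp (2 * (K * integral {0..x} (\<lambda>s. norm (q s))))"
proof -
  let ?\<omega> = "\<lambda>x. exp (2 * (K * integral {0..x} (\<lambda>s. norm (q s))))"
  have \<sigma>: "primitive (\<lambda>x. integral {0..x} (\<lambda>s. norm (q s))) (\<lambda>s. norm (q s))"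
    by (rule primitive_norm_integral[OF q])
  have \<omega>1: "?\<omega> t \<ge> 1" if "t \<ge> 0" for t
    using primitive_mono[OF \<sigma>, of 0 t] that K(1) by simp
  have "norm (X x) / ?\<omega> x \<le> 2 * k"
  proof (rule self_improving_bound[where f = "\<lambda>x. norm (X x) / ?\<omega> x" and S = "{0..T}"])
    obtain B where B: "\<forall>x\<in>{0..T}. norm (X x) \<le> B"
      using continuous_on_Icc_bounded[OF X] by (elim exE)
    have "norm (X t) / ?\<omega> t \<le> B" if "t \<in> {0..T}" for t
    proof -
      have "norm (X t) / ?\<omega> t \<le> norm (X t) / 1"
        using \<omega>1[of t] that by (intro divide_left_mono) auto
      then show ?thesis using bspec[OF B that] by simp
    qed
    then show "\<exists>B. \<forall>x\<in>{0..T}. norm (X x) / ?\<omega> x \<le> B" by blast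
    fix B y assume B: "\<And>x. x \<in> {0..T} \<Longrightarrow> norm (X x) / ?\<omega> x \<le> B" and y: "y \<in> {0..T}"
    have "norm (X y) \<le> norm (F y) + norm (integral {0..y} (\<lambda>t. h (q t) (X t)))"
      by (subst eq[OF y]) (rule norm_triangle_ineq)
    also have "norm (integral {0..y} (\<lambda>t. h (q t) (X t))) \<le> B / 2 * ?\<omega> y"
      by (rule volterra_weighted_estimate[OF X y]) (use B in \<open>simp add: divide_le_eq\<close>)
    also have "norm (F y) \<le> k * ?\<omega> y"
      using F[OF y] \<omega>1[of y] y order_trans[OF norm_ge_zero F[OF y]] mult_left_mono[of 1 "?\<omega> y" k] by simp
    finally show "norm (X y) / ?\<omega> y \<le> k + B / 2"
      by (simp add: divide_le_eq algebra_simps)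
  qed fact
  then show ?thesis by (simp add: divide_le_eq)
qed

text \<open>The contraction factor is the same on every {0..T}, so one fixed point is obtained on
  the whole half-line at once, without continuation from interval to interval.\<close>

lemma volterra_exists:
  assumes F: "continuous_on {0..} F"
  shows "\<exists>X. continuous_on {0..} X \<and> (\<forall>x\<ge>0. X x = F x + integral {0..x} (\<lambda>t. h (q t) (X t)))"
proof -
  let ?\<omega> = "\<lambda>x. exp (2 * (K * integral {0..x} (\<lambda>s. norm (q s))))"
  let ?S = "{{0..T} |T. T \<ge> (0::real)}"
  define U where "U X x = F x + integral {0..x} (\<lambda>t. h (q t) (X t))" for X x
  have \<sigma>: "primitive (\<lambda>x. integral {0..x} (\<lambda>s. norm (q s))) (\<lambda>s. norm (q s))"
    by (rule primitive_norm_integral[OF q])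
  have \<omega>1: "?\<omega> t \<ge> 1" if "t \<ge> 0" for t
    using primitive_mono[OF \<sigma>, of 0 t] that K(1) by simp
  have ws: "X \<in> weighted_space ?S ?\<omega>" if X: "\<And>T. T \<ge> 0 \<Longrightarrow> continuous_on {0..T} X" for X :: "real \<Rightarrow> 'e"
    unfolding weighted_space_def
  proof (intro CollectI ballI)
    fix S assume "S \<in> ?S"
    then obtain T where T: "T \<ge> 0" "S = {0..T}" by auto
    obtain B where B: "\<forall>x\<in>{0..T}. norm (X x) \<le> B"
      using continuous_on_Icc_bounded[OF X[OF T(1)]] by (elim exE)
    have "B \<ge> 0" using T(1) order_trans[OF norm_ge_zero bspec[OF B, of 0]] by simp
    then have "norm (X x) \<le> B * ?\<omega> x" if "x \<in> S" for x
      using bspec[OF B, of x] \<omega>1[of x] that T(2) mult_left_mono[of 1 "?\<omega> x" B] by simp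
    then show "continuous_on S X \<and> (\<exists>k. \<forall>x\<in>S. norm (X x) \<le> k * ?\<omega> x)"
      using X[OF T(1)] T(2) by blast
  qed
  have wsD: "continuous_on {0..T} X" if "X \<in> weighted_space ?S ?\<omega>" "T \<ge> 0" for X :: "real \<Rightarrow> 'e" and T
    using that by (auto simp: weighted_space_def)
  have hq: "(\<lambda>t. h (q t) (X t)) absolutely_integrable_on {0..T}" if "continuous_on {0..T} X" "T \<ge> 0" for X T
    by (rule absolutely_integrable_bilinear'[OF h q[OF that(2)] that(1)])
  have "\<exists>X \<in> weighted_space ?S ?\<omega>. \<forall>S\<in>?S. \<forall>x\<in>S. X x = U X x"
  proof (rule weighted_contraction_fixpoint)
    fix X :: "real \<Rightarrow> 'e" assume X: "X \<in> weighted_space ?S ?\<omega>"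
    show "U X \<in> weighted_space ?S ?\<omega>"
    proof (rule ws)
      fix T :: real assume "T \<ge> 0"
      have "(\<lambda>t. h (q t) (X t)) integrable_on {0..T}"
        using hq[OF wsD[OF X \<open>T \<ge> 0\<close>] \<open>T \<ge> 0\<close>] by (simp add: absolutely_integrable_on_def)
      then show "continuous_on {0..T} (U X)"
        unfolding U_def
        by (intro continuous_on_add indefinite_integral_continuous_1 continuous_on_subset[OF F]) auto
    qed
  next
    fix X Z :: "real \<Rightarrow> 'e" and S k x
    assume X: "X \<in> weighted_space ?S ?\<omega>" and Z: "Z \<in> weighted_space ?S ?\<omega>" and "S \<in> ?S"
      and le: "\<And>x. x \<in> S \<Longrightarrow> norm (X x - Z x) \<le> k * ?\<omega> x" and x: "x \<in> S"
    then obtain T where T: "T \<ge> 0" "S = {0..T}" by auto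
    have x0: "x \<ge> 0" using x T by auto
    have "U X x - U Z x = integral {0..x} (\<lambda>t. h (q t) (X t)) - integral {0..x} (\<lambda>t. h (q t) (Z t))"
      by (simp add: U_def)
    also have "\<dots> = integral {0..x} (\<lambda>t. h (q t) (X t) - h (q t) (Z t))"
      using hq[OF wsD[OF X x0] x0] hq[OF wsD[OF Z x0] x0]
      by (intro Henstock_Kurzweil_Integration.integral_diff[symmetric]) (simp_all add: absolutely_integrable_on_def)
    also have "\<dots> = integral {0..x} (\<lambda>t. h (q t) (X t - Z t))"
      by (simp add: bounded_bilinear.diff_right[OF h])
    finally have "norm (U X x - U Z x) = norm (integral {0..x} (\<lambda>t. h (q t) (X t - Z t)))" by simp
    also have "\<dots> \<le> k / 2 * ?\<omega> x"
      by (rule volterra_weighted_estimate[of T])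
        (use T x le wsD[OF X T(1)] wsD[OF Z T(1)] in \<open>auto intro: continuous_on_diff\<close>)
    finally show "norm (U X x - U Z x) \<le> k / 2 * ?\<omega> x" .
  next
    fix S assume "S \<in> ?S"
    then obtain T where T: "T \<ge> 0" "S = {0..T}" by auto
    have "?\<omega> x \<le> ?\<omega> T" if "x \<in> {0..T}" for x
      using primitive_mono[OF \<sigma>, of x T] that K by (auto intro: mult_left_mono)
    then show "\<exists>B. \<forall>x\<in>S. 0 \<le> ?\<omega> x \<and> ?\<omega> x \<le> B"
      using T by (intro exI[of _ "?\<omega> T"]) simp
  qed
  then obtain X where X: "X \<in> weighted_space ?S ?\<omega>" "\<forall>S\<in>?S. \<forall>x\<in>S. X x = U X x" by (elim bexE)
  have "X x = F x + integral {0..x} (\<lambda>t. h (q t) (X t))" if "x \<ge> 0" for x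
    using bspec[OF bspec[OF X(2), of "{0..x}"], of x] that by (auto simp: U_def)
  moreover have "continuous_on {0..} X"
    by (rule continuous_on_half_lineI) (use wsD[OF X(1)] in simp)
  ultimately show ?thesis by blast
qed

lemma linear_ode_exists:
  "\<exists>X. X 0 = X0 \<and> primitive X (\<lambda>t. h (q t) (X t))"
proof -
  obtain X where X: "continuous_on {0..} X" "\<forall>x\<ge>0. X x = X0 + integral {0..x} (\<lambda>t. h (q t) (X t))"
    using volterra_exists[of "\<lambda>x. X0"] by auto
  have "(\<lambda>t. h (q t) (X t)) absolutely_integrable_on {0..T}" if "T \<ge> 0" for T
    by (rule absolutely_integrable_bilinear'[OF h q[OF that] continuous_on_subset[OF X(1)]]) auto
  then have "primitive (\<lambda>x. X0 + integral {0..x} (\<lambda>t. h (q t) (X t))) (\<lambda>t. h (q t) (X t))"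
    by (rule primitive_integral)
  then have "primitive X (\<lambda>t. h (q t) (X t))"
    by (rule primitive_cong) (use X(2) in auto)
  moreover have "X 0 = X0" using X(2) by simp
  ultimately show ?thesis by blast
qed

lemma linear_ode_bound:
  assumes X: "primitive X (\<lambda>t. h (q t) (X t))" and "x \<ge> 0"
  shows "norm (X x) \<le> 2 * norm (X 0) * exp (2 * (K * integral {0..x} (\<lambda>s. norm (q s))))"
proof (rule volterra_bound[where F = "\<lambda>x. X 0" and T = x])
  show "continuous_on {0..x} X" by (rule primitive_continuous_on_Icc[OF X])
  show "X t = X 0 + integral {0..t} (\<lambda>t. h (q t) (X t))" if "t \<in> {0..x}" for t
    by (rule primitive_eq[OF X]) (use that in simp)
qed (use \<open>x \<ge> 0\<close> in auto)

lemma linear_ode_unique: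
  assumes X: "primitive X (\<lambda>t. h (q t) (X t))" and Y: "primitive Y (\<lambda>t. h (q t) (Y t))"
    and "X 0 = Y 0" and "x \<ge> 0"
  shows "X x = Y x"
proof -
  have "primitive (\<lambda>t. X t - Y t) (\<lambda>t. h (q t) (X t - Y t))"
    using primitive_diff[OF X Y] by (simp add: bounded_bilinear.diff_right[OF h])
  from linear_ode_bound[OF this \<open>x \<ge> 0\<close>] show ?thesis using \<open>X 0 = Y 0\<close> by simp
qed

end

section \<open>Complex matrices and entire functions\<close>

lemma norm_vec_scalar_mult: "norm (c *s (v :: complex^'n)) = norm c * norm v"
  by (simp add: norm_vec_def norm_mult L2_set_right_distrib vector_scalar_mult_def)

text \<open>The norm of nested vectors is the Frobenius norm; it is submultiplicative by the
  Cauchy-Schwarz inequality, row by row.\<close>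

lemma norm_matrix_mult_le:
  fixes A :: "complex^'n^'m" and B :: "complex^'p^'n"
  shows "norm (A ** B) \<le> norm A * norm B"
proof -
  have row: "norm ((A ** B) $ i) \<le> norm (A $ i) * norm B" for i
  proof -
    have "(A ** B) $ i = (\<Sum>k\<in>UNIV. (A $ i $ k) *s (B $ k))"
      by (simp add: vec_eq_iff matrix_matrix_mult_def)
    then have "norm ((A ** B) $ i) \<le> (\<Sum>k\<in>UNIV. norm ((A $ i $ k) *s (B $ k)))"
      by (simp add: norm_sum)
    also have "\<dots> = (\<Sum>k\<in>UNIV. \<bar>norm (A $ i $ k)\<bar> * \<bar>norm (B $ k)\<bar>)"
      by (simp add: norm_vec_scalar_mult)
    also have "\<dots> \<le> L2_set (\<lambda>k. norm (A $ i $ k)) UNIV * L2_set (\<lambda>k. norm (B $ k)) UNIV"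
      by (rule L2_set_mult_ineq)
    finally show ?thesis by (simp add: norm_vec_def)
  qed
  have "norm (A ** B) = L2_set (\<lambda>i. norm ((A ** B) $ i)) UNIV" by (simp add: norm_vec_def)
  also have "\<dots> \<le> L2_set (\<lambda>i. norm (A $ i) * norm B) UNIV"
    by (rule L2_set_mono) (use row in auto)
  also have "\<dots> = norm A * norm B"
    by (simp add: norm_vec_def[of A] L2_set_left_distrib)
  finally show ?thesis .
qed

lemma matrix_scaleR_left: "(r *\<^sub>R A) ** B = r *\<^sub>R (A ** B)"
  and matrix_scaleR_right: "A ** (r *\<^sub>R B) = r *\<^sub>R (A ** B)"
  for A :: "complex^'n^'m" and B :: "complex^'p^'n"
  by (simp_all add: vec_eq_iff matrix_matrix_mult_def scaleR_sum_right)

interpretation mm: bounded_bilinear "(**) :: complex^'n^'m \<Rightarrow> complex^'p^'n \<Rightarrow> complex^'p^'m"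
proof
  fix A A' :: "complex^'n^'m" and B B' :: "complex^'p^'n" and r :: real
  show "(A + A') ** B = A ** B + A' ** B"
    by (simp add: vec_eq_iff matrix_matrix_mult_def sum.distrib ring_distribs)
  show "A ** (B + B') = A ** B + A ** B'" by (rule matrix_add_ldistrib)
  show "(r *\<^sub>R A) ** B = r *\<^sub>R (A ** B)" by (rule matrix_scaleR_left)
  show "A ** (r *\<^sub>R B) = r *\<^sub>R (A ** B)" by (rule matrix_scaleR_right)
  show "\<exists>K. \<forall>A B. norm (A ** B :: complex^'p^'m) \<le> norm (A :: complex^'n^'m) * norm B * K"
    by (intro exI[of _ 1]) (simp add: norm_matrix_mult_le)
qed

text \<open>Complex scalar multiplication as a bounded bilinear map, so that the product rule and
  the integrability lemmas cover scalar exponentials. For square matrices it agrees with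
  multiplication by \<open>mat c\<close>.\<close>

definition cscale :: "complex \<Rightarrow> complex^'n^'m \<Rightarrow> complex^'n^'m" where
  "cscale c A = (\<chi> i j. c * A $ i $ j)"

lemma cscale_nth [simp]: "cscale c A $ i $ j = c * A $ i $ j"
  by (simp add: cscale_def)

lemma norm_cscale [simp]: "norm (cscale c A) = norm c * norm A"
  by (simp add: cscale_def norm_vec_def norm_mult L2_set_right_distrib)

interpretation cscale: bounded_bilinear "cscale :: complex \<Rightarrow> complex^'n^'m \<Rightarrow> complex^'n^'m"
proof
  fix a b :: complex and A B :: "complex^'n^'m" and r :: real
  show "cscale (a + b) A = cscale a A + cscale b A" "cscale a (A + B) = cscale a A + cscale a B"
    "cscale (r *\<^sub>R a) A = r *\<^sub>R cscale a A" "cscale a (r *\<^sub>R A) = r *\<^sub>R cscale a A"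
    by (simp_all add: vec_eq_iff algebra_simps)
  show "\<exists>K. \<forall>a (A :: complex^'n^'m). norm (cscale a A) \<le> norm a * norm A * K"
    by (intro exI[of _ 1]) simp
qed

lemma cscale_mult_left: "cscale c A ** B = cscale c (A ** B)"
  and cscale_mult_right: "A ** cscale c B = cscale c (A ** B)"
  and cscale_cscale: "cscale a (cscale b A) = cscale (a * b) A"
  and cscale_one: "cscale 1 A = A"
  by (simp_all add: vec_eq_iff matrix_matrix_mult_def sum_distrib_left mult_ac)

lemma mat_matrix_mult: "mat c ** A = cscale c A" for A :: "complex^'n^'n"
  by (simp add: vec_eq_iff matrix_matrix_mult_def mat_def if_distrib[of "\<lambda>x. x * _"] cong: if_cong)

lemmas matrix_algebra =
  mm.add_left mm.add_right mm.diff_left mm.diff_right mm.minus_left mm.minus_right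
  mm.zero_left mm.zero_right matrix_scaleR_left matrix_scaleR_right matrix_mul_assoc
  matrix_mul_lid matrix_mul_rid
  cscale_mult_left cscale_mult_right cscale_cscale cscale_one
  cscale.add_right cscale.diff_right cscale.minus_right cscale.zero_right
  cscale.zero_left cscale.scaleR_left cscale.scaleR_right

text \<open>In finite dimension a trivial kernel suffices: a vector with v = - X v has norm v \<le>
  norm X * norm v, which forces v = 0.\<close>

lemma matrix_near_identity_invertible:
  fixes X :: "complex^'n^'n"
  assumes "norm X < 1"
  shows "\<exists>B. B ** (mat 1 + X) = mat 1"
  unfolding matrix_left_invertible_ker
proof (intro allI impI)
  fix v :: "complex^'n" assume "(mat 1 + X) *v v = 0"
  then have v: "v = - (X *v v)"
    by (simp add: matrix_vector_mult_add_rdistrib eq_neg_iff_add_eq_0)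
  have "norm (X *v v) \<le> norm X * norm v"
  proof -
    have row: "norm ((X *v v) $ i) \<le> norm (X $ i) * norm v" for i
    proof -
      have "norm ((X *v v) $ i) \<le> (\<Sum>k\<in>UNIV. norm (X $ i $ k * v $ k))"
        by (simp add: matrix_vector_mult_def norm_sum)
      also have "\<dots> = (\<Sum>k\<in>UNIV. \<bar>norm (X $ i $ k)\<bar> * \<bar>norm (v $ k)\<bar>)"
        by (simp add: norm_mult)
      also have "\<dots> \<le> L2_set (\<lambda>k. norm (X $ i $ k)) UNIV * L2_set (\<lambda>k. norm (v $ k)) UNIV"
        by (rule L2_set_mult_ineq)
      finally show ?thesis by (simp add: norm_vec_def)
    qed
    have "norm (X *v v) \<le> L2_set (\<lambda>i. norm (X $ i) * norm v) UNIV"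
      unfolding norm_vec_def[of "X *v v"] by (rule L2_set_mono) (use row in auto)
    also have "\<dots> = norm X * norm v" by (simp add: norm_vec_def[of X] L2_set_left_distrib)
    finally show ?thesis .
  qed
  moreover have "norm v = norm (X *v v)" using v by (metis norm_minus_cancel)
  ultimately have "(1 - norm X) * norm v \<le> 0" by (simp add: algebra_simps)
  then show "v = 0" using assms by (simp add: mult_le_0_iff)
qed

text \<open>Phragmen-Lindelof in a strip, with the damping factor \<open>exp (- \<epsilon> z\<^sup>2)\<close>.\<close>

lemma entire_bounded_off_strip:
  fixes f :: "complex \<Rightarrow> complex"
  assumes hol: "f holomorphic_on UNIV" and exp_type: "\<And>z. norm (f z) \<le> C * exp (C * norm z)"
    and bd: "\<And>z. \<bar>Im z\<bar> \<ge> R \<Longrightarrow> norm (f z) \<le> M" and "R > 0" "M > 0" "C \<ge> 0"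
  shows "norm (f z) \<le> M"
proof (cases "\<bar>Im z\<bar> \<ge> R")
  case False
  have main: "norm (f z) \<le> M * exp (\<epsilon> * R\<^sup>2) * exp (\<epsilon> * Re (z\<^sup>2))" if "\<epsilon> > 0" for \<epsilon> :: real
  proof -
    define g where "g w = f w * exp (- (of_real \<epsilon> * w\<^sup>2))" for w
    have ng: "norm (g w) = norm (f w) * exp (\<epsilon> * (Im w)\<^sup>2 - \<epsilon> * (Re w)\<^sup>2)" for w
      by (simp add: g_def norm_mult power2_eq_square algebra_simps)
    have "((\<lambda>x::real. exp (- x)) \<longlongrightarrow> 0) at_top" by real_asymp
    then have "((\<lambda>x. C * exp (C * R + \<epsilon> * R\<^sup>2) * exp (- x)) \<longlongrightarrow> 0) at_top"
      by (rule tendsto_mult_right_zero)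
    then have "\<forall>\<^sub>F x in at_top. C * exp (C * R + \<epsilon> * R\<^sup>2) * exp (- x) < M"
      using \<open>M > 0\<close> by (rule order_tendstoD(2))
    then have "\<forall>\<^sub>F x in at_top. C * exp (C * R + \<epsilon> * R\<^sup>2) * exp (- x) < M \<and> x > max \<bar>Re z\<bar> ((C + 1) / \<epsilon>)"
      using eventually_gt_at_top by (rule eventually_conj)
    then obtain X where X': "C * exp (C * R + \<epsilon> * R\<^sup>2) * exp (- X) < M" "X > max \<bar>Re z\<bar> ((C + 1) / \<epsilon>)"
      using eventually_happens[of _ "at_top :: real filter"] by auto
    \<comment> \<open>\<open>X\<close> is half the width of the rectangle. As
      \<open>\<epsilon> * X\<^sup>2\<close> is at least \<open>(C + 1) * X\<close>, the Gaussian
      damping on the vertical sides outweighs the exponential type and leaves a factor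
      \<open>exp (- X)\<close>.\<close>
    have "X > \<bar>Re z\<bar>" "X \<ge> (C + 1) / \<epsilon>" using X'(2) by auto
    have "X * (C + 1) \<le> X * (\<epsilon> * X)"
      using \<open>X \<ge> (C + 1) / \<epsilon>\<close> \<open>\<epsilon> > 0\<close> \<open>X > \<bar>Re z\<bar>\<close> by (intro mult_left_mono) (auto simp: divide_le_eq mult.commute)
    then have "C * (X + R) + (\<epsilon> * R\<^sup>2 - \<epsilon> * X\<^sup>2) \<le> C * R + \<epsilon> * R\<^sup>2 + - X"
      by (simp add: algebra_simps power2_eq_square)
    then have "exp (C * (X + R)) * exp (\<epsilon> * R\<^sup>2 - \<epsilon> * X\<^sup>2) \<le> exp (C * R + \<epsilon> * R\<^sup>2) * exp (- X)"
      unfolding exp_add[symmetric] by (rule exp_le_cancel_iff[THEN iffD2])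
    then have "C * (exp (C * (X + R)) * exp (\<epsilon> * R\<^sup>2 - \<epsilon> * X\<^sup>2)) \<le> C * (exp (C * R + \<epsilon> * R\<^sup>2) * exp (- X))"
      using \<open>C \<ge> 0\<close> by (rule mult_left_mono)
    then have X: "C * exp (C * (X + R)) * exp (\<epsilon> * R\<^sup>2 - \<epsilon> * X\<^sup>2) < M" "X > \<bar>Re z\<bar>"
      using X'(1) \<open>X > \<bar>Re z\<bar>\<close> by (simp_all add: mult.assoc)
    let ?B = "cbox (Complex (- X) (- R)) (Complex X R)"
    have "norm (g z) \<le> M * exp (\<epsilon> * R\<^sup>2)"
    proof (rule maximum_modulus_frontier[of g ?B])
      show "g holomorphic_on interior ?B"
        unfolding g_def by (intro holomorphic_intros holomorphic_on_subset[OF hol]) auto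
      show "continuous_on (closure ?B) g"
        unfolding g_def
        by (intro continuous_intros holomorphic_on_imp_continuous_on holomorphic_on_subset[OF hol]) auto
      show "bounded ?B" by (rule bounded_cbox)
      show "z \<in> ?B" using X(2) False by (auto simp: in_cbox_complex_iff)
      fix w assume "w \<in> frontier ?B"
      then have w: "w \<in> ?B" "w \<notin> box (Complex (- X) (- R)) (Complex X R)"
        by (auto simp: frontier_cbox)
      then have wb: "\<bar>Re w\<bar> \<le> X" "\<bar>Im w\<bar> \<le> R" and or: "\<bar>Re w\<bar> = X \<or> \<bar>Im w\<bar> = R"
        by (auto simp: in_cbox_complex_iff in_box_complex_iff)
      have "(Im w)\<^sup>2 \<le> R\<^sup>2" using abs_le_square_iff[of "Im w" R] wb(2) \<open>R > 0\<close> by simp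
      then have e1: "exp (\<epsilon> * (Im w)\<^sup>2 - \<epsilon> * (Re w)\<^sup>2) \<le> exp (\<epsilon> * R\<^sup>2 - \<epsilon> * (Re w)\<^sup>2)"
        using \<open>\<epsilon> > 0\<close> by simp
      show "norm (g w) \<le> M * exp (\<epsilon> * R\<^sup>2)"
        using or
      proof
        assume "\<bar>Im w\<bar> = R"
        have "norm (g w) \<le> M * exp (\<epsilon> * R\<^sup>2 - \<epsilon> * (Re w)\<^sup>2)"
          unfolding ng by (intro mult_mono bd e1) (use \<open>\<bar>Im w\<bar> = R\<close> \<open>M > 0\<close> in auto)
        also have "\<dots> \<le> M * exp (\<epsilon> * R\<^sup>2)" using \<open>M > 0\<close> \<open>\<epsilon> > 0\<close> by simp
        finally show ?thesis .
      next
        assume Re: "\<bar>Re w\<bar> = X"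
        have "norm w \<le> X + R" using cmod_le[of w] wb by simp
        then have "norm (f w) \<le> C * exp (C * (X + R))"
          using \<open>C \<ge> 0\<close> by (intro order_trans[OF exp_type] mult_left_mono) (auto intro: mult_left_mono)
        then have "norm (g w) \<le> C * exp (C * (X + R)) * exp (\<epsilon> * R\<^sup>2 - \<epsilon> * (Re w)\<^sup>2)"
          unfolding ng by (intro mult_mono e1) (use \<open>C \<ge> 0\<close> in auto)
        also have "(Re w)\<^sup>2 = X\<^sup>2" using Re by (metis power2_abs)
        also have "C * exp (C * (X + R)) * exp (\<epsilon> * R\<^sup>2 - \<epsilon> * X\<^sup>2) \<le> M * 1" using X(1) by simp
        also have "M * 1 \<le> M * exp (\<epsilon> * R\<^sup>2)" using \<open>M > 0\<close> \<open>\<epsilon> > 0\<close> by (intro mult_left_mono) auto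
        finally show ?thesis .
      qed
    qed
    then have "norm (f z) * exp (\<epsilon> * (Im z)\<^sup>2 - \<epsilon> * (Re z)\<^sup>2) * exp (\<epsilon> * Re (z\<^sup>2)) \<le> M * exp (\<epsilon> * R\<^sup>2) * exp (\<epsilon> * Re (z\<^sup>2))"
      unfolding ng by (rule mult_right_mono) simp
    moreover have "exp (\<epsilon> * (Im z)\<^sup>2 - \<epsilon> * (Re z)\<^sup>2) * exp (\<epsilon> * Re (z\<^sup>2)) = 1"
      by (simp add: exp_add[symmetric] power2_eq_square algebra_simps)
    ultimately show ?thesis by (simp add: mult.assoc)
  qed
  \<comment> \<open>The factors lost to the damping tend to 1 as \<epsilon> tends to 0 from the
    right, which restores the bound \<open>M\<close>.\<close>
  have "((\<lambda>\<epsilon>. M * exp (\<epsilon> * R\<^sup>2) * exp (\<epsilon> * Re (z\<^sup>2))) \<longlongrightarrow> M * exp (0 * R\<^sup>2) * exp (0 * Re (z\<^sup>2))) (at_right 0)"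
    by (intro tendsto_intros)
  then have "norm (f z) \<le> M * exp (0 * R\<^sup>2) * exp (0 * Re (z\<^sup>2))"
    by (rule tendsto_lowerbound) (use main in \<open>auto simp: eventually_at_right_less eventually_at_filter\<close>)
  then show ?thesis by simp
qed (rule bd)

text \<open>Absolute values and the summand 1 make the constants admissible for the strip lemma; the
  resulting global bound is fed into Liouville's theorem.\<close>

lemma entire_bounded_off_strip_const:
  fixes f :: "complex \<Rightarrow> complex"
  assumes "f holomorphic_on UNIV" "\<And>z. norm (f z) \<le> C * exp (C * norm z)"
    and "\<And>z. \<bar>Im z\<bar> \<ge> R \<Longrightarrow> norm (f z) \<le> M"
  shows "f z = f w"
proof -
  have C: "norm (f z) \<le> \<bar>C\<bar> * exp (\<bar>C\<bar> * norm z)" for z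
  proof -
    have "C * exp (C * norm z) \<le> \<bar>C\<bar> * exp (\<bar>C\<bar> * norm z)"
      by (intro mult_mono) (auto intro: mult_right_mono)
    then show ?thesis using assms(2)[of z] by linarith
  qed
  have M: "norm (f z) \<le> \<bar>M\<bar> + 1" if "\<bar>Im z\<bar> \<ge> \<bar>R\<bar> + 1" for z
    using assms(3)[of z] that by linarith
  have "norm (f z) \<le> \<bar>M\<bar> + 1" for z
    by (rule entire_bounded_off_strip[OF assms(1) C M]) auto
  then have "bounded (range f)" by (auto simp: bounded_iff)
  then have "f constant_on UNIV" by (rule Liouville_theorem[OF assms(1)])
  then show ?thesis by (auto simp: constant_on_def)
qed

section \<open>Variational equation and holomorphic dependence on a parameter\<close>

context
  fixes h :: "'c::euclidean_space \<Rightarrow> 'e::euclidean_space \<Rightarrow> 'e" and K :: real and q :: "real \<Rightarrow> 'c"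
  assumes h: "bounded_bilinear h" and K: "K \<ge> 0" "\<And>a b. norm (h a b) \<le> K * norm a * norm b"
    and q: "\<And>T. T \<ge> 0 \<Longrightarrow> q absolutely_integrable_on {0..T}"
begin

text \<open>The forcing enters the free term of a Volterra equation through its integral. This
  supplies the solution of the variational equation.\<close>

lemma linear_ode_inhomogeneous_exists:
  assumes g: "continuous_on {0..} g"
  shows "\<exists>X. X 0 = 0 \<and> primitive X (\<lambda>t. h (q t) (X t) + g t)"
proof -
  have ig: "g absolutely_integrable_on {0..T}" for T
    by (rule absolutely_integrable_continuous_real[OF continuous_on_subset[OF g]]) auto
  have G: "primitive (\<lambda>x. 0 + integral {0..x} g) g"
    by (rule primitive_integral) (rule ig)
  obtain X where X: "continuous_on {0..} X"
      "\<forall>x\<ge>0. X x = integral {0..x} g + integral {0..x} (\<lambda>t. h (q t) (X t))"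
    using volterra_exists[OF h K q primitive_continuous_on[OF G]] by auto
  have ih: "(\<lambda>t. h (q t) (X t)) absolutely_integrable_on {0..T}" if "T \<ge> 0" for T
    by (rule absolutely_integrable_bilinear'[OF h q[OF that] continuous_on_subset[OF X(1)]]) auto
  have "primitive (\<lambda>x. 0 + integral {0..x} (\<lambda>t. h (q t) (X t) + g t)) (\<lambda>t. h (q t) (X t) + g t)"
    by (rule primitive_integral) (intro set_integral_add ih ig)
  then have "primitive X (\<lambda>t. h (q t) (X t) + g t)"
  proof (rule primitive_cong)
    fix x :: real assume "x \<ge> 0"
    have "integral {0..x} (\<lambda>t. h (q t) (X t) + g t) = integral {0..x} (\<lambda>t. h (q t) (X t)) + integral {0..x} g"
      using ih[OF \<open>x \<ge> 0\<close>] ig[of x]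
      by (intro Henstock_Kurzweil_Integration.integral_add) (simp_all add: absolutely_integrable_on_def)
    then show "0 + integral {0..x} (\<lambda>t. h (q t) (X t) + g t) = X x"
      using X(2) \<open>x \<ge> 0\<close> by simp
  qed simp
  moreover have "X 0 = 0" using X(2) by simp
  ultimately show ?thesis by blast
qed

lemma linear_ode_inhomogeneous_bound:
  assumes X: "primitive X (\<lambda>t. h (q t) (X t) + g t)" "X 0 = 0" and g: "continuous_on {0..} g"
    and le: "\<And>t. t \<in> {0..T} \<Longrightarrow> norm (g t) \<le> k" and x: "x \<in> {0..T}"
  shows "norm (X x) \<le> 2 * (k * T) * exp (2 * (K * integral {0..x} (\<lambda>s. norm (q s))))"
proof (rule volterra_bound[OF h K q, where F = "\<lambda>x. integral {0..x} g" and T = T])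
  have ig: "g absolutely_integrable_on {0..T}" for T
    by (rule absolutely_integrable_continuous_real[OF continuous_on_subset[OF g]]) auto
  have ih: "(\<lambda>t. h (q t) (X t)) absolutely_integrable_on {0..T}" if "T \<ge> 0" for T
    by (rule absolutely_integrable_bilinear'[OF h q[OF that] primitive_continuous_on_Icc[OF X(1)]])
  show "continuous_on {0..T} X" by (rule primitive_continuous_on_Icc[OF X(1)])
  fix y assume y: "y \<in> {0..T}"
  have "integral {0..y} (\<lambda>t. h (q t) (X t) + g t) = integral {0..y} (\<lambda>t. h (q t) (X t)) + integral {0..y} g"
    using ih[of y] ig[of y] y
    by (intro Henstock_Kurzweil_Integration.integral_add) (simp_all add: absolutely_integrable_on_def)
  then show "X y = integral {0..y} g + integral {0..y} (\<lambda>t. h (q t) (X t))"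
    using primitive_eq[OF X(1), of y] y X(2) by simp
  have "0 \<le> k" using order_trans[OF norm_ge_zero le[OF y]] .
  have "norm (integral {0..y} g) \<le> integral {0..y} (\<lambda>t. k)"
    using ig[of y] y le by (intro Henstock_Kurzweil_Integration.integral_norm_bound_integral) (auto simp: absolutely_integrable_on_def)
  also have "\<dots> = k * y" using y by simp
  also have "\<dots> \<le> k * T" using y \<open>0 \<le> k\<close> by (intro mult_left_mono) auto
  finally show "norm (integral {0..y} g) \<le> k * T" .
qed (use x in auto)

end

lemma has_field_derivative_quadratic:
  fixes f :: "complex \<Rightarrow> complex"
  assumes le: "\<And>\<zeta>. norm \<zeta> \<le> 1 \<Longrightarrow> norm (f (a + \<zeta>) - f a - \<zeta> * d) \<le> C * (norm \<zeta>)\<^sup>2"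
  shows "(f has_field_derivative d) (at a)"
  unfolding has_field_derivative_def has_derivative_at_alt
proof (intro conjI allI impI)
  show "bounded_linear ((*) d)" by (rule bounded_linear_mult_right)
  fix e :: real assume "e > 0"
  show "\<exists>\<delta>>0. \<forall>y. norm (y - a) < \<delta> \<longrightarrow> norm (f y - f a - d * (y - a)) \<le> e * norm (y - a)"
  proof (intro exI[of _ "min 1 (e / (\<bar>C\<bar> + 1))"] conjI allI impI)
    show "0 < min 1 (e / (\<bar>C\<bar> + 1))" using \<open>e > 0\<close> by simp
    fix y assume y: "norm (y - a) < min 1 (e / (\<bar>C\<bar> + 1))"
    then have "norm (y - a) < e / (\<bar>C\<bar> + 1)" by simp
    then have "norm (y - a) * (\<bar>C\<bar> + 1) < e" by (subst (asm) pos_less_divide_eq) auto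
    moreover have "C * norm (y - a) \<le> (\<bar>C\<bar> + 1) * norm (y - a)" by (rule mult_right_mono) auto
    ultimately have "C * norm (y - a) \<le> e" by (simp add: mult.commute)
    then have "C * norm (y - a) * norm (y - a) \<le> e * norm (y - a)" by (rule mult_right_mono) simp
    moreover have "norm (f y - f a - d * (y - a)) \<le> C * (norm (y - a))\<^sup>2"
      using le[of "y - a"] y by (simp add: mult.commute)
    ultimately show "norm (f y - f a - d * (y - a)) \<le> e * norm (y - a)"
      by (simp add: power2_eq_square mult.assoc)
  qed
qed

context
  fixes h :: "'c::euclidean_space \<Rightarrow> 'e::euclidean_space \<Rightarrow> 'e" and K c :: real and q :: "complex \<Rightarrow> real \<Rightarrow> 'c"
    and X :: "complex \<Rightarrow> real \<Rightarrow> 'e" and X0 :: 'e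
  assumes h: "bounded_bilinear h" and K: "K \<ge> 0" "\<And>a b. norm (h a b) \<le> K * norm a * norm b"
    and q: "\<And>\<rho> T. T \<ge> 0 \<Longrightarrow> q \<rho> absolutely_integrable_on {0..T}"
    and qle: "\<And>\<rho> t. norm (q \<rho> t) \<le> norm (q 0 t) + c * norm \<rho>" and "c \<ge> 0"
    and X: "\<And>\<rho>. primitive (X \<rho>) (\<lambda>t. h (q \<rho> t) (X \<rho> t))" "\<And>\<rho>. X \<rho> 0 = X0"
begin

text \<open>The coefficient grows at most linearly in |\<rho>|, hence so does the exponent of the
  Volterra bound. Uniformity in \<open>t\<close> is what the derivative with respect to \<rho>
  needs.\<close>

lemma linear_ode_exponential_type:
  assumes t: "t \<in> {0..T}"
  shows "norm (X \<rho> t) \<le> 2 * norm X0 * exp (2 * (K * (integral {0..T} (\<lambda>s. norm (q 0 s)) + c * norm \<rho> * T)))"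
proof -
  have \<sigma>: "primitive (\<lambda>x. integral {0..x} (\<lambda>s. norm (q \<rho> s))) (\<lambda>s. norm (q \<rho> s))" for \<rho>
    by (rule primitive_norm_integral[OF q])
  have T: "0 \<le> T" using t by simp
  have "integral {0..t} (\<lambda>s. norm (q \<rho> s)) \<le> integral {0..T} (\<lambda>s. norm (q \<rho> s))"
    by (rule primitive_mono[OF \<sigma>]) (use t in auto)
  also have "\<dots> \<le> integral {0..T} (\<lambda>s. norm (q 0 s) + c * norm \<rho>)"
    using primitive_integrable_on[OF \<sigma>[of \<rho>], of 0 T] primitive_integrable_on[OF \<sigma>[of 0], of 0 T]
    by (intro integral_le qle Henstock_Kurzweil_Integration.integrable_add) auto
  also have "\<dots> = integral {0..T} (\<lambda>s. norm (q 0 s)) + c * norm \<rho> * T"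
    using primitive_integrable_on[OF \<sigma>[of 0], of 0 T] T
    by (subst Henstock_Kurzweil_Integration.integral_add) auto
  finally have "exp (2 * (K * integral {0..t} (\<lambda>s. norm (q \<rho> s)))) \<le>
      exp (2 * (K * (integral {0..T} (\<lambda>s. norm (q 0 s)) + c * norm \<rho> * T)))"
    using K(1) by (simp add: mult_left_mono)
  then have "2 * norm X0 * exp (2 * (K * integral {0..t} (\<lambda>s. norm (q \<rho> s)))) \<le>
      2 * norm X0 * exp (2 * (K * (integral {0..T} (\<lambda>s. norm (q 0 s)) + c * norm \<rho> * T)))"
    by (rule mult_left_mono) simp
  moreover have "norm (X \<rho> t) \<le> 2 * norm (X \<rho> 0) * exp (2 * (K * integral {0..t} (\<lambda>s. norm (q \<rho> s))))"
    by (rule linear_ode_bound[OF h K q X(1)]) (use t in auto)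
  ultimately show ?thesis by (simp add: X(2))
qed

text \<open>The complex derivative of the solution is the solution \<open>D\<close> of the variational equation;
  the remainder of the difference quotient is estimated by the weighted Volterra bound.\<close>

lemma linear_ode_holomorphic:
  fixes S :: "complex \<Rightarrow> 'e \<Rightarrow> 'e" and \<phi> :: "'e \<Rightarrow> complex"
  assumes S: "bounded_bilinear S" and comm: "\<And>a \<zeta> v. h a (S \<zeta> v) = S \<zeta> (h a v)"
    and shift: "\<And>\<rho> \<rho>0 t v. h (q \<rho> t) v = h (q \<rho>0 t) v + S (\<rho> - \<rho>0) (h c1 v)"
    and \<phi>: "bounded_linear \<phi>" "\<And>\<zeta> v. \<phi> (S \<zeta> v) = \<zeta> * \<phi> v" and "T \<ge> 0"
  shows "(\<lambda>\<rho>. \<phi> (X \<rho> T)) holomorphic_on UNIV"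
proof -
  have "\<exists>d. ((\<lambda>\<rho>. \<phi> (X \<rho> T)) has_field_derivative d) (at \<rho>0)" for \<rho>0
  proof -
    have cont: "continuous_on {0..} (\<lambda>t. h c1 (F t))" if "continuous_on {0..} F" for F
      by (rule bounded_linear.continuous_on[OF bounded_bilinear.bounded_linear_right[OF h] that])
    have contS: "continuous_on {0..} (\<lambda>t. S \<zeta> (F t))" if "continuous_on {0..} F" for F \<zeta>
      by (rule bounded_linear.continuous_on[OF bounded_bilinear.bounded_linear_right[OF S] that])
    obtain KS where KS: "KS \<ge> 0" "\<And>a b. norm (S a b) \<le> norm a * norm b * KS"
      using bounded_bilinear.nonneg_bounded[OF S] by blast
    obtain D where D: "D 0 = 0" "primitive D (\<lambda>t. h (q \<rho>0 t) (D t) + h c1 (X \<rho>0 t))"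
      using linear_ode_inhomogeneous_exists[OF h K q cont[OF primitive_continuous_on[OF X(1)]]] by blast
    define B where "B = 2 * norm X0 * exp (2 * (K * (integral {0..T} (\<lambda>s. norm (q 0 s)) + c * (norm \<rho>0 + 1) * T)))"
    have "B \<ge> 0" by (simp add: B_def)
    have B: "norm (X (\<rho>0 + \<zeta>) t) \<le> B" if "norm \<zeta> \<le> 1" "t \<in> {0..T}" for \<zeta> t
    proof -
      have "norm (\<rho>0 + \<zeta>) \<le> norm \<rho>0 + 1" using norm_triangle_ineq[of \<rho>0 \<zeta>] that by simp
      then have "c * norm (\<rho>0 + \<zeta>) * T \<le> c * (norm \<rho>0 + 1) * T"
        using \<open>c \<ge> 0\<close> \<open>T \<ge> 0\<close> by (intro mult_right_mono mult_left_mono)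
      then have "exp (2 * (K * (integral {0..T} (\<lambda>s. norm (q 0 s)) + c * norm (\<rho>0 + \<zeta>) * T))) \<le>
          exp (2 * (K * (integral {0..T} (\<lambda>s. norm (q 0 s)) + c * (norm \<rho>0 + 1) * T)))"
        using K(1) by (simp add: mult_left_mono)
      then have "2 * norm X0 * exp (2 * (K * (integral {0..T} (\<lambda>s. norm (q 0 s)) + c * norm (\<rho>0 + \<zeta>) * T))) \<le> B"
        unfolding B_def by (rule mult_left_mono) simp
      then show ?thesis using linear_ode_exponential_type[OF that(2), of "\<rho>0 + \<zeta>"] by simp
    qed
    define W where "W = exp (2 * (K * integral {0..T} (\<lambda>s. norm (q \<rho>0 s))))"
    have \<sigma>: "primitive (\<lambda>x. integral {0..x} (\<lambda>s. norm (q \<rho>0 s))) (\<lambda>s. norm (q \<rho>0 s))"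
      by (rule primitive_norm_integral[OF q])
    have W: "exp (2 * (K * integral {0..t} (\<lambda>s. norm (q \<rho>0 s)))) \<le> W" if "t \<in> {0..T}" for t
      unfolding W_def using primitive_mono[OF \<sigma>, of t T] that K(1) by (simp add: mult_left_mono)
    have inh: "norm (F x) \<le> 2 * (k * T) * W"
      if "primitive F (\<lambda>t. h (q \<rho>0 t) (F t) + g t)" "F 0 = 0" "continuous_on {0..} g"
        "\<And>t. t \<in> {0..T} \<Longrightarrow> norm (g t) \<le> k" "x \<in> {0..T}" for F g k x
    proof -
      have "0 \<le> k" using order_trans[OF norm_ge_zero that(4)[OF that(5)]] .
      then have "2 * (k * T) * exp (2 * (K * integral {0..x} (\<lambda>s. norm (q \<rho>0 s)))) \<le> 2 * (k * T) * W"
        using \<open>T \<ge> 0\<close> by (intro mult_left_mono W that(5)) simp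
      then show ?thesis using linear_ode_inhomogeneous_bound[OF h K q that] by linarith
    qed
    obtain K\<phi> where K\<phi>: "K\<phi> \<ge> 0" "\<And>v. norm (\<phi> v) \<le> norm v * K\<phi>"
      using bounded_linear.nonneg_bounded[OF \<phi>(1)] by blast
    \<comment> \<open>If the forcing is \<open>S \<zeta> (h c1 v)\<close> with \<open>v\<close>
      bounded by \<open>k\<close>, the solution starting from 0 is at most
      \<open>norm \<zeta> * E k\<close>. One application bounds the increment and a second one the
      remainder, whence the quadratic constant \<open>E (E B)\<close>.\<close>
    define E where "E k = 2 * ((K * norm c1 * k * KS) * T) * W" for k
    have Slin: "norm (S \<zeta> (h c1 v)) \<le> norm \<zeta> * (K * norm c1 * k * KS)" if "norm v \<le> k" for \<zeta> v k
    proof -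
      have "norm (h c1 v) \<le> K * norm c1 * k"
        using K(2)[of c1 v] mult_left_mono[OF that, of "K * norm c1"] K(1) by simp
      then have "norm \<zeta> * norm (h c1 v) * KS \<le> norm \<zeta> * (K * norm c1 * k) * KS"
        using KS(1) by (intro mult_right_mono mult_left_mono) auto
      then show ?thesis using KS(2)[of \<zeta> "h c1 v"] by (simp add: mult.assoc)
    qed
    have "norm (\<phi> (X (\<rho>0 + \<zeta>) T) - \<phi> (X \<rho>0 T) - \<zeta> * \<phi> (D T)) \<le> E (E B) * K\<phi> * (norm \<zeta>)\<^sup>2"
      if \<zeta>: "norm \<zeta> \<le> 1" for \<zeta>
    proof -
      let ?\<Delta> = "\<lambda>t. X (\<rho>0 + \<zeta>) t - X \<rho>0 t"
      let ?R = "\<lambda>t. ?\<Delta> t - S \<zeta> (D t)"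
      have \<Delta>: "primitive ?\<Delta> (\<lambda>t. h (q \<rho>0 t) (?\<Delta> t) + S \<zeta> (h c1 (X (\<rho>0 + \<zeta>) t)))"
        using primitive_diff[OF X(1)[of "\<rho>0 + \<zeta>"] X(1)[of \<rho>0]] shift[of "\<rho>0 + \<zeta>" _ _ \<rho>0]
        by (simp add: bounded_bilinear.diff_right[OF h] algebra_simps)
      have \<Delta>le: "norm (?\<Delta> t) \<le> norm \<zeta> * E B" if t: "t \<in> {0..T}" for t
      proof -
        have "norm (?\<Delta> t) \<le> 2 * ((norm \<zeta> * (K * norm c1 * B * KS)) * T) * W"
          by (rule inh[OF \<Delta> _ contS[OF cont[OF primitive_continuous_on[OF X(1)]]] Slin[OF B[OF \<zeta>]] t])
            (simp add: X(2))
        then show ?thesis by (simp add: E_def mult_ac)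
      qed
      have SD: "primitive (\<lambda>t. S \<zeta> (D t)) (\<lambda>t. S \<zeta> (h (q \<rho>0 t) (D t) + h c1 (X \<rho>0 t)))"
        by (rule primitive_linear[OF bounded_bilinear.bounded_linear_right[OF S] D(2)])
      \<comment> \<open>Since the scalar action commutes with \<open>h\<close>, the remainder solves
        the same equation, now driven only by the increment.\<close>
      have R: "primitive ?R (\<lambda>t. h (q \<rho>0 t) (?R t) + S \<zeta> (h c1 (?\<Delta> t)))"
        using primitive_diff[OF \<Delta> SD]
        by (simp add: bounded_bilinear.diff_right[OF h] bounded_bilinear.diff_right[OF S]
            bounded_bilinear.add_right[OF S] bounded_bilinear.add_right[OF h] comm algebra_simps)
      have "continuous_on {0..} ?\<Delta>" by (rule primitive_continuous_on[OF \<Delta>])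
      then have "norm (?R T) \<le> 2 * ((norm \<zeta> * (K * norm c1 * (norm \<zeta> * E B) * KS)) * T) * W"
        by (intro inh[OF R _ contS[OF cont] Slin[OF \<Delta>le]])
          (auto simp: X(2) D(1) bounded_bilinear.zero_right[OF S] \<open>T \<ge> 0\<close>)
      also have "\<dots> = E (E B) * (norm \<zeta>)\<^sup>2" by (simp add: E_def power2_eq_square mult_ac)
      finally have "norm (?R T) * K\<phi> \<le> E (E B) * (norm \<zeta>)\<^sup>2 * K\<phi>"
        using K\<phi>(1) by (rule mult_right_mono)
      moreover have "\<phi> (?R T) = \<phi> (X (\<rho>0 + \<zeta>) T) - \<phi> (X \<rho>0 T) - \<zeta> * \<phi> (D T)"
        by (simp add: linear_diff[OF bounded_linear.linear[OF \<phi>(1)]] \<phi>(2))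
      ultimately show ?thesis using K\<phi>(2)[of "?R T"] by (simp add: mult_ac)
    qed
    from has_field_derivative_quadratic[OF this] show ?thesis by blast
  qed
  then show ?thesis
    by (metis field_differentiable_def field_differentiable_at_within holomorphic_onI)
qed

end

section \<open>Exponential solutions of the factored pencil\<close>

lemma norm_mm_le:
  fixes A :: "complex^'n^'m" and B :: "complex^'p^'n"
  assumes "norm A \<le> a" "norm B \<le> b"
  shows "norm (A ** B) \<le> a * b"
  by (rule order_trans[OF norm_matrix_mult_le mult_mono[OF assms order_trans[OF norm_ge_zero assms(1)]]]) simp

section \<open>Integrals over the half-line and their exponentially weighted tails\<close>

lemma absolutely_integrable_half_line_bilinear:
  fixes h :: "'a::euclidean_space \<Rightarrow> 'b::euclidean_space \<Rightarrow> 'c::euclidean_space"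
  assumes "bounded_bilinear h" "continuous_on {0::real..} F" "\<And>x. x \<ge> 0 \<Longrightarrow> norm (F x) \<le> B"
    and "g absolutely_integrable_on {0..}"
  shows "(\<lambda>x. h (F x) (g x)) absolutely_integrable_on {0..}"
proof (rule absolutely_integrable_bounded_measurable_product[of h])
  show "bilinear h" using assms(1) by (simp add: bilinear_conv_bounded_bilinear)
  show "F \<in> borel_measurable (lebesgue_on {0..})"
    by (rule continuous_imp_measurable_on_sets_lebesgue[OF assms(2)]) simp
  show "bounded (F ` {0..})" unfolding bounded_iff using assms(3) by auto
qed (use assms in auto)

lemma absolutely_integrable_half_line_subset:
  fixes g :: "real \<Rightarrow> 'a::euclidean_space"
  assumes "g absolutely_integrable_on {0..}" "x \<ge> 0"
  shows "g absolutely_integrable_on {0..x}" "g absolutely_integrable_on {x..}"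
  using assms by (auto intro: set_integrable_subset)

lemma integral_half_line_split:
  fixes g :: "real \<Rightarrow> 'a::euclidean_space"
  assumes g: "g absolutely_integrable_on {0..}" and "x \<ge> 0"
  shows "integral {0..} g = integral {0..x} g + integral {x..} g"
proof -
  have "{0..} = {0..x} \<union> {x..}" using \<open>x \<ge> 0\<close> by auto
  moreover have "integral ({0..x} \<union> {x..}) g = integral {0..x} g + integral {x..} g"
  proof (rule Henstock_Kurzweil_Integration.integral_Un)
    have "{0..x} \<inter> {x..} = {x}" using \<open>x \<ge> 0\<close> by auto
    then show "negligible ({0..x} \<inter> {x..})" by simp
  qed (use absolutely_integrable_half_line_subset[OF g \<open>x \<ge> 0\<close>] in \<open>auto simp: absolutely_integrable_on_def\<close>)
  ultimately show ?thesis by simp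
qed

lemma primitive_cexp: "primitive (\<lambda>x. exp (a * of_real x)) (\<lambda>x. a * exp (a * of_real x) :: complex)"
proof (rule primitive_of_derivative)
  show "((\<lambda>x. exp (a * of_real x)) has_vector_derivative a * exp (a * of_real x)) (at x within {0..})" for x :: real
    by (rule has_vector_derivative_real_field[THEN has_vector_derivative_at_within]
        | auto intro!: derivative_eq_intros)+
qed (intro continuous_intros)

text \<open>The solution of \<open>W' = - 2 \<i> \<rho> W - f\<close> that vanishes at infinity when \<open>Im \<rho> > 0\<close>.\<close>

definition decay :: "complex \<Rightarrow> (real \<Rightarrow> complex^'n^'m) \<Rightarrow> real \<Rightarrow> complex^'n^'m" where
  "decay \<rho> f x = cscale (exp (- 2 * \<i> * \<rho> * of_real x)) (integral {x..} (\<lambda>s. cscale (exp (2 * \<i> * \<rho> * of_real s)) (f s)))"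

context
  fixes \<rho> :: complex and \<tau> :: real
  assumes \<rho>: "Im \<rho> \<ge> \<tau>" "\<tau> > 0"
begin

lemma norm_exp_rho: "norm (exp (2 * \<i> * \<rho> * of_real s)) = exp (- 2 * Im \<rho> * s)"
  "norm (exp (- 2 * \<i> * \<rho> * of_real s)) = exp (2 * Im \<rho> * s)"
  by simp_all

lemma decay_integrand:
  fixes f :: "real \<Rightarrow> complex^'n^'m"
  assumes "f absolutely_integrable_on {0..}"
  shows "(\<lambda>s. cscale (exp (2 * \<i> * \<rho> * of_real s)) (f s)) absolutely_integrable_on {0..}"
proof (rule absolutely_integrable_half_line_bilinear[OF cscale.bounded_bilinear_axioms _ _ assms])
  show "continuous_on {0..} (\<lambda>s. exp (2 * \<i> * \<rho> * of_real s))" by (intro continuous_intros)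
  show "norm (exp (2 * \<i> * \<rho> * of_real x)) \<le> 1" if "x \<ge> 0" for x
    unfolding norm_exp_rho using that \<rho> by (simp add: mult_nonneg_nonneg)
qed

text \<open>The tail integral is written as the total integral minus the one over {0..x}, so that
  the product rule for primitives applies.\<close>

lemma primitive_decay:
  fixes f :: "real \<Rightarrow> complex^'n^'m"
  assumes f: "f absolutely_integrable_on {0..}"
  shows "primitive (decay \<rho> f) (\<lambda>t. cscale (- 2 * \<i> * \<rho>) (decay \<rho> f t) - f t)"
proof -
  let ?g = "\<lambda>s. cscale (exp (2 * \<i> * \<rho> * of_real s)) (f s)"
  let ?I = "\<lambda>x. integral {0..} ?g - integral {0..x} ?g"
  have g: "?g absolutely_integrable_on {0..}" by (rule decay_integrand[OF f])
  have "primitive (\<lambda>x. 0 + integral {0..x} ?g) ?g"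
    by (rule primitive_integral) (rule absolutely_integrable_half_line_subset[OF g])
  then have "primitive ?I (\<lambda>t. 0 - ?g t)"
    using primitive_diff[OF primitive_const[of "integral {0..} ?g"]] by simp
  note primitive_bilinear[OF cscale.bounded_bilinear_axioms primitive_cexp[of "- 2 * \<i> * \<rho>"] this]
  then show ?thesis
  proof (rule primitive_cong)
    fix x :: real assume x: "x \<ge> 0"
    have eq: "?I x = integral {x..} ?g" using integral_half_line_split[OF g x] by simp
    show "cscale (exp (- 2 * \<i> * \<rho> * of_real x)) (?I x) = decay \<rho> f x"
      unfolding eq decay_def ..
    have "exp (- 2 * \<i> * \<rho> * of_real x) * exp (2 * \<i> * \<rho> * of_real x) = 1"
      by (simp add: exp_add[symmetric])
    then show "cscale (exp (- 2 * \<i> * \<rho> * of_real x)) (0 - ?g x) +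
        cscale (- 2 * \<i> * \<rho> * exp (- 2 * \<i> * \<rho> * of_real x)) (?I x) = cscale (- 2 * \<i> * \<rho>) (decay \<rho> f x) - f x"
      unfolding eq decay_def by (simp add: matrix_algebra)
  qed
qed

lemma decay_diff:
  fixes f g :: "real \<Rightarrow> complex^'n^'m"
  assumes "f absolutely_integrable_on {0..}" "g absolutely_integrable_on {0..}" "x \<ge> 0"
  shows "decay \<rho> (\<lambda>s. f s - g s) x = decay \<rho> f x - decay \<rho> g x"
proof -
  have "integral {x..} (\<lambda>s. cscale (exp (2 * \<i> * \<rho> * of_real s)) (f s) - cscale (exp (2 * \<i> * \<rho> * of_real s)) (g s)) =
     integral {x..} (\<lambda>s. cscale (exp (2 * \<i> * \<rho> * of_real s)) (f s)) - integral {x..} (\<lambda>s. cscale (exp (2 * \<i> * \<rho> * of_real s)) (g s))"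
    using absolutely_integrable_half_line_subset(2)[OF decay_integrand[OF assms(1)] assms(3)]
      absolutely_integrable_half_line_subset(2)[OF decay_integrand[OF assms(2)] assms(3)]
    by (intro Henstock_Kurzweil_Integration.integral_diff) (auto simp: absolutely_integrable_on_def)
  then show ?thesis by (simp add: decay_def cscale.diff_right)
qed

text \<open>For a merely integrable \<open>f\<close> the pointwise bound is \<open>N\<close>; the
  gain 1/\<tau> appears after integration. The majorant \<open>G\<close> satisfies G' = 2 \<tau> G -
  norm f, and integrating this equation bounds 2 \<tau> times the integral of \<open>G\<close> by 2
  N, without interchanging integrals.\<close>

lemma decay_bounds:
  fixes f :: "real \<Rightarrow> complex^'n^'m"
  assumes f: "f absolutely_integrable_on {0..}" and N: "integral {0..} (\<lambda>s. norm (f s)) \<le> N" and x: "x \<ge> 0"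
  shows "norm (decay \<rho> f x) \<le> N" "integral {0..x} (\<lambda>t. norm (decay \<rho> f t)) \<le> N / \<tau>"
proof -
  let ?n = "\<lambda>s. norm (f s)"
  let ?g = "\<lambda>s. exp (- 2 * \<tau> * s) * ?n s"
  define G where "G t = exp (2 * \<tau> * t) * integral {t..} ?g" for t
  have n: "?n absolutely_integrable_on {0..}"
    using absolutely_integrable_norm[OF f] by (simp add: o_def)
  have g: "?g absolutely_integrable_on {0..}"
    by (rule absolutely_integrable_half_line_bilinear[OF bounded_bilinear_mult _ _ n, of _ 1])
      (use \<rho> in \<open>auto intro!: continuous_intros simp: mult_nonneg_nonneg\<close>)
  have le: "norm (decay \<rho> f t) \<le> G t" if t: "t \<ge> 0" for t
  proof -
    have "norm (decay \<rho> f t) = norm (integral {t..} (\<lambda>s. cscale (exp (2 * \<i> * \<rho> * of_real (s - t))) (f s)))"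
    proof -
      have "cscale (exp (- 2 * \<i> * \<rho> * of_real t)) (integral {t..} (\<lambda>s. cscale (exp (2 * \<i> * \<rho> * of_real s)) (f s))) =
          integral {t..} (\<lambda>s. cscale (exp (- 2 * \<i> * \<rho> * of_real t)) (cscale (exp (2 * \<i> * \<rho> * of_real s)) (f s)))"
        using integral_linear[OF _ cscale.bounded_linear_right, of "\<lambda>s. cscale (exp (2 * \<i> * \<rho> * of_real s)) (f s)" "{t..}"]
          absolutely_integrable_half_line_subset(2)[OF decay_integrand[OF f] t]
        by (simp add: o_def absolutely_integrable_on_def)
      also have "\<dots> = integral {t..} (\<lambda>s. cscale (exp (2 * \<i> * \<rho> * of_real (s - t))) (f s))"
        by (simp add: cscale_cscale exp_add[symmetric] algebra_simps)
      finally show ?thesis by (simp add: decay_def)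
    qed
    also have "\<dots> \<le> integral {t..} (\<lambda>s. exp (2 * \<tau> * t) * ?g s)"
    proof (rule Henstock_Kurzweil_Integration.integral_norm_bound_integral)
      have "(\<lambda>s. cscale (exp (- 2 * \<i> * \<rho> * of_real t)) (cscale (exp (2 * \<i> * \<rho> * of_real s)) (f s))) absolutely_integrable_on {t..}"
        using absolutely_integrable_linear[OF absolutely_integrable_half_line_subset(2)[OF decay_integrand[OF f] t] cscale.bounded_linear_right]
        by (simp add: o_def)
      then show "(\<lambda>s. cscale (exp (2 * \<i> * \<rho> * of_real (s - t))) (f s)) integrable_on {t..}"
        by (simp add: cscale_cscale exp_add[symmetric] algebra_simps absolutely_integrable_on_def)
      show "(\<lambda>s. exp (2 * \<tau> * t) * ?g s) integrable_on {t..}"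
        using absolutely_integrable_half_line_subset(2)[OF g t]
        by (intro integrable_on_mult_right) (simp add: absolutely_integrable_on_def)
      fix s assume "s \<in> {t..}"
      then have "\<tau> * (s - t) \<le> Im \<rho> * (s - t)" using \<rho> by (intro mult_right_mono) auto
      then have "exp (- (2 * (Im \<rho> * (s - t)))) \<le> exp (2 * \<tau> * t) * exp (- 2 * \<tau> * s)"
        by (simp add: exp_add[symmetric] algebra_simps)
      then have "exp (- (2 * (Im \<rho> * (s - t)))) * ?n s \<le> exp (2 * \<tau> * t) * exp (- 2 * \<tau> * s) * ?n s"
        by (rule mult_right_mono) simp
      then show "norm (cscale (exp (2 * \<i> * \<rho> * of_real (s - t))) (f s)) \<le> exp (2 * \<tau> * t) * ?g s"
        by (simp add: mult.assoc)
    qed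
    also have "\<dots> = G t" by (simp add: G_def)
    finally show ?thesis .
  qed
  have Gle: "0 \<le> G t \<and> G t \<le> N" if t: "t \<ge> 0" for t
  proof
    have gi: "?g integrable_on {t..}"
      using absolutely_integrable_half_line_subset(2)[OF g t] by (simp add: absolutely_integrable_on_def)
    have ni: "?n integrable_on {t..}" "?n integrable_on {0..t}"
      using absolutely_integrable_half_line_subset[OF n t] by (simp_all add: absolutely_integrable_on_def)
    show "0 \<le> G t" unfolding G_def
      by (intro mult_nonneg_nonneg Henstock_Kurzweil_Integration.integral_nonneg gi) auto
    have "G t = integral {t..} (\<lambda>s. exp (2 * \<tau> * t) * ?g s)" by (simp add: G_def)
    also have "\<dots> \<le> integral {t..} ?n"
    proof (rule integral_le[OF integrable_on_mult_right[OF gi] ni(1)])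
      fix s assume "s \<in> {t..}"
      then have "exp (2 * \<tau> * t) * exp (- 2 * \<tau> * s) \<le> 1"
        using \<rho> by (simp add: exp_add[symmetric])
      then have "exp (2 * \<tau> * t) * exp (- 2 * \<tau> * s) * ?n s \<le> 1 * ?n s" by (rule mult_right_mono) simp
      then show "exp (2 * \<tau> * t) * ?g s \<le> ?n s" by (simp add: mult.assoc)
    qed
    also have "\<dots> \<le> integral {0..} ?n"
      using integral_half_line_split[OF n t] Henstock_Kurzweil_Integration.integral_nonneg[OF ni(2)] by simp
    finally show "G t \<le> N" using N by simp
  qed
  show "norm (decay \<rho> f x) \<le> N" using le[OF x] Gle[OF x] by simp
  have "primitive (\<lambda>x. 0 + integral {0..x} ?g) ?g"
    by (rule primitive_integral) (rule absolutely_integrable_half_line_subset[OF g])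
  then have "primitive (\<lambda>x. integral {0..} ?g - integral {0..x} ?g) (\<lambda>t. 0 - ?g t)"
    using primitive_diff[OF primitive_const[of "integral {0..} ?g"]] by simp
  moreover have "primitive (\<lambda>t. exp (2 * \<tau> * t)) (\<lambda>t. exp (2 * \<tau> * t) * (2 * \<tau> * 1))"
    by (rule primitive_exp) (rule primitive_of_derivative, auto intro!: derivative_eq_intros continuous_intros)
  ultimately have "primitive (\<lambda>x. exp (2 * \<tau> * x) * (integral {0..} ?g - integral {0..x} ?g))
     (\<lambda>t. exp (2 * \<tau> * t) * (0 - ?g t) + exp (2 * \<tau> * t) * (2 * \<tau> * 1) * (integral {0..} ?g - integral {0..t} ?g))"
    by (intro primitive_bilinear bounded_bilinear_mult)
  then have G: "primitive G (\<lambda>t. 2 * \<tau> * G t - ?n t)"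
  proof (rule primitive_cong)
    fix t :: real assume t: "t \<ge> 0"
    have eq: "integral {0..} ?g - integral {0..t} ?g = integral {t..} ?g"
      using integral_half_line_split[OF g t] by simp
    show "exp (2 * \<tau> * t) * (integral {0..} ?g - integral {0..t} ?g) = G t"
      unfolding eq G_def ..
    have "exp (2 * \<tau> * t) * exp (- 2 * \<tau> * t) = 1" by (simp add: exp_add[symmetric])
    then have "exp (2 * \<tau> * t) * ?g t = ?n t" by (simp add: mult.assoc[symmetric])
    then show "exp (2 * \<tau> * t) * (0 - ?g t) + exp (2 * \<tau> * t) * (2 * \<tau> * 1) * (integral {0..} ?g - integral {0..t} ?g) =
        2 * \<tau> * G t - ?n t"
      unfolding eq G_def by (simp add: algebra_simps)
  qed
  have Gi: "G absolutely_integrable_on {0..x}"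
    by (rule absolutely_integrable_continuous_real[OF primitive_continuous_on_Icc[OF G]])
  then have Gi': "G integrable_on {0..x}" by (simp add: absolutely_integrable_on_def)
  have ni: "?n integrable_on {0..x}"
    using absolutely_integrable_half_line_subset(1)[OF n x] by (simp add: absolutely_integrable_on_def)
  have ni': "?n integrable_on {x..}"
    using absolutely_integrable_half_line_subset(2)[OF n x] by (simp add: absolutely_integrable_on_def)
  have "G x - G 0 = integral {0..x} (\<lambda>t. 2 * \<tau> * G t - ?n t)"
    by (rule primitive_diff_eq[OF G _ x]) simp
  also have "\<dots> = 2 * \<tau> * integral {0..x} G - integral {0..x} ?n"
    using integrable_on_mult_right[OF Gi'] ni
    by (subst Henstock_Kurzweil_Integration.integral_diff) auto
  finally have "2 * \<tau> * integral {0..x} G = G x - G 0 + integral {0..x} ?n" by simp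
  also have "\<dots> \<le> N + N"
    using Gle[OF x] Gle[of 0] integral_half_line_split[OF n x] N
      Henstock_Kurzweil_Integration.integral_nonneg[OF ni'] by simp
  finally have Gint: "integral {0..x} G \<le> N / \<tau>" using \<rho> by (simp add: field_simps)
  have "integral {0..x} (\<lambda>t. norm (decay \<rho> f t)) \<le> integral {0..x} G"
  proof (rule integral_le[OF _ Gi'])
    have "continuous_on {0..x} (\<lambda>t. norm (decay \<rho> f t))"
      by (rule continuous_on_norm[OF primitive_continuous_on_Icc[OF primitive_decay[OF f]]])
    then show "(\<lambda>t. norm (decay \<rho> f t)) integrable_on {0..x}" by (rule integrable_continuous_real)
  qed (use le in auto)
  then show "integral {0..x} (\<lambda>t. norm (decay \<rho> f t)) \<le> N / \<tau>" using Gint by linarith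
qed

end

text \<open>\<open>P'\<close> is the inverse of \<open>P\<close>, not its derivative: it solves the
  adjoint equation, which makes \<open>P' ** P\<close> constant, and a left inverse of a square
  matrix is two-sided. Integrability of \<open>A\<close> on the whole half-line keeps both matrices
  bounded.\<close>

lemma fundamental_matrix_exists:
  fixes A :: "real \<Rightarrow> complex^'m^'m"
  assumes A: "A absolutely_integrable_on {0..}"
  shows "\<exists>P P' B. P 0 = mat 1 \<and> P' 0 = mat 1 \<and> primitive P (\<lambda>t. A t ** P t) \<and> primitive P' (\<lambda>t. - (P' t ** A t)) \<and>
     (\<forall>x\<ge>0. P' x ** P x = mat 1 \<and> P x ** P' x = mat 1 \<and> norm (P x) \<le> B \<and> norm (P' x) \<le> B)"
proof -
  have loc: "\<And>T. T \<ge> 0 \<Longrightarrow> A absolutely_integrable_on {0..T}"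
    by (rule absolutely_integrable_half_line_subset[OF A])
  have h1: "bounded_bilinear ((**) :: complex^'m^'m \<Rightarrow> complex^'m^'m \<Rightarrow> complex^'m^'m)"
    by (rule mm.bounded_bilinear_axioms)
  have h2: "bounded_bilinear (\<lambda>(A :: complex^'m^'m) (B :: complex^'m^'m). - (B ** A))"
    by (simp add: bilinear_conv_bounded_bilinear[symmetric] bilinear_def linear_iff matrix_algebra)
  have K1: "norm (A ** B) \<le> 1 * norm A * norm B" for A B :: "complex^'m^'m"
    by (simp add: norm_matrix_mult_le)
  have K2: "norm (- (B ** A)) \<le> 1 * norm A * norm B" for A B :: "complex^'m^'m"
    using norm_matrix_mult_le[of B A] by (simp add: mult.commute)
  obtain P where P: "P 0 = mat 1" "primitive P (\<lambda>t. A t ** P t)"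
    using linear_ode_exists[OF h1 zero_le_one K1 loc] by blast
  obtain P' where P': "P' 0 = mat 1" "primitive P' (\<lambda>t. - (P' t ** A t))"
    using linear_ode_exists[OF h2 zero_le_one K2 loc] by blast
  have "primitive (\<lambda>x. P' x ** P x) (\<lambda>t. P' t ** (A t ** P t) + (- (P' t ** A t)) ** P t)"
    by (rule primitive_bilinear[OF h1 P'(2) P(2)])
  then have "primitive (\<lambda>x. P' x ** P x) (\<lambda>t. 0)"
    by (simp add: matrix_algebra)
  then have inv: "P' x ** P x = mat 1" if "x \<ge> 0" for x
    using primitive_zero_imp_const[of "\<lambda>x. P' x ** P x" x] that P(1) P'(1) by simp
  define B where "B = 2 * norm (mat 1 :: complex^'m^'m) * exp (2 * (1 * integral {0..} (\<lambda>s. norm (A s))))"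
  have nA: "(\<lambda>s. norm (A s)) absolutely_integrable_on {0..}"
    using absolutely_integrable_norm[OF A] by (simp add: o_def)
  have le: "2 * norm (mat 1 :: complex^'m^'m) * exp (2 * (1 * integral {0..x} (\<lambda>s. norm (A s)))) \<le> B" if x: "x \<ge> 0" for x
  proof -
    have "(\<lambda>s. norm (A s)) integrable_on {x..}"
      using absolutely_integrable_half_line_subset(2)[OF nA x] by (simp add: absolutely_integrable_on_def)
    then have "integral {x..} (\<lambda>s. norm (A s)) \<ge> 0"
      by (rule Henstock_Kurzweil_Integration.integral_nonneg) simp
    then show ?thesis unfolding B_def using integral_half_line_split[OF nA x]
      by (intro mult_left_mono) simp_all
  qed
  have "norm (P x) \<le> B" "norm (P' x) \<le> B" if "x \<ge> 0" for x
    using linear_ode_bound[OF h1 zero_le_one K1 loc P(2) that] linear_ode_bound[OF h2 zero_le_one K2 loc P'(2) that]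
      le[OF that] P(1) P'(1) by auto
  then show ?thesis
    using P P' inv matrix_left_right_inverse by blast
qed

lemma exp_growth_cancel:
  fixes c :: "complex^'n^'m"
  assumes "\<And>x. x \<ge> 0 \<Longrightarrow> norm (cscale (exp (a * of_real x) - 1) c) \<le> M" "Re a > 0"
  shows "c = 0"
proof (rule ccontr)
  assume "c \<noteq> 0"
  then have c: "norm c > 0" by simp
  have "filterlim (\<lambda>x::real. exp (Re a * x)) at_top at_top"
    by (rule filterlim_compose[OF exp_at_top filterlim_tendsto_pos_mult_at_top[OF tendsto_const \<open>Re a > 0\<close> filterlim_ident]])
  then have "\<forall>\<^sub>F x in at_top. exp (Re a * x) > M / norm c + 1 \<and> x \<ge> 0"
    by (intro eventually_conj eventually_ge_at_top) (simp add: filterlim_at_top_dense)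
  then obtain x where x: "exp (Re a * x) > M / norm c + 1" "x \<ge> 0"
    using eventually_happens[of _ "at_top :: real filter"] by auto
  have "norm (exp (a * of_real x)) - norm (1 :: complex) \<le> norm (exp (a * of_real x) - 1)"
    by (rule norm_triangle_ineq2)
  then have "M / norm c < norm (exp (a * of_real x) - 1)" using x by simp
  then have "M < norm (exp (a * of_real x) - 1) * norm c" using c by (simp add: divide_less_eq)
  then show False using assms(1)[OF x(2)] by simp
qed

text \<open>With \<open>V = Y' - \<i> \<rho> Y + Q Y\<close> the pencil equation becomes
  \<open>Y' = (\<i> \<rho> - Q) Y + V\<close>, \<open>V' = (- \<i> \<rho> + Q) V - q Y\<close> where \<open>q = Q\<^sub>0 - Q' + Q\<^sup>2\<close>. The matrices \<open>Pm\<close>, \<open>Pp\<close>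
  are the leading coefficients of the two exponential solutions, \<open>Pm'\<close>, \<open>Pp'\<close> their inverses.\<close>

locale factored =
  fixes Q q Pm Pm' Pp Pp' :: "real \<Rightarrow> complex^'m::finite^'m" and B N :: real
  assumes Q: "Q absolutely_integrable_on {0..}" and q: "q absolutely_integrable_on {0..}"
    and N: "integral {0..} (\<lambda>s. norm (q s)) \<le> N"
    and Pm: "primitive Pm (\<lambda>t. - (Q t ** Pm t))" and Pm': "primitive Pm' (\<lambda>t. Pm' t ** Q t)"
    and Pp: "primitive Pp (\<lambda>t. Q t ** Pp t)" and Pp': "primitive Pp' (\<lambda>t. - (Pp' t ** Q t))"
    and init: "Pm 0 = mat 1" "Pm' 0 = mat 1" "Pp 0 = mat 1" "Pp' 0 = mat 1"
    and inv: "\<And>x. x \<ge> 0 \<Longrightarrow> Pm x ** Pm' x = mat 1" "\<And>x. x \<ge> 0 \<Longrightarrow> Pm' x ** Pm x = mat 1"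
      "\<And>x. x \<ge> 0 \<Longrightarrow> Pp x ** Pp' x = mat 1" "\<And>x. x \<ge> 0 \<Longrightarrow> Pp' x ** Pp x = mat 1"
    and bound: "\<And>x. x \<ge> 0 \<Longrightarrow> norm (Pm x) \<le> B" "\<And>x. x \<ge> 0 \<Longrightarrow> norm (Pm' x) \<le> B"
      "\<And>x. x \<ge> 0 \<Longrightarrow> norm (Pp x) \<le> B" "\<And>x. x \<ge> 0 \<Longrightarrow> norm (Pp' x) \<le> B"
begin

lemma B_nonneg: "0 \<le> B" using order_trans[OF norm_ge_zero bound(1)[of 0]] by simp

lemma q_norm: "(\<lambda>s. norm (q s)) absolutely_integrable_on {0..}"
  using absolutely_integrable_norm[OF q] by (simp add: o_def)

lemma N_nonneg: "0 \<le> N"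
proof -
  have "0 \<le> integral {0..} (\<lambda>s. norm (q s))"
    using q_norm by (intro Henstock_Kurzweil_Integration.integral_nonneg) (auto simp: absolutely_integrable_on_def)
  then show ?thesis using N by simp
qed

lemmas P_cont = Pm[THEN primitive_continuous_on] Pm'[THEN primitive_continuous_on]
  Pp[THEN primitive_continuous_on] Pp'[THEN primitive_continuous_on]

text \<open>For \<open>Y = Pm z exp (\<i> \<rho> x)\<close> and \<open>V = w exp (\<i> \<rho> x)\<close> the system reads \<open>w = Pp W\<close>, \<open>W' = - 2 \<i> \<rho> W - src z\<close>,
  \<open>z' = Pm' Pp W\<close>; the decaying solution has \<open>W = decay \<rho> (src z)\<close> and is a fixed point in \<open>z\<close>.\<close>

definition src :: "(real \<Rightarrow> complex^'m^'m) \<Rightarrow> real \<Rightarrow> complex^'m^'m" where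
  "src z t = Pp' t ** (q t ** (Pm t ** z t))"

lemma src_integrable:
  assumes z: "continuous_on {0..} z" and k: "\<And>x. x \<ge> 0 \<Longrightarrow> norm (z x) \<le> k"
  shows "src z absolutely_integrable_on {0..}" "integral {0..} (\<lambda>s. norm (src z s)) \<le> B ^ 2 * N * k"
proof -
  have c: "continuous_on {0..} (\<lambda>t. Pm t ** z t)"
    by (rule mm.continuous_on[OF P_cont(1) z])
  have qz: "(\<lambda>t. q t ** (Pm t ** z t)) absolutely_integrable_on {0..}"
    by (rule absolutely_integrable_half_line_bilinear[OF mm.flip c _ q, of "B * k"])
      (intro norm_mm_le bound k)
  show s: "src z absolutely_integrable_on {0..}"
    unfolding src_def[abs_def]
    by (rule absolutely_integrable_half_line_bilinear[OF mm.bounded_bilinear_axioms P_cont(4) bound(4) qz])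
  have ns: "(\<lambda>s. norm (src z s)) integrable_on {0..}" using s by (simp add: absolutely_integrable_on_def)
  have nq: "(\<lambda>s. norm (q s)) integrable_on {0..}" using q by (simp add: absolutely_integrable_on_def)
  have "0 \<le> k" using order_trans[OF norm_ge_zero k[of 0]] by simp
  have "integral {0..} (\<lambda>s. norm (src z s)) \<le> integral {0..} (\<lambda>s. (B ^ 2 * k) * norm (q s))"
  proof (rule integral_le[OF ns integrable_on_mult_right[OF nq]])
    fix s :: real assume "s \<in> {0..}"
    then have "norm (src z s) \<le> B * (norm (q s) * (B * k))"
      unfolding src_def by (intro norm_mm_le bound k order_refl) auto
    then show "norm (src z s) \<le> (B ^ 2 * k) * norm (q s)" by (simp add: power2_eq_square mult_ac)
  qed
  also have "\<dots> = B ^ 2 * k * integral {0..} (\<lambda>s. norm (q s))" by simp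
  also have "\<dots> \<le> B ^ 2 * k * N" using N \<open>0 \<le> k\<close> by (intro mult_left_mono) auto
  finally show "integral {0..} (\<lambda>s. norm (src z s)) \<le> B ^ 2 * N * k" by (simp add: mult_ac)
qed

lemma src_diff: "src (\<lambda>t. y t - z t) = (\<lambda>t. src y t - src z t)"
  by (simp add: src_def[abs_def] matrix_algebra)

section \<open>Decaying, bounded and growing solutions for large Im \<rho>\<close>

context
  fixes \<rho> :: complex and \<tau> :: real
  assumes \<rho>: "Im \<rho> \<ge> \<tau>" "\<tau> > 0" and \<tau>: "\<tau> \<ge> 2 * B ^ 4 * N"
begin

lemma primitive_reduced_op:
  assumes z: "continuous_on {0..} z" and k: "\<And>x. x \<ge> 0 \<Longrightarrow> norm (z x) \<le> k"
  shows "primitive (\<lambda>x. c + integral {0..x} (\<lambda>t. Pm' t ** (Pp t ** decay \<rho> (src z) t)))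
     (\<lambda>t. Pm' t ** (Pp t ** decay \<rho> (src z) t))"
proof (rule primitive_integral, rule absolutely_integrable_continuous_real)
  fix T :: real
  have "continuous_on {0..} (\<lambda>t. Pm' t ** (Pp t ** decay \<rho> (src z) t))"
    by (rule mm.continuous_on[OF P_cont(2) mm.continuous_on[OF P_cont(3)
        primitive_continuous_on[OF primitive_decay[OF \<rho> src_integrable(1)[OF z k]]]]])
  then show "continuous_on {0..T} (\<lambda>t. Pm' t ** (Pp t ** decay \<rho> (src z) t))"
    by (rule continuous_on_subset) auto
qed

text \<open>Two factors \<open>B\<close> come from \<open>Pm'\<close> and \<open>Pp\<close>, two
  from \<open>src\<close>, and 1/\<tau> from the integrated bound for \<open>decay\<close>. The
  condition \<tau> \<ge> 2 B^4 N of this context is what turns the product into a factor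
  1/2.\<close>

lemma reduced_op_bound:
  assumes z: "continuous_on {0..} z" and k: "\<And>x. x \<ge> 0 \<Longrightarrow> norm (z x) \<le> k" and x: "x \<ge> 0"
  shows "norm (integral {0..x} (\<lambda>t. Pm' t ** (Pp t ** decay \<rho> (src z) t))) \<le> B ^ 4 * N * k / \<tau>"
    "norm (integral {0..x} (\<lambda>t. Pm' t ** (Pp t ** decay \<rho> (src z) t))) \<le> k / 2"
proof -
  note s = src_integrable[OF z k]
  have "0 \<le> k" using order_trans[OF norm_ge_zero k[of 0]] by simp
  have c: "continuous_on {0..x} (\<lambda>t. norm (decay \<rho> (src z) t))"
    by (rule continuous_on_norm[OF primitive_continuous_on_Icc[OF primitive_decay[OF \<rho> s(1)]]])
  have "norm (integral {0..x} (\<lambda>t. Pm' t ** (Pp t ** decay \<rho> (src z) t))) \<le> integral {0..x} (\<lambda>t. B ^ 2 * norm (decay \<rho> (src z) t))"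
  proof (rule Henstock_Kurzweil_Integration.integral_norm_bound_integral)
    show "(\<lambda>t. Pm' t ** (Pp t ** decay \<rho> (src z) t)) integrable_on {0..x}"
      by (rule primitive_integrable_on[OF primitive_reduced_op[OF z k]]) auto
    show "(\<lambda>t. B\<^sup>2 * norm (decay \<rho> (src z) t)) integrable_on {0..x}"
      by (rule integrable_continuous_real) (intro continuous_intros c)
    fix t assume "t \<in> {0..x}"
    then have "norm (Pm' t ** (Pp t ** decay \<rho> (src z) t)) \<le> B * (B * norm (decay \<rho> (src z) t))"
      by (intro norm_mm_le bound order_refl) auto
    then show "norm (Pm' t ** (Pp t ** decay \<rho> (src z) t)) \<le> B\<^sup>2 * norm (decay \<rho> (src z) t)"
      by (simp add: power2_eq_square mult_ac)
  qed
  also have "\<dots> = B\<^sup>2 * integral {0..x} (\<lambda>t. norm (decay \<rho> (src z) t))" by simp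
  also have "\<dots> \<le> B\<^sup>2 * (B ^ 2 * N * k / \<tau>)"
    by (intro mult_left_mono decay_bounds(2)[OF \<rho> s x]) auto
  finally show 1: "norm (integral {0..x} (\<lambda>t. Pm' t ** (Pp t ** decay \<rho> (src z) t))) \<le> B ^ 4 * N * k / \<tau>"
    by (simp add: power4_eq_xxxx power2_eq_square mult_ac)
  have "2 * B ^ 4 * N * k \<le> \<tau> * k" using \<tau> \<open>0 \<le> k\<close> by (rule mult_right_mono)
  then have "B ^ 4 * N * k / \<tau> \<le> k / 2" using \<rho> by (simp add: field_simps)
  then show "norm (integral {0..x} (\<lambda>t. Pm' t ** (Pp t ** decay \<rho> (src z) t))) \<le> k / 2" using 1 by linarith
qed

text \<open>A contraction on bounded continuous functions yields \<open>z\<close>, normalised at 0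
  because the boundary form is evaluated there. The difference \<open>z - mat 1\<close> is an
  integral of the decaying part and thus O(1/\<tau>), whereas \<open>w = Pp D\<close> inherits only
  the pointwise bound of \<open>decay\<close>.\<close>

lemma decaying_solution_exists:
  "\<exists>z w. z 0 = mat 1 \<and> primitive (\<lambda>x. Pm x ** z x) (\<lambda>t. w t - Q t ** (Pm t ** z t)) \<and>
     primitive w (\<lambda>t. cscale (- 2 * \<i> * \<rho>) (w t) + Q t ** w t - q t ** (Pm t ** z t)) \<and>
     (\<forall>x\<ge>0. norm (z x - mat 1) \<le> 2 * B ^ 4 * N * norm (mat 1 :: complex^'m^'m) / \<tau> \<and>
        norm (z x) \<le> 2 * norm (mat 1 :: complex^'m^'m) \<and>
        norm (w x) \<le> 2 * B ^ 3 * N * norm (mat 1 :: complex^'m^'m))"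
proof -
  let ?I = "mat 1 :: complex^'m^'m"
  define U where "U z x = ?I + integral {0..x} (\<lambda>t. Pm' t ** (Pp t ** decay \<rho> (src z) t))" for z x
  let ?ws = "weighted_space {{0..}} (\<lambda>x. 1) :: (real \<Rightarrow> complex^'m^'m) set"
  have wsD: "continuous_on {0..} z" "\<exists>k. \<forall>x\<ge>0. norm (z x) \<le> k" if "z \<in> ?ws" for z
    using that by (auto simp: weighted_space_def)
  have wsI: "z \<in> ?ws" if "continuous_on {0..} z" "\<And>x. x \<ge> 0 \<Longrightarrow> norm (z x) \<le> k" for z k
    using that by (auto simp: weighted_space_def)
  have "\<exists>z\<in>?ws. \<forall>S\<in>{{0..}}. \<forall>x\<in>S. z x = U z x"
  proof (rule weighted_contraction_fixpoint)
    fix z assume "z \<in> ?ws"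
    from wsD[OF this] obtain k where z: "continuous_on {0..} z" and "\<forall>x\<ge>0. norm (z x) \<le> k" by (elim exE)
    then have k: "\<And>x. x \<ge> 0 \<Longrightarrow> norm (z x) \<le> k" by simp
    show "U z \<in> ?ws"
    proof (rule wsI)
      show "continuous_on {0..} (U z)"
        unfolding U_def[abs_def] by (rule primitive_continuous_on[OF primitive_reduced_op[OF z k]])
      show "norm (U z x) \<le> norm ?I + k / 2" if "x \<ge> 0" for x
        unfolding U_def by (rule norm_triangle_le) (use reduced_op_bound(2)[OF z k that] in simp)
    qed
  next
    fix y z :: "real \<Rightarrow> complex^'m^'m" and S k x
    assume y: "y \<in> ?ws" and z: "z \<in> ?ws" and S: "S \<in> {{0..}}" and x: "x \<in> S"
      and le: "\<And>x. x \<in> S \<Longrightarrow> norm (y x - z x) \<le> k * 1"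
    obtain ky where "\<forall>x\<ge>0. norm (y x) \<le> ky" using wsD(2)[OF y] by (elim exE)
    then have ky: "\<And>x. x \<ge> 0 \<Longrightarrow> norm (y x) \<le> ky" by simp
    obtain kz where "\<forall>x\<ge>0. norm (z x) \<le> kz" using wsD(2)[OF z] by (elim exE)
    then have kz: "\<And>x. x \<ge> 0 \<Longrightarrow> norm (z x) \<le> kz" by simp
    have x0: "x \<ge> 0" using S x by auto
    have yz: "continuous_on {0..} (\<lambda>t. y t - z t)" using wsD(1)[OF y] wsD(1)[OF z] by (rule continuous_on_diff)
    have le': "\<And>x. x \<ge> 0 \<Longrightarrow> norm (y x - z x) \<le> k" using le S by simp
    have "U y x - U z x = integral {0..x} (\<lambda>t. Pm' t ** (Pp t ** decay \<rho> (src y) t)) -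
        integral {0..x} (\<lambda>t. Pm' t ** (Pp t ** decay \<rho> (src z) t))" by (simp add: U_def)
    also have "\<dots> = integral {0..x} (\<lambda>t. Pm' t ** (Pp t ** decay \<rho> (src y) t) - Pm' t ** (Pp t ** decay \<rho> (src z) t))"
      by (rule Henstock_Kurzweil_Integration.integral_diff[symmetric];
          rule primitive_integrable_on[OF primitive_reduced_op], (rule wsD y z ky kz order_refl | assumption)+)
    also have "\<dots> = integral {0..x} (\<lambda>t. Pm' t ** (Pp t ** decay \<rho> (src (\<lambda>t. y t - z t)) t))"
    proof (rule Henstock_Kurzweil_Integration.integral_cong)
      fix t assume "t \<in> {0..x}"
      then have "decay \<rho> (src (\<lambda>t. y t - z t)) t = decay \<rho> (src y) t - decay \<rho> (src z) t"
        unfolding src_diff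
        by (intro decay_diff[OF \<rho> src_integrable(1)[OF wsD(1)[OF y] ky] src_integrable(1)[OF wsD(1)[OF z] kz]]) auto
      then show "Pm' t ** (Pp t ** decay \<rho> (src y) t) - Pm' t ** (Pp t ** decay \<rho> (src z) t) =
          Pm' t ** (Pp t ** decay \<rho> (src (\<lambda>t. y t - z t)) t)"
        by (simp only: mm.diff_right)
    qed
    finally have "norm (U y x - U z x) \<le> k / 2" using reduced_op_bound(2)[OF yz le' x0] by simp
    then show "norm (U y x - U z x) \<le> k / 2 * 1" by simp
  next
    fix S :: "real set" show "\<exists>B. \<forall>x\<in>S. (0::real) \<le> 1 \<and> (1::real) \<le> B" by (intro exI[of _ 1]) simp
  qed
  then obtain z where zw: "z \<in> ?ws" and fix_z: "\<And>x. x \<ge> 0 \<Longrightarrow> z x = U z x" by auto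
  obtain k0 where "\<forall>x\<ge>0. norm (z x) \<le> k0" using wsD(2)[OF zw] by (elim exE)
  then have k0: "\<And>x. x \<ge> 0 \<Longrightarrow> norm (z x) \<le> k0" by simp
  note zc = wsD(1)[OF zw]
  have z_le: "norm (z x) \<le> 2 * norm ?I" if "x \<ge> 0" for x
  proof (rule self_improving_bound[where f = "\<lambda>x. norm (z x)" and S = "{0..}"])
    show "\<exists>B. \<forall>x\<in>{0..}. norm (z x) \<le> B" using k0 by auto
    fix k y assume k: "\<And>x. x \<in> {0..} \<Longrightarrow> norm (z x) \<le> k" and y: "y \<in> {0::real..}"
    have "norm (U z y) \<le> norm ?I + k / 2"
      unfolding U_def by (rule norm_triangle_le) (use reduced_op_bound(2)[OF zc, of k y] k y in simp)
    then show "norm (z y) \<le> norm ?I + k / 2" using fix_z[of y] y by simp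
  qed (use that in simp)
  have z_I: "norm (z x - ?I) \<le> 2 * B ^ 4 * N * norm ?I / \<tau>" if "x \<ge> 0" for x
    using fix_z[OF that] reduced_op_bound(1)[OF zc z_le that] by (simp add: U_def mult_ac)
  define D where "D = decay \<rho> (src z)"
  have D: "primitive D (\<lambda>t. cscale (- 2 * \<i> * \<rho>) (D t) - src z t)"
    unfolding D_def by (rule primitive_decay[OF \<rho> src_integrable(1)[OF zc k0]])
  have "primitive (U z) (\<lambda>t. Pm' t ** (Pp t ** D t))"
    unfolding U_def[abs_def] D_def by (rule primitive_reduced_op[OF zc k0])
  then have z': "primitive z (\<lambda>t. Pm' t ** (Pp t ** D t))"
    by (rule primitive_cong) (simp_all add: fix_z[symmetric])
  have "primitive (\<lambda>x. Pm x ** z x) (\<lambda>t. Pm t ** (Pm' t ** (Pp t ** D t)) + (- (Q t ** Pm t)) ** z t)"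
    by (rule primitive_bilinear[OF mm.bounded_bilinear_axioms Pm z'])
  then have y: "primitive (\<lambda>x. Pm x ** z x) (\<lambda>t. Pp t ** D t - Q t ** (Pm t ** z t))"
    by (rule primitive_cong) (simp_all add: matrix_algebra inv)
  have "primitive (\<lambda>t. Pp t ** D t) (\<lambda>t. Pp t ** (cscale (- 2 * \<i> * \<rho>) (D t) - src z t) + (Q t ** Pp t) ** D t)"
    by (rule primitive_bilinear[OF mm.bounded_bilinear_axioms Pp D])
  then have w: "primitive (\<lambda>t. Pp t ** D t)
     (\<lambda>t. cscale (- 2 * \<i> * \<rho>) (Pp t ** D t) + Q t ** (Pp t ** D t) - q t ** (Pm t ** z t))"
    by (rule primitive_cong) (simp_all add: matrix_algebra inv src_def)
  have w_le: "norm (Pp x ** D x) \<le> 2 * B ^ 3 * N * norm ?I" if "x \<ge> 0" for x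
  proof -
    have "norm (Pp x ** D x) \<le> B * (B ^ 2 * N * (2 * norm ?I))"
      unfolding D_def
      by (intro norm_mm_le bound that decay_bounds(1)[OF \<rho> src_integrable(1)[OF zc k0] src_integrable(2)[OF zc z_le]])
    then show ?thesis by (simp add: power3_eq_cube power2_eq_square mult_ac)
  qed
  have z0: "z 0 = ?I" using fix_z[of 0] by (simp add: U_def)
  show ?thesis
    by (intro exI[of _ z] exI[of _ "\<lambda>t. Pp t ** D t"] conjI allI impI z0 y w z_I z_le w_le)
qed

text \<open>A bounded solution has no growing component: \<open>Pp' y\<close> has an integrable derivative up to
  the term \<open>exp (- 2 \<i> \<rho> x) c\<close>.\<close>

lemma bounded_solution_zero:
  fixes y w :: "real \<Rightarrow> complex^'m^'m"
  assumes y: "primitive y (\<lambda>t. w t - Q t ** y t)"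
    and w: "primitive w (\<lambda>t. cscale (- 2 * \<i> * \<rho>) (w t) + Q t ** w t - q t ** y t)"
    and y0: "y 0 = 0" and k: "\<And>x. x \<ge> 0 \<Longrightarrow> norm (y x) \<le> k" and x: "x \<ge> 0"
  shows "y x = 0"
proof -
  define z where "z t = Pm' t ** y t" for t
  have y_z: "y t = Pm t ** z t" if "t \<ge> 0" for t
    using that by (simp add: z_def matrix_algebra inv)
  have "primitive z (\<lambda>t. Pm' t ** (w t - Q t ** y t) + (Pm' t ** Q t) ** y t)"
    unfolding z_def[abs_def] by (rule primitive_bilinear[OF mm.bounded_bilinear_axioms Pm' y])
  then have z': "primitive z (\<lambda>t. Pm' t ** w t)"
    by (simp add: matrix_algebra)
  note zc = primitive_continuous_on[OF z']
  have zk: "norm (z t) \<le> B * k" if "t \<ge> 0" for t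
    unfolding z_def by (intro norm_mm_le bound k that)
  note s = src_integrable[OF zc zk]
  define W where "W = decay \<rho> (src z)"
  have W: "primitive W (\<lambda>t. cscale (- 2 * \<i> * \<rho>) (W t) - src z t)"
    unfolding W_def by (rule primitive_decay[OF \<rho> s(1)])
  \<comment> \<open>\<open>v\<close> measures how far \<open>w\<close> is from the decaying branch.
    It solves v' = -2i\<rho> v and therefore grows like exp(2 Im \<rho> x) unless v(0) = 0.\<close>
  define v where "v t = Pp' t ** w t - W t" for t
  have "primitive (\<lambda>t. Pp' t ** w t) (\<lambda>t. Pp' t ** (cscale (- 2 * \<i> * \<rho>) (w t) + Q t ** w t - q t ** y t) + (- (Pp' t ** Q t)) ** w t)"
    by (rule primitive_bilinear[OF mm.bounded_bilinear_axioms Pp' w])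
  from primitive_diff[OF this W] have "primitive v (\<lambda>t. cscale (- 2 * \<i> * \<rho>) (v t))"
    by (rule primitive_cong) (simp_all add: v_def matrix_algebra src_def y_z)
  note primitive_bilinear[OF cscale.bounded_bilinear_axioms primitive_cexp[of "2 * \<i> * \<rho>"] this]
  then have const: "primitive (\<lambda>t. cscale (exp (2 * \<i> * \<rho> * of_real t)) (v t)) (\<lambda>t. 0)"
    by (rule primitive_cong) (simp_all add: matrix_algebra cscale.add_left[symmetric])
  have v: "v t = cscale (exp (- 2 * \<i> * \<rho> * of_real t)) (v 0)" if "t \<ge> 0" for t
  proof -
    have "v 0 = cscale (exp (2 * \<i> * \<rho> * of_real t)) (v t)"
      using primitive_zero_imp_const[OF const that] by (simp add: cscale_one)
    then have "cscale (exp (- 2 * \<i> * \<rho> * of_real t)) (v 0) =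
        cscale (exp (- 2 * \<i> * \<rho> * of_real t) * exp (2 * \<i> * \<rho> * of_real t)) (v t)"
      by (simp only: cscale_cscale)
    then show ?thesis by (simp add: exp_add[symmetric] cscale_one)
  qed
  have "v 0 = 0"
  proof -
    \<comment> \<open>With \<open>Pp'\<close> in place of \<open>Pm'\<close> the growing term is a
      scalar exponential times the constant matrix \<open>v 0\<close>, and it has the explicit
      primitive \<open>cscale (e t) c\<close>. The price is a term \<open>- 2 Pp' Q y\<close>, which
      is integrable because \<open>y\<close> is bounded.\<close>
    define F where "F t = Pp' t ** y t" for t
    have "primitive F (\<lambda>t. Pp' t ** (w t - Q t ** y t) + (- (Pp' t ** Q t)) ** y t)"
      unfolding F_def[abs_def] by (rule primitive_bilinear[OF mm.bounded_bilinear_axioms Pp' y])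
    moreover define e where "e t = exp (- 2 * \<i> * \<rho> * of_real t)" for t :: real
    define c where "c = cscale (inverse (- 2 * \<i> * \<rho>)) (v 0)"
    have "\<rho> \<noteq> 0" using \<rho> by auto
    have "primitive (\<lambda>t. cscale (e t) c) (\<lambda>t. cscale (e t) 0 + cscale (- 2 * \<i> * \<rho> * e t) c)"
      unfolding e_def by (rule primitive_bilinear[OF cscale.bounded_bilinear_axioms primitive_cexp primitive_const])
    ultimately have "primitive (\<lambda>t. F t - cscale (e t) c)
       (\<lambda>t. (Pp' t ** (w t - Q t ** y t) + (- (Pp' t ** Q t)) ** y t) -
         (cscale (e t) 0 + cscale (- 2 * \<i> * \<rho> * e t) c))"
      by (intro primitive_diff)
    then have H: "primitive (\<lambda>t. F t - cscale (e t) c) (\<lambda>t. W t - 2 *\<^sub>R (Pp' t ** (Q t ** y t)))"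
    proof (rule primitive_cong)
      fix t :: real assume t: "t \<ge> 0"
      have "(- 2 * \<i> * \<rho> * e t) * inverse (- 2 * \<i> * \<rho>) = e t" using \<open>\<rho> \<noteq> 0\<close> by (simp add: field_simps)
      then have 1: "cscale (- 2 * \<i> * \<rho> * e t) c = cscale (e t) (v 0)"
        unfolding c_def cscale_cscale by (rule arg_cong)
      have 2: "Pp' t ** w t = W t + cscale (e t) (v 0)"
        using v[OF t] by (simp add: v_def e_def algebra_simps)
      show "(Pp' t ** (w t - Q t ** y t) + (- (Pp' t ** Q t)) ** y t) -
         (cscale (e t) 0 + cscale (- 2 * \<i> * \<rho> * e t) c) = W t - 2 *\<^sub>R (Pp' t ** (Q t ** y t))"
        unfolding 1 mm.diff_right 2 by (simp add: matrix_algebra scaleR_2)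
    qed simp
    have nQ: "(\<lambda>s. norm (Q s)) absolutely_integrable_on {0..}"
      using absolutely_integrable_norm[OF Q] by (simp add: o_def)
    define MQ where "MQ = integral {0..} (\<lambda>s. norm (Q s))"
    have "0 \<le> k" using order_trans[OF norm_ge_zero k[of 0]] by simp
    define M where "M = (B ^ 2 * N * (B * k)) / \<tau> + 2 * (B * k) * MQ"
    have bd: "norm ((F t - cscale (e t) c) - (F 0 - cscale (e 0) c)) \<le> M"
      if t: "t \<ge> 0" for t
    proof -
      have cW: "continuous_on {0..t} (\<lambda>s. norm (W s))"
        by (rule continuous_on_norm[OF primitive_continuous_on_Icc[OF W]])
      then have iW: "(\<lambda>s. norm (W s)) integrable_on {0..t}" by (rule integrable_continuous_real)
      have iQ: "(\<lambda>s. norm (Q s)) integrable_on {0..t}" "(\<lambda>s. norm (Q s)) integrable_on {t..}"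
        using absolutely_integrable_half_line_subset[OF nQ t] by (simp_all add: absolutely_integrable_on_def)
      have "norm (integral {0..t} (\<lambda>s. W s - 2 *\<^sub>R (Pp' s ** (Q s ** y s)))) \<le>
          integral {0..t} (\<lambda>s. norm (W s) + 2 * (B * k) * norm (Q s))"
      proof (rule Henstock_Kurzweil_Integration.integral_norm_bound_integral)
        show "(\<lambda>s. W s - 2 *\<^sub>R (Pp' s ** (Q s ** y s))) integrable_on {0..t}"
          by (rule primitive_integrable_on[OF H]) simp
        show "(\<lambda>s. norm (W s) + 2 * (B * k) * norm (Q s)) integrable_on {0..t}"
          by (intro Henstock_Kurzweil_Integration.integrable_add integrable_on_mult_right iW iQ)
        fix s assume "s \<in> {0..t}"
        then have "norm (Pp' s ** (Q s ** y s)) \<le> B * (norm (Q s) * k)"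
          by (intro norm_mm_le bound k order_refl) auto
        then show "norm (W s - 2 *\<^sub>R (Pp' s ** (Q s ** y s))) \<le> norm (W s) + 2 * (B * k) * norm (Q s)"
          using norm_triangle_ineq4[of "W s" "2 *\<^sub>R (Pp' s ** (Q s ** y s))"] by (simp add: mult_ac)
      qed
      also have "\<dots> = integral {0..t} (\<lambda>s. norm (W s)) + 2 * (B * k) * integral {0..t} (\<lambda>s. norm (Q s))"
        using iW integrable_on_mult_right[OF iQ(1)]
        by (subst Henstock_Kurzweil_Integration.integral_add) auto
      also have "\<dots> \<le> M"
        unfolding M_def
      proof (intro add_mono mult_left_mono)
        show "integral {0..t} (\<lambda>s. norm (W s)) \<le> (B ^ 2 * N * (B * k)) / \<tau>"
          unfolding W_def by (rule decay_bounds(2)[OF \<rho> s t])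
        show "integral {0..t} (\<lambda>s. norm (Q s)) \<le> MQ"
          using integral_half_line_split[OF nQ t] Henstock_Kurzweil_Integration.integral_nonneg[OF iQ(2)] by (simp add: MQ_def)
        show "0 \<le> 2 * (B * k)" using B_nonneg \<open>0 \<le> k\<close> by simp
      qed
      finally show ?thesis using primitive_diff_eq[OF H order_refl t] by simp
    qed
    have "c = 0"
    proof (rule exp_growth_cancel[where a = "- 2 * \<i> * \<rho>" and M = "M + B * k"])
      show "Re (- 2 * \<i> * \<rho>) > 0" using \<rho> by simp
      fix t :: real assume t: "t \<ge> 0"
      have "F 0 = 0" by (simp add: F_def y0)
      then have eq: "cscale (exp (- 2 * \<i> * \<rho> * of_real t) - 1) c =
          F t - ((F t - cscale (e t) c) - (F 0 - cscale (e 0) c))"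
        by (simp add: e_def cscale.diff_left cscale_one)
      have "norm (F t) \<le> B * k" unfolding F_def by (intro norm_mm_le bound k t)
      then show "norm (cscale (exp (- 2 * \<i> * \<rho> * of_real t) - 1) c) \<le> M + B * k"
        unfolding eq using bd[OF t] by (intro norm_triangle_le_diff) linarith
    qed
    then have "norm (cscale (inverse (- 2 * \<i> * \<rho>)) (v 0)) = 0" by (simp add: c_def)
    then show ?thesis using \<open>\<rho> \<noteq> 0\<close> by (simp add: norm_mult norm_inverse)
  qed
  then have "Pp' t ** w t = W t" if "t \<ge> 0" for t
    using v[OF that] by (simp add: v_def cscale.zero_right)
  then have "Pp t ** (Pp' t ** w t) = Pp t ** W t" if "t \<ge> 0" for t
    using that by simp
  then have wW: "w t = Pp t ** W t" if "t \<ge> 0" for t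
    using that by (simp add: matrix_algebra inv)
  have z0: "z 0 = 0" by (simp add: z_def y0)
  have zeq: "z t = integral {0..t} (\<lambda>t. Pm' t ** (Pp t ** decay \<rho> (src z) t))" if "t \<ge> 0" for t
  proof -
    have "primitive z (\<lambda>t. Pm' t ** (Pp t ** W t))"
      by (rule primitive_cong[OF z']) (simp_all add: wW)
    from primitive_eq[OF this that] show ?thesis by (simp add: z0 W_def)
  qed
  \<comment> \<open>With the growing part gone, \<open>z\<close> is a fixed point of the homogeneous
    reduced equation, so its bound halves itself with additive constant 0.\<close>
  have "norm (z x) \<le> 2 * 0"
  proof (rule self_improving_bound[where f = "\<lambda>x. norm (z x)" and S = "{0..}"])
    show "\<exists>B. \<forall>x\<in>{0..}. norm (z x) \<le> B" using zk by auto
    fix k t assume k: "\<And>x. x \<in> {0..} \<Longrightarrow> norm (z x) \<le> k" and t: "t \<in> {0::real..}"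
    show "norm (z t) \<le> 0 + k / 2"
      using zeq[of t] reduced_op_bound(2)[OF zc, of k t] k t by simp
  qed (use x in simp)
  then show ?thesis using y_z[OF x] by simp
qed

text \<open>The solution is taken after multiplication by exp(i\<rho>x), which turns growth like
  exp(-i\<rho>x) into boundedness. \<open>Y\<close> is driven by a bounded \<open>V\<close> through
  the damped kernel exp(2i\<rho>(x - t)), hence it is O(1/\<tau>) pointwise; \<open>Pp' V\<close>
  changes only through \<open>q Y\<close> and stays within O(1/\<tau>) of its initial value.\<close>

lemma growing_solution_bounds:
  fixes Y V :: "real \<Rightarrow> complex^'m^'m"
  assumes Y: "primitive Y (\<lambda>t. cscale (2 * \<i> * \<rho>) (Y t) - Q t ** Y t + V t)" "Y 0 = 0"
    and V: "primitive V (\<lambda>t. Q t ** V t - q t ** Y t)" "V 0 = mat 1" and x: "x \<ge> 0"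
  shows "norm (Y x) \<le> B ^ 3 * norm (mat 1 :: complex^'m^'m) / \<tau>"
    "norm (Pp' x ** V x - mat 1) \<le> B ^ 4 * N * norm (mat 1 :: complex^'m^'m) / \<tau>"
proof -
  let ?I = "mat 1 :: complex^'m^'m"
  define v where "v t = Pp' t ** V t" for t
  have V_v: "V t = Pp t ** v t" if "t \<ge> 0" for t using that by (simp add: v_def matrix_algebra inv)
  have "primitive v (\<lambda>t. Pp' t ** (Q t ** V t - q t ** Y t) + (- (Pp' t ** Q t)) ** V t)"
    unfolding v_def[abs_def] by (rule primitive_bilinear[OF mm.bounded_bilinear_axioms Pp' V(1)])
  then have v: "primitive v (\<lambda>t. - (Pp' t ** (q t ** Y t)))" by (simp add: matrix_algebra)
  have v0: "v 0 = ?I" by (simp add: v_def V(2) init)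
  define \<eta> where "\<eta> t = Pm' t ** Y t" for t
  have "primitive \<eta> (\<lambda>t. Pm' t ** (cscale (2 * \<i> * \<rho>) (Y t) - Q t ** Y t + V t) + (Pm' t ** Q t) ** Y t)"
    unfolding \<eta>_def[abs_def] by (rule primitive_bilinear[OF mm.bounded_bilinear_axioms Pm' Y(1)])
  from primitive_bilinear[OF cscale.bounded_bilinear_axioms primitive_cexp[of "- 2 * \<i> * \<rho>"] this]
  have e\<eta>: "primitive (\<lambda>t. cscale (exp (- 2 * \<i> * \<rho> * of_real t)) (\<eta> t)) (\<lambda>t. cscale (exp (- 2 * \<i> * \<rho> * of_real t)) (Pm' t ** V t))"
    by (rule primitive_cong) (simp_all add: \<eta>_def matrix_algebra mult.commute cscale.minus_left)
  \<comment> \<open>\<open>Yle\<close> bounds \<open>Y\<close> by the size of \<open>v\<close>, and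
    \<open>vle\<close> bounds the change of \<open>v\<close> through \<open>Y\<close>; together they
    make the bound for \<open>v\<close> self-improving. The comparison primitive \<open>G\<close>
    needs the exact rate Im \<rho>, which is weakened to \<tau> afterwards.\<close>
  have Yle: "norm (Y t) \<le> B ^ 3 * k / (2 * \<tau>)" if t: "t \<in> {0..x}" and k: "\<And>t. t \<in> {0..x} \<Longrightarrow> norm (v t) \<le> k" for t k
  proof -
    have "0 \<le> k" using order_trans[OF norm_ge_zero k[OF t]] .
    define \<tau>' where "\<tau>' = Im \<rho>"
    have \<tau>': "\<tau>' > 0" "\<tau> \<le> \<tau>'" using \<rho> by (auto simp: \<tau>'_def)
    have ex: "primitive (\<lambda>t. exp (2 * \<tau>' * t)) (\<lambda>t. exp (2 * \<tau>' * t) * (2 * \<tau>' * 1))"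
      by (rule primitive_exp) (rule primitive_of_derivative, auto intro!: derivative_eq_intros continuous_intros)
    have G: "primitive (\<lambda>t. B ^ 2 * k / (2 * \<tau>') * exp (2 * \<tau>' * t)) (\<lambda>t. B ^ 2 * k / (2 * \<tau>') * (exp (2 * \<tau>' * t) * (2 * \<tau>' * 1)))"
      by (rule primitive_linear[OF bounded_linear_mult_right ex])
    have "norm (cscale (exp (- 2 * \<i> * \<rho> * of_real t)) (\<eta> t) - cscale (exp (- 2 * \<i> * \<rho> * of_real 0)) (\<eta> 0)) \<le>
        B ^ 2 * k / (2 * \<tau>') * exp (2 * \<tau>' * t) - B ^ 2 * k / (2 * \<tau>') * exp (2 * \<tau>' * 0)"
    proof (rule primitive_norm_le[OF e\<eta> G])
      fix s assume s: "s \<in> {0..t}"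
      have "norm (Pm' s ** (Pp s ** v s)) \<le> B * (B * k)"
        by (intro norm_mm_le bound k) (use s t in auto)
      then have "exp (2 * \<tau>' * s) * norm (Pm' s ** V s) \<le> exp (2 * \<tau>' * s) * (B * (B * k))"
        using V_v[of s] s by (intro mult_left_mono) auto
      then show "norm (cscale (exp (- 2 * \<i> * \<rho> * of_real s)) (Pm' s ** V s)) \<le> B ^ 2 * k / (2 * \<tau>') * (exp (2 * \<tau>' * s) * (2 * \<tau>' * 1))"
        using \<tau>' by (simp add: \<tau>'_def power2_eq_square mult_ac)
    qed (use t in auto)
    also have "\<dots> \<le> B ^ 2 * k / (2 * \<tau>') * exp (2 * \<tau>' * t)" using \<tau>' \<open>0 \<le> k\<close> by simp
    finally have "exp (2 * \<tau>' * t) * norm (\<eta> t) \<le> exp (2 * \<tau>' * t) * (B ^ 2 * k / (2 * \<tau>'))"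
      by (simp add: \<eta>_def Y(2) \<tau>'_def cscale.zero_right mult.commute)
    then have "norm (\<eta> t) \<le> B ^ 2 * k / (2 * \<tau>')" by (rule mult_left_le_imp_le) simp
    also have "\<dots> \<le> B ^ 2 * k / (2 * \<tau>)"
      using \<tau>' \<rho> \<open>0 \<le> k\<close> by (intro divide_left_mono) auto
    finally have "norm (Pm t ** \<eta> t) \<le> B * (B ^ 2 * k / (2 * \<tau>))"
      using t by (intro norm_mm_le bound) auto
    moreover have "Pm t ** \<eta> t = Y t" using t by (simp add: \<eta>_def matrix_algebra inv)
    ultimately show ?thesis by (simp add: power3_eq_cube power2_eq_square mult_ac)
  qed
  have nq: "(\<lambda>s. norm (q s)) integrable_on {0..t} \<and> integral {0..t} (\<lambda>s. norm (q s)) \<le> N" if t: "t \<ge> 0" for t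
  proof -
    have "(\<lambda>s. norm (q s)) integrable_on {0..t}" "(\<lambda>s. norm (q s)) integrable_on {t..}"
      using absolutely_integrable_half_line_subset[OF q_norm t] by (simp_all add: absolutely_integrable_on_def)
    then show ?thesis
      using integral_half_line_split[OF q_norm t] Henstock_Kurzweil_Integration.integral_nonneg[of "\<lambda>s. norm (q s)" "{t..}"] N by simp
  qed
  have vle: "norm (v t - ?I) \<le> B ^ 4 * N * k / (2 * \<tau>)" if t: "t \<in> {0..x}" and k: "\<And>t. t \<in> {0..x} \<Longrightarrow> norm (v t) \<le> k" for t k
  proof -
    have "0 \<le> k" using order_trans[OF norm_ge_zero k[OF t]] .
    have "norm (integral {0..t} (\<lambda>t. - (Pp' t ** (q t ** Y t)))) \<le> integral {0..t} (\<lambda>s. B * (B ^ 3 * k / (2 * \<tau>)) * norm (q s))"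
    proof (rule Henstock_Kurzweil_Integration.integral_norm_bound_integral)
      show "(\<lambda>t. - (Pp' t ** (q t ** Y t))) integrable_on {0..t}" by (rule primitive_integrable_on[OF v]) simp
      show "(\<lambda>s. B * (B ^ 3 * k / (2 * \<tau>)) * norm (q s)) integrable_on {0..t}"
        using nq[of t] t by (intro integrable_on_mult_right) auto
      fix s assume s: "s \<in> {0..t}"
      have "norm (Pp' s ** (q s ** Y s)) \<le> B * (norm (q s) * (B ^ 3 * k / (2 * \<tau>)))"
        by (intro norm_mm_le bound Yle k order_refl) (use s t in auto)
      then show "norm (- (Pp' s ** (q s ** Y s))) \<le> B * (B ^ 3 * k / (2 * \<tau>)) * norm (q s)" by (simp add: mult_ac)
    qed
    also have "\<dots> = B * (B ^ 3 * k / (2 * \<tau>)) * integral {0..t} (\<lambda>s. norm (q s))" by simp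
    also have "\<dots> \<le> B * (B ^ 3 * k / (2 * \<tau>)) * N"
      using nq[of t] t B_nonneg \<open>0 \<le> k\<close> \<rho> by (intro mult_left_mono) auto
    also have "\<dots> = B ^ 4 * N * k / (2 * \<tau>)" by (simp add: power4_eq_xxxx power3_eq_cube mult_ac)
    finally show ?thesis using primitive_diff_eq[OF v, of 0 t] t v0 by simp
  qed
  have vI: "norm (v t) \<le> 2 * norm ?I" if "t \<in> {0..x}" for t
  proof (rule self_improving_bound[where f = "\<lambda>x. norm (v x)" and S = "{0..x}"])
    show "\<exists>B. \<forall>x\<in>{0..x}. norm (v x) \<le> B"
      by (rule continuous_on_Icc_bounded[OF primitive_continuous_on_Icc[OF v]])
    fix k t assume k: "\<And>t. t \<in> {0..x} \<Longrightarrow> norm (v t) \<le> k" and t: "t \<in> {0..x}"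
    have "0 \<le> k" using order_trans[OF norm_ge_zero k[OF t]] .
    have "2 * B ^ 4 * N * k \<le> \<tau> * k" using \<tau> \<open>0 \<le> k\<close> by (rule mult_right_mono)
    then have "B ^ 4 * N * k / (2 * \<tau>) \<le> k / 4" using \<rho> by (simp add: field_simps)
    moreover have "norm (v t) \<le> norm ?I + norm (v t - ?I)"
      using norm_triangle_ineq[of ?I "v t - ?I"] by simp
    ultimately show "norm (v t) \<le> norm ?I + k / 2" using vle[OF t k] \<open>0 \<le> k\<close> by linarith
  qed fact
  show "norm (Y x) \<le> B ^ 3 * norm ?I / \<tau>" using Yle[OF _ vI, of x] x by simp
  show "norm (Pp' x ** V x - ?I) \<le> B ^ 4 * N * norm ?I / \<tau>" using vle[OF _ vI, of x] x by (simp add: v_def)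
qed

end

end

lemma norm_diff3_le: "norm (x - y - z) \<le> norm x + norm y + norm z"
  for x y z :: "'a::real_normed_vector"
  using norm_triangle_ineq4[of "x - y" z] norm_triangle_ineq4[of x y] by linarith

text \<open>Write a and e for the norms of \<open>A ** Pmt\<close> and \<open>E ** Ppt\<close>. The
  first equation gives \<open>a \<le> d * (2 * n + 1) + 2 * d\<^sup>2 * e\<close>, the second bounds
  e by (2 d + 2 a d^2)/\<tau>. Here \<tau> \<ge> 2 d absorbs the deviations of \<open>zt\<close> and
  \<open>vt\<close> from the identity, and \<tau> \<ge> 8 d^4 absorbs the feedback of e into a.
  Solving the two inequalities produces \<open>a0\<close> and \<open>e0\<close>.\<close>

lemma transfer_matrix_estimate:
  fixes A E Pm Pmt Pmt' Ppt Ppt' z zt wt Yg Ygt vt :: "complex^'m^'m" and d \<tau> :: real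
  defines "n \<equiv> norm (mat 1 :: complex^'m^'m)"
  defines "a0 \<equiv> 2 * (d * (2 * n + 1) + 4 * d ^ 3)"
  defines "e0 \<equiv> 2 * d + 2 * a0 * d\<^sup>2"
  assumes \<tau>: "\<tau> > 0" "\<tau> \<ge> 2 * d" "\<tau> \<ge> 8 * d ^ 4" "\<tau> \<ge> 1"
    and le: "norm Pm \<le> d" "norm Pmt \<le> d" "norm Pmt' \<le> d" "norm Ppt \<le> d" "norm Ppt' \<le> d"
    and inv: "Pmt ** Pmt' = mat 1" "Ppt ** Ppt' = mat 1"
    and z: "norm (z - mat 1) \<le> d / \<tau>" and zt: "norm (zt - mat 1) \<le> d / \<tau>" and wt: "norm wt \<le> d"
    and Yg: "norm Yg \<le> d / \<tau>" and Ygt: "norm Ygt \<le> d / \<tau>" and vt: "norm (vt - mat 1) \<le> d / \<tau>"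
    and eqJ: "A ** (Pmt ** zt) + E ** wt = Pm ** z" and eqG: "A ** Ygt + E ** (Ppt ** vt) = Yg"
  shows "norm A \<le> a0 * d" "norm E \<le> e0 * d / \<tau>" "norm (A - Pm ** Pmt') \<le> (d\<^sup>2 + a0 * d + e0 * d\<^sup>2) * d / \<tau>"
proof -
  have d: "0 \<le> d" using le(1) norm_ge_zero order_trans by blast
  have d\<tau>: "d / \<tau> \<le> 1 / 2" using \<tau> by (simp add: field_simps)
  define a where "a = norm (A ** Pmt)"
  define e where "e = norm (E ** Ppt)"
  have a: "0 \<le> a" and e: "0 \<le> e" by (simp_all add: a_def e_def)
  have "A = (A ** Pmt) ** Pmt'" using inv by (simp add: matrix_mul_assoc[symmetric])
  then have A: "norm A \<le> a * d" using norm_mm_le[OF order_refl le(3), of "A ** Pmt"] by (simp add: a_def)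
  have "E = (E ** Ppt) ** Ppt'" using inv by (simp add: matrix_mul_assoc[symmetric])
  then have E: "norm E \<le> e * d" using norm_mm_le[OF order_refl le(5), of "E ** Ppt"] by (simp add: e_def)
  have zle: "norm z \<le> n + 1 / 2"
  proof -
    have "norm z \<le> n + norm (z - mat 1)"
      using norm_triangle_ineq[of "mat 1" "z - mat 1"] by (simp add: n_def)
    then show ?thesis using z d\<tau> by linarith
  qed
  have "A ** Pmt = Pm ** z - E ** wt - (A ** Pmt) ** (zt - mat 1)"
    using eqJ by (simp add: matrix_algebra algebra_simps)
  then have "a \<le> norm (Pm ** z) + norm (E ** wt) + norm ((A ** Pmt) ** (zt - mat 1))"
    unfolding a_def using norm_diff3_le[of "Pm ** z" "E ** wt" "(A ** Pmt) ** (zt - mat 1)"] by simp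
  also have "\<dots> \<le> d * (n + 1 / 2) + (e * d) * d + a * (d / \<tau>)"
    by (intro add_mono norm_mm_le le zle E wt zt) (simp add: a_def)
  also have "a * (d / \<tau>) \<le> a * (1 / 2)" using a d\<tau> by (rule mult_left_mono[rotated])
  finally have a1: "a \<le> d * (2 * n + 1) + 2 * d\<^sup>2 * e" by (simp add: power2_eq_square algebra_simps)
  have "E ** Ppt = Yg - A ** Ygt - (E ** Ppt) ** (vt - mat 1)"
    using eqG by (simp add: matrix_algebra algebra_simps)
  then have "e \<le> norm Yg + norm (A ** Ygt) + norm ((E ** Ppt) ** (vt - mat 1))"
    unfolding e_def using norm_diff3_le[of Yg "A ** Ygt" "(E ** Ppt) ** (vt - mat 1)"] by simp
  also have "\<dots> \<le> d / \<tau> + (a * d) * (d / \<tau>) + e * (d / \<tau>)"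
    by (intro add_mono norm_mm_le A Yg Ygt vt) (simp add: e_def)
  also have "e * (d / \<tau>) \<le> e * (1 / 2)" using e d\<tau> by (rule mult_left_mono[rotated])
  also have "a * d * (d / \<tau>) = a * d\<^sup>2 / \<tau>" by (simp add: power2_eq_square)
  finally have "e \<le> 2 * (d / \<tau>) + 2 * (a * d\<^sup>2 / \<tau>)" by linarith
  then have e1: "e \<le> 2 * d / \<tau> + 2 * a * d\<^sup>2 / \<tau>" by simp
  have "2 * d / \<tau> + 2 * a * d\<^sup>2 / \<tau> \<le> 2 * d + 2 * a * d\<^sup>2 / \<tau>"
    using \<tau> d by (simp add: divide_le_eq mult_le_cancel_left1)
  with e1 have "2 * d\<^sup>2 * e \<le> 2 * d\<^sup>2 * (2 * d + 2 * a * d\<^sup>2 / \<tau>)" by (intro mult_left_mono) auto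
  also have "\<dots> = 4 * d ^ 3 + a * (4 * d ^ 4 / \<tau>)"
    by (simp add: power2_eq_square power3_eq_cube power4_eq_xxxx algebra_simps)
  also have "a * (4 * d ^ 4 / \<tau>) \<le> a * (1 / 2)"
    using \<tau> a by (intro mult_left_mono) (simp_all add: field_simps)
  finally have "a \<le> d * (2 * n + 1) + 4 * d ^ 3 + a / 2" using a1 by simp
  then have a2: "a \<le> a0" by (simp add: a0_def)
  show A': "norm A \<le> a0 * d" using A mult_right_mono[OF a2 d] by linarith
  have "2 * a * d\<^sup>2 \<le> 2 * a0 * d\<^sup>2" using a2 by (intro mult_right_mono) auto
  then have "2 * d / \<tau> + 2 * a * d\<^sup>2 / \<tau> \<le> e0 / \<tau>"
    using \<tau> unfolding e0_def add_divide_distrib by (intro add_left_mono divide_right_mono) auto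
  then have e2: "e \<le> e0 / \<tau>" using e1 by linarith
  show E': "norm E \<le> e0 * d / \<tau>" using E mult_right_mono[OF e2 d] by simp
  \<comment> \<open>All terms on the right are small: \<open>z\<close> and \<open>zt\<close> are
    close to the identity, and \<open>E\<close> brings its own factor 1/\<tau>.\<close>
  have "A - Pm ** Pmt' = (Pm ** (z - mat 1) - (A ** Pmt) ** (zt - mat 1) - E ** wt) ** Pmt'"
  proof -
    have "Pm ** (z - mat 1) - (A ** Pmt) ** (zt - mat 1) - E ** wt = A ** Pmt - Pm"
      using eqJ by (simp add: matrix_algebra algebra_simps)
    then show ?thesis using inv by (simp add: mm.diff_left matrix_mul_assoc[symmetric])
  qed
  moreover have "norm (Pm ** (z - mat 1) - (A ** Pmt) ** (zt - mat 1) - E ** wt) \<le>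
      d * (d / \<tau>) + a0 * (d / \<tau>) + (e0 * d / \<tau>) * d"
    by (rule order_trans[OF norm_diff3_le], intro add_mono norm_mm_le le z zt E' wt) (use a2 in \<open>simp add: a_def\<close>)
  ultimately have "norm (A - Pm ** Pmt') \<le> (d * (d / \<tau>) + a0 * (d / \<tau>) + (e0 * d / \<tau>) * d) * d"
    using norm_mm_le[OF _ le(3)] by simp
  then show "norm (A - Pm ** Pmt') \<le> (d\<^sup>2 + a0 * d + e0 * d\<^sup>2) * d / \<tau>"
    by (simp add: power2_eq_square add_divide_distrib[symmetric] algebra_simps)
qed

section \<open>Pencil, Weyl matrix and first order system\<close>

text \<open>Linear in the entry \<open>c\<close>, so that the entrywise assumptions of
  \<open>class_V\<close> can be summed to statements about matrix functions.\<close>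

definition matrix_unit :: "'n \<Rightarrow> 'm \<Rightarrow> complex \<Rightarrow> complex^'m::finite^'n::finite" where
  "matrix_unit i j c = (\<chi> k l. if k = i \<and> l = j then c else 0)"

lemma matrix_sum_units: "A = (\<Sum>i\<in>UNIV. \<Sum>j\<in>UNIV. matrix_unit i j (A $ i $ j))"
proof -
  have "(\<Sum>i\<in>UNIV. \<Sum>j\<in>UNIV. matrix_unit i j (A $ i $ j) $ k $ l) = A $ k $ l" for k l
  proof -
    have "(\<Sum>j\<in>UNIV. matrix_unit i j (A $ i $ j) $ k $ l) = (if i = k then A $ k $ l else 0)" for i
      by (simp add: matrix_unit_def)
    then show ?thesis by simp
  qed
  then show ?thesis by (simp add: vec_eq_iff)
qed

lemma bounded_linear_matrix_unit: "bounded_linear (matrix_unit i j)"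
  by (simp add: linear_conv_bounded_linear[symmetric] linear_iff matrix_unit_def vec_eq_iff)

lemma primitive_sum:
  assumes "finite I" "\<And>i. i \<in> I \<Longrightarrow> primitive (F i) (f i)"
  shows "primitive (\<lambda>x. \<Sum>i\<in>I. F i x) (\<lambda>x. \<Sum>i\<in>I. f i x)"
  using assms by (induction I rule: finite_induct) (simp_all add: primitive_add)

lemma primitive_matrixI:
  fixes F f :: "real \<Rightarrow> complex^'m^'n"
  assumes "\<And>i j. primitive (\<lambda>x. F x $ i $ j) (\<lambda>x. f x $ i $ j)"
  shows "primitive F f"
proof -
  have "primitive (\<lambda>x. \<Sum>i\<in>UNIV. \<Sum>j\<in>UNIV. matrix_unit i j (F x $ i $ j))
      (\<lambda>x. \<Sum>i\<in>UNIV. \<Sum>j\<in>UNIV. matrix_unit i j (f x $ i $ j))"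
    by (intro primitive_sum primitive_linear[OF bounded_linear_matrix_unit] assms finite)
  then show ?thesis by (simp add: matrix_sum_units[symmetric])
qed

lemma absolutely_integrable_matrixI:
  fixes f :: "real \<Rightarrow> complex^'m^'n"
  assumes "\<And>i j. (\<lambda>x. f x $ i $ j) absolutely_integrable_on S"
  shows "f absolutely_integrable_on S"
proof -
  have "(\<lambda>x. matrix_unit i j (f x $ i $ j)) absolutely_integrable_on S" for i j
    using absolutely_integrable_linear[OF assms bounded_linear_matrix_unit] by (simp add: o_def)
  then have "(\<lambda>x. \<Sum>i\<in>UNIV. \<Sum>j\<in>UNIV. matrix_unit i j (f x $ i $ j)) absolutely_integrable_on S"
    by (intro absolutely_integrable_sum finite)
  then show ?thesis by (simp add: matrix_sum_units[symmetric])
qed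

lemma absolutely_integrable_greaterThan_iff:
  fixes f :: "real \<Rightarrow> 'a::euclidean_space"
  shows "f absolutely_integrable_on {0<..} \<longleftrightarrow> f absolutely_integrable_on {0..}"
proof (rule absolutely_integrable_spike_set_eq)
  have "{0::real<..} - {0..} \<union> ({0..} - {0<..}) \<subseteq> {0}" by auto
  then show "negligible {x \<in> {0::real<..} - {0..}. f x \<noteq> 0}" "negligible {x \<in> {0::real..} - {0<..}. f x \<noteq> 0}"
    by (auto intro: negligible_subset[of "{0}"])
qed

lemma class_V_primitive:
  fixes Q0 Q1 :: "real \<Rightarrow> complex^'m::finite^'m"
  assumes "class_V Q0 Q1"
  shows "\<exists>Q1'. primitive Q1 Q1' \<and> Q0 absolutely_integrable_on {0..} \<and> Q1 absolutely_integrable_on {0..} \<and>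
     Q1' absolutely_integrable_on {0..}"
proof -
  obtain Q1' :: "real \<Rightarrow> complex^'m^'m" where Q1': "AE x in lebesgue. x > 0 \<longrightarrow> (Q1 has_vector_derivative Q1' x) (at x)"
      "\<forall>i j. (\<lambda>x. Q1' x $ i $ j) absolutely_integrable_on {0<..}"
    using assms[unfolded class_V_def, THEN conjunct2, THEN conjunct2, THEN conjunct2] by (elim exE conjE)
  have V: "\<forall>T>0. \<forall>i j. abs_cont_on 0 T (\<lambda>x. Q1 x $ i $ j)"
      "\<forall>i j. (\<lambda>x. Q0 x $ i $ j) absolutely_integrable_on {0<..}"
      "\<forall>i j. (\<lambda>x. Q1 x $ i $ j) absolutely_integrable_on {0<..}"
    using assms[unfolded class_V_def, THEN conjunct1] assms[unfolded class_V_def, THEN conjunct2, THEN conjunct1]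
      assms[unfolded class_V_def, THEN conjunct2, THEN conjunct2, THEN conjunct1] .
  have int: "Q0 absolutely_integrable_on {0..}" "Q1 absolutely_integrable_on {0..}" "Q1' absolutely_integrable_on {0..}"
    using V(2,3) Q1'(2) by (simp_all add: absolutely_integrable_matrixI absolutely_integrable_greaterThan_iff)
  have bl: "bounded_linear (\<lambda>A :: complex^'m^'m. A $ i $ j)" for i j
    by (rule bounded_linear_compose[OF bounded_linear_vec_nth bounded_linear_vec_nth])
  have "primitive Q1 Q1'"
  proof (rule primitive_matrixI, rule abs_cont_on_imp_primitive)
    fix i j
    show "abs_cont_on 0 T (\<lambda>x. Q1 x $ i $ j)" if "T > 0" for T using V(1) that by simp
    show "(\<lambda>x. Q1' x $ i $ j) absolutely_integrable_on {0..T}" if "T > 0" for T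
      using Q1'(2) that by (intro absolutely_integrable_half_line_subset(1)) (simp_all add: absolutely_integrable_greaterThan_iff)
    show "AE x in lebesgue. x > 0 \<longrightarrow> ((\<lambda>x. Q1 x $ i $ j) has_vector_derivative Q1' x $ i $ j) (at x)"
      using Q1'(1) by eventually_elim (auto intro: bounded_linear.has_vector_derivative[OF bl])
  qed
  then show ?thesis using int by blast
qed

lemma primitive_cscale_exp:
  fixes F f :: "real \<Rightarrow> complex^'m^'n"
  assumes "primitive F f"
  shows "primitive (\<lambda>t. cscale (exp (a * of_real t)) (F t))
    (\<lambda>t. cscale (exp (a * of_real t)) (f t + cscale a (F t)))"
  using primitive_bilinear[OF cscale.bounded_bilinear_axioms primitive_cexp[of a] assms]
  by (simp add: matrix_algebra mult.commute)

lemma at_within_half_line_neq_bot: "x \<ge> 0 \<Longrightarrow> at x within {0::real..} \<noteq> bot"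
proof -
  assume x: "x \<ge> 0"
  have "at x within {0..} = at x within {0..x+1}"
    using x by (intro at_within_nhd[of _ "{..<x+1}"]) auto
  moreover have "at x within {0..x+1} \<noteq> bot"
    using x by (simp add: trivial_limit_within islimpt_Icc)
  ultimately show ?thesis by simp
qed

section \<open>Equivalence of the pencil equation and the first order system\<close>

locale pencil_system =
  fixes Q0 Q1 Q1' :: "real \<Rightarrow> complex^'m::finite^'m"
  assumes Q1: "primitive Q1 Q1'" and int: "Q0 absolutely_integrable_on {0..}" "Q1 absolutely_integrable_on {0..}"
     "Q1' absolutely_integrable_on {0..}"
begin

text \<open>The remainder in the factorisation of the pencil as (d/dx + i\<rho> - Q1)(d/dx - i\<rho>
  + Q1) + q. The inner factor applied to Y is the second component V.\<close>

definition q :: "real \<Rightarrow> complex^'m^'m" where "q t = Q0 t - Q1' t + Q1 t ** Q1 t"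

definition system :: "complex \<Rightarrow> (real \<Rightarrow> complex^'m^'m) \<Rightarrow> (real \<Rightarrow> complex^'m^'m) \<Rightarrow> bool" where
  "system \<rho> Y V \<longleftrightarrow> primitive Y (\<lambda>t. cscale (\<i> * \<rho>) (Y t) - Q1 t ** Y t + V t) \<and>
     primitive V (\<lambda>t. Q1 t ** V t - cscale (\<i> * \<rho>) (V t) - q t ** Y t)"

lemma Q1_bounded: "\<exists>B. \<forall>x\<ge>0. norm (Q1 x) \<le> B"
proof -
  have n: "(\<lambda>s. norm (Q1' s)) absolutely_integrable_on {0..}"
    using absolutely_integrable_norm[OF int(3)] by (simp add: o_def)
  have "norm (Q1 x) \<le> norm (Q1 0) + integral {0..} (\<lambda>s. norm (Q1' s))" if x: "x \<ge> 0" for x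
  proof -
    have n': "(\<lambda>s. norm (Q1' s)) integrable_on {0..x}" "(\<lambda>s. norm (Q1' s)) integrable_on {x..}"
      using absolutely_integrable_half_line_subset[OF n x] by (simp_all add: absolutely_integrable_on_def)
    have "norm (integral {0..x} Q1') \<le> integral {0..x} (\<lambda>s. norm (Q1' s))"
      by (rule Henstock_Kurzweil_Integration.integral_norm_bound_integral[OF primitive_integrable_on[OF Q1] n'(1)]) auto
    also have "\<dots> \<le> integral {0..} (\<lambda>s. norm (Q1' s))"
      using integral_half_line_split[OF n x] Henstock_Kurzweil_Integration.integral_nonneg[OF n'(2)] by simp
    finally show ?thesis
      using primitive_eq[OF Q1 x] norm_triangle_ineq[of "Q1 0" "integral {0..x} Q1'"] by simp
  qed
  then show ?thesis by blast
qed

text \<open>\<open>Q1\<close> is bounded because \<open>Q1'\<close> is integrable, so its square is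
  integrable together with \<open>Q1\<close>.\<close>

lemma q_integrable: "q absolutely_integrable_on {0..}"
proof -
  obtain B where B: "\<forall>x\<ge>0. norm (Q1 x) \<le> B" using Q1_bounded by (elim exE)
  have "(\<lambda>t. Q1 t ** Q1 t) absolutely_integrable_on {0..}"
    by (rule absolutely_integrable_half_line_bilinear[OF mm.bounded_bilinear_axioms primitive_continuous_on[OF Q1] _ int(2), of B])
      (use B in simp)
  then show ?thesis unfolding q_def[abs_def] by (intro set_integral_add set_integral_diff int)
qed

text \<open>Absolute continuity of Y' and the equation almost everywhere make Y' a primitive. The
  rest is the product rule, the derivative \<open>Q1'\<close> being absorbed into
  \<open>q\<close>.\<close>

lemma pencil_solution_imp_system:
  assumes "pencil_solution Q0 Q1 \<rho> Y"
  shows "system \<rho> Y (\<lambda>t. deriv_half_line Y t - cscale (\<i> * \<rho>) (Y t) + Q1 t ** Y t)"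
proof -
  define U where "U = deriv_half_line Y"
  have Yd: "\<forall>x\<ge>0. Y differentiable (at x within {0..})" and Uac: "\<forall>T>0. abs_cont_on 0 T U"
    and ae: "AE x in lebesgue. x > 0 \<longrightarrow> U differentiable (at x) \<and> pencil_ell Q0 Q1 \<rho> Y x = 0"
    using assms unfolding pencil_solution_def U_def by auto
  have YU: "(Y has_vector_derivative U x) (at x within {0..})" if "x \<ge> 0" for x
    using Yd that unfolding U_def deriv_half_line_def by (simp add: vector_derivative_works[symmetric])
  have Yc: "continuous_on {0..} Y"
    unfolding continuous_on_eq_continuous_within using YU has_vector_derivative_continuous by blast
  let ?f = "\<lambda>x. - (cscale (\<rho>\<^sup>2) (Y x) + cscale (2 * \<i> * \<rho>) (Q1 x ** Y x) + Q0 x ** Y x)"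
  have U: "primitive U ?f"
  proof (rule abs_cont_on_imp_primitive)
    show "abs_cont_on 0 T U" if "T > 0" for T using Uac that by simp
    show "AE x in lebesgue. x > 0 \<longrightarrow> (U has_vector_derivative ?f x) (at x)"
      using ae
    proof eventually_elim
      case (elim x)
      show ?case
      proof
        assume "x > 0"
        then have d: "U differentiable (at x)" and "pencil_ell Q0 Q1 \<rho> Y x = 0" using elim by auto
        then have "vector_derivative U (at x) = ?f x"
          unfolding pencil_ell_def U_def[symmetric]
          by (simp add: matrix_algebra mat_matrix_mult add_eq_0_iff2)
        then show "(U has_vector_derivative ?f x) (at x)" using d by (simp add: vector_derivative_works)
      qed
    qed
    fix T :: real assume "T > 0"
    then have T: "T \<ge> 0" by simp
    have Yc': "continuous_on {0..T} Y" by (rule continuous_on_subset[OF Yc]) auto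
    have Q1c: "continuous_on {0..T} Q1" by (rule primitive_continuous_on_Icc[OF Q1])
    have "continuous_on {0..T} (\<lambda>x. cscale (\<rho>\<^sup>2) (Y x) + cscale (2 * \<i> * \<rho>) (Q1 x ** Y x))"
      by (intro continuous_on_add cscale.continuous_on mm.continuous_on continuous_on_const Yc' Q1c)
    then have "(\<lambda>x. cscale (\<rho>\<^sup>2) (Y x) + cscale (2 * \<i> * \<rho>) (Q1 x ** Y x) + Q0 x ** Y x) absolutely_integrable_on {0..T}"
      by (intro set_integral_add absolutely_integrable_continuous_real
          absolutely_integrable_bilinear'[OF mm.bounded_bilinear_axioms _ Yc'] absolutely_integrable_half_line_subset(1)[OF int(1) T])
    from set_integral_diff(1)[OF absolutely_integrable_zero this] show "?f absolutely_integrable_on {0..T}" by simp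
  qed
  have Y: "primitive Y U" by (rule primitive_of_derivative[OF YU primitive_continuous_on[OF U]])
  define V where "V t = U t - cscale (\<i> * \<rho>) (Y t) + Q1 t ** Y t" for t
  have "primitive V (\<lambda>t. ?f t - cscale (\<i> * \<rho>) (U t) + (Q1 t ** U t + Q1' t ** Y t))"
    unfolding V_def[abs_def]
    by (intro primitive_add primitive_diff U primitive_linear[OF cscale.bounded_linear_right Y]
        primitive_bilinear[OF mm.bounded_bilinear_axioms Q1 Y])
  then have "primitive V (\<lambda>t. Q1 t ** V t - cscale (\<i> * \<rho>) (V t) - q t ** Y t)"
  proof (rule primitive_cong)
    fix t :: real
    have "cscale (2 * \<i> * \<rho>) (Q1 t ** Y t) = cscale (\<i> * \<rho>) (Q1 t ** Y t) + cscale (\<i> * \<rho>) (Q1 t ** Y t)"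
      by (simp add: cscale.add_left[symmetric] mult.assoc)
    moreover have "cscale (\<i> * \<rho> * (\<i> * \<rho>)) (Y t) = - cscale (\<rho>\<^sup>2) (Y t)"
      by (simp add: cscale.minus_left[symmetric] power2_eq_square algebra_simps)
    ultimately show "?f t - cscale (\<i> * \<rho>) (U t) + (Q1 t ** U t + Q1' t ** Y t) =
        Q1 t ** V t - cscale (\<i> * \<rho>) (V t) - q t ** Y t"
      unfolding V_def q_def by (simp add: matrix_algebra)
  qed simp
  moreover have "primitive Y (\<lambda>t. cscale (\<i> * \<rho>) (Y t) - Q1 t ** Y t + V t)"
    by (rule primitive_cong[OF Y]) (simp_all add: V_def)
  ultimately show ?thesis by (simp add: system_def V_def[abs_def] U_def)
qed

text \<open>Y' is given by a continuous expression, so it exists at every point and one-sidedly at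
  0, where the boundary form needs it.\<close>

lemma system_deriv_half_line:
  assumes "system \<rho> Y V" "x \<ge> 0"
  shows "(Y has_vector_derivative (cscale (\<i> * \<rho>) (Y x) - Q1 x ** Y x + V x)) (at x within {0..})"
    "deriv_half_line Y x = cscale (\<i> * \<rho>) (Y x) - Q1 x ** Y x + V x"
proof -
  have Y: "primitive Y (\<lambda>t. cscale (\<i> * \<rho>) (Y t) - Q1 t ** Y t + V t)"
    and V: "primitive V (\<lambda>t. Q1 t ** V t - cscale (\<i> * \<rho>) (V t) - q t ** Y t)"
    using assms(1) by (auto simp: system_def)
  have "continuous_on {0..} (\<lambda>t. cscale (\<i> * \<rho>) (Y t) - Q1 t ** Y t + V t)"
    by (intro continuous_on_add continuous_on_diff cscale.continuous_on mm.continuous_on continuous_on_const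
        primitive_continuous_on[OF Y] primitive_continuous_on[OF V] primitive_continuous_on[OF Q1])
  then show d: "(Y has_vector_derivative (cscale (\<i> * \<rho>) (Y x) - Q1 x ** Y x + V x)) (at x within {0..})"
    by (rule primitive_has_vector_derivative[OF Y _ assms(2)])
  show "deriv_half_line Y x = cscale (\<i> * \<rho>) (Y x) - Q1 x ** Y x + V x"
    unfolding deriv_half_line_def by (rule vector_derivative_within[OF at_within_half_line_neq_bot[OF assms(2)] d])
qed

lemma system_imp_pencil_solution:
  assumes YV: "system \<rho> Y V"
  shows "pencil_solution Q0 Q1 \<rho> Y"
proof -
  have Y: "primitive Y (\<lambda>t. cscale (\<i> * \<rho>) (Y t) - Q1 t ** Y t + V t)"
    and V: "primitive V (\<lambda>t. Q1 t ** V t - cscale (\<i> * \<rho>) (V t) - q t ** Y t)"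
    using assms by (auto simp: system_def)
  define U where "U t = cscale (\<i> * \<rho>) (Y t) - Q1 t ** Y t + V t" for t
  have Y': "primitive Y U" using Y by (simp add: U_def[abs_def])
  let ?f = "\<lambda>x. - (cscale (\<rho>\<^sup>2) (Y x) + cscale (2 * \<i> * \<rho>) (Q1 x ** Y x) + Q0 x ** Y x)"
  have "primitive U (\<lambda>t. cscale (\<i> * \<rho>) (U t) - (Q1 t ** U t + Q1' t ** Y t) + (Q1 t ** V t - cscale (\<i> * \<rho>) (V t) - q t ** Y t))"
    unfolding U_def[abs_def]
    by (intro primitive_add primitive_diff V primitive_linear[OF cscale.bounded_linear_right Y]
        primitive_bilinear[OF mm.bounded_bilinear_axioms Q1 Y])
  then have U: "primitive U ?f"
  proof (rule primitive_cong)
    fix t :: real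
    have "cscale (2 * \<i> * \<rho>) (Q1 t ** Y t) = cscale (\<i> * \<rho>) (Q1 t ** Y t) + cscale (\<i> * \<rho>) (Q1 t ** Y t)"
      by (simp add: cscale.add_left[symmetric] mult.assoc)
    moreover have "cscale (\<i> * \<rho> * (\<i> * \<rho>)) (Y t) = - cscale (\<rho>\<^sup>2) (Y t)"
      by (simp add: cscale.minus_left[symmetric] power2_eq_square algebra_simps)
    ultimately show "cscale (\<i> * \<rho>) (U t) - (Q1 t ** U t + Q1' t ** Y t) + (Q1 t ** V t - cscale (\<i> * \<rho>) (V t) - q t ** Y t) = ?f t"
      unfolding U_def q_def by (simp add: matrix_algebra)
  qed simp
  have dU: "deriv_half_line Y x = U x" if "x \<ge> 0" for x
    using system_deriv_half_line(2)[OF YV that] by (simp add: U_def)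
  show ?thesis
    unfolding pencil_solution_def
  proof (intro conjI allI impI)
    show "Y differentiable (at x within {0..})" if "x \<ge> 0" for x
      using system_deriv_half_line(1)[OF YV that] by (auto intro: differentiableI_vector)
    show "abs_cont_on 0 T (deriv_half_line Y)" if "T > 0" for T
      by (rule abs_cont_on_dominated[OF primitive_abs_cont_on[OF U] primitive_abs_cont_on[OF U] zero_le_one])
        (simp add: dU)
    show "AE x in lebesgue. x > 0 \<longrightarrow> deriv_half_line Y differentiable (at x) \<and> pencil_ell Q0 Q1 \<rho> Y x = 0"
      using primitive_AE_deriv[OF U]
    proof eventually_elim
      case (elim x)
      show ?case
      proof
        assume "x > 0"
        have d: "(deriv_half_line Y has_vector_derivative ?f x) (at x)"
          by (rule has_vector_derivative_transform_within_open[of U _ _ "{0<..}"]) (use elim \<open>x > 0\<close> dU in auto)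
        from vector_derivative_at[OF d] have "pencil_ell Q0 Q1 \<rho> Y x = 0"
          unfolding pencil_ell_def by (simp add: matrix_algebra mat_matrix_mult)
        then show "deriv_half_line Y differentiable (at x) \<and> pencil_ell Q0 Q1 \<rho> Y x = 0"
          using d by (auto intro: differentiableI_vector)
      qed
    qed
  qed
qed

end

section \<open>Growth conditions and reflection of the spectral parameter\<close>

lemma norm_matrix_le_sum: "norm A \<le> (\<Sum>i\<in>UNIV. \<Sum>j\<in>UNIV. norm (A $ i $ j))"
  for A :: "complex^'m^'n"
proof -
  have "norm A \<le> (\<Sum>i\<in>UNIV. norm (A $ i))" unfolding norm_vec_def[of A] by (rule L2_set_le_sum) simp
  also have "\<dots> \<le> (\<Sum>i\<in>UNIV. \<Sum>j\<in>UNIV. norm (A $ i $ j))"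
    by (rule sum_mono) (simp add: norm_vec_def L2_set_le_sum)
  finally show ?thesis .
qed

lemma eventually_bounded_imp_bounded:
  fixes g :: "real \<Rightarrow> 'a::real_normed_vector"
  assumes "continuous_on {0..} g" "\<forall>\<^sub>F x in at_top. norm (g x) \<le> c"
  shows "\<exists>B. \<forall>x\<ge>0. norm (g x) \<le> B"
proof -
  obtain X where X: "\<forall>x\<ge>X. norm (g x) \<le> c"
    using assms(2) unfolding eventually_at_top_linorder by (elim exE)
  have "continuous_on {0..X} g" by (rule continuous_on_subset[OF assms(1)]) auto
  from continuous_on_Icc_bounded[OF this] obtain B where B: "\<forall>x\<in>{0..X}. norm (g x) \<le> B" by (elim exE)
  have "norm (g x) \<le> max B c" if "x \<ge> 0" for x
    using X B that by (cases "x \<ge> X") (auto simp: le_max_iff_disj)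
  then show ?thesis by blast
qed

text \<open>\<open>Q1\<close> and \<open>h1\<close> enter only in products with \<rho>, so changing
  all three signs leaves the equation and the boundary form alone; the half-planes swap together
  with their growth conditions.\<close>

lemma weyl_solution_uminus:
  "weyl_solution Q0 (\<lambda>x. - Q1 x) h0 (- h1) (- \<rho>) \<Phi> \<longleftrightarrow> weyl_solution Q0 Q1 h0 h1 \<rho> \<Phi>"
proof -
  have 1: "mat ((- \<rho>)\<^sup>2) + mat (2 * \<i> * (- \<rho>)) ** (- A) = mat (\<rho>\<^sup>2) + mat (2 * \<i> * \<rho>) ** A" for A :: "complex^'m^'m"
    by (simp add: mat_matrix_mult matrix_algebra cscale.minus_left)
  have 2: "mat (\<i> * (- \<rho>)) ** (- h1) = mat (\<i> * \<rho>) ** h1"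
    by (simp add: mat_matrix_mult matrix_algebra cscale.minus_left)
  have "pencil_ell Q0 (\<lambda>x. - Q1 x) (- \<rho>) \<Phi> = pencil_ell Q0 Q1 \<rho> \<Phi>"
    unfolding pencil_ell_def 1 ..
  moreover have "pencil_U h0 (- h1) (- \<rho>) \<Phi> = pencil_U h0 h1 \<rho> \<Phi>"
    unfolding pencil_U_def 2 ..
  moreover have "- \<rho> \<in> Pi_plus \<longleftrightarrow> \<rho> \<in> Pi_minus" "- \<rho> \<in> Pi_minus \<longleftrightarrow> \<rho> \<in> Pi_plus"
    by (auto simp: Pi_plus_def Pi_minus_def)
  ultimately show ?thesis
    unfolding weyl_solution_def pencil_solution_def by auto
qed

lemma weyl_domain_uminus:
  "- \<rho> \<in> weyl_domain Q0 (\<lambda>x. - Q1 x) h0 (- h1) \<longleftrightarrow> \<rho> \<in> weyl_domain Q0 Q1 h0 h1"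
  unfolding weyl_domain_def by (auto simp: weyl_solution_uminus Pi_plus_def Pi_minus_def)

lemma weyl_matrix_uminus:
  "weyl_matrix Q0 (\<lambda>x. - Q1 x) h0 (- h1) (- \<rho>) = weyl_matrix Q0 Q1 h0 h1 \<rho>"
  unfolding weyl_matrix_def weyl_solution_uminus ..

section \<open>The Weyl matrix for large Im \<rho>\<close>

context pencil_system
begin

text \<open>The choice \<open>c = - (\<i> * \<rho>)\<close> strips a decaying solution of its
  exponential, and \<open>c = \<i> * \<rho>\<close> does the same for a growing one.\<close>

lemma system_scaled:
  assumes "system \<rho> Y V"
  shows "primitive (\<lambda>t. cscale (exp (c * of_real t)) (Y t))
      (\<lambda>t. cscale (\<i> * \<rho> + c) (cscale (exp (c * of_real t)) (Y t)) - Q1 t ** cscale (exp (c * of_real t)) (Y t) +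
        cscale (exp (c * of_real t)) (V t))"
    "primitive (\<lambda>t. cscale (exp (c * of_real t)) (V t))
      (\<lambda>t. Q1 t ** cscale (exp (c * of_real t)) (V t) - cscale (\<i> * \<rho> - c) (cscale (exp (c * of_real t)) (V t)) -
        q t ** cscale (exp (c * of_real t)) (Y t))"
proof -
  have Y: "primitive Y (\<lambda>t. cscale (\<i> * \<rho>) (Y t) - Q1 t ** Y t + V t)"
    and V: "primitive V (\<lambda>t. Q1 t ** V t - cscale (\<i> * \<rho>) (V t) - q t ** Y t)"
    using assms by (auto simp: system_def)
  have comm: "cscale (exp (c * of_real t)) (cscale b A) = cscale b (cscale (exp (c * of_real t)) A)" for t :: real and b A
    by (simp add: cscale_cscale mult.commute)
  show "primitive (\<lambda>t. cscale (exp (c * of_real t)) (Y t))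
      (\<lambda>t. cscale (\<i> * \<rho> + c) (cscale (exp (c * of_real t)) (Y t)) - Q1 t ** cscale (exp (c * of_real t)) (Y t) +
        cscale (exp (c * of_real t)) (V t))"
    using primitive_cscale_exp[OF Y, of c]
    by (simp add: comm cscale.add_left cscale.add_right cscale.diff_right cscale_mult_right algebra_simps)
  show "primitive (\<lambda>t. cscale (exp (c * of_real t)) (V t))
      (\<lambda>t. Q1 t ** cscale (exp (c * of_real t)) (V t) - cscale (\<i> * \<rho> - c) (cscale (exp (c * of_real t)) (V t)) -
        q t ** cscale (exp (c * of_real t)) (Y t))"
    using primitive_cscale_exp[OF V, of c]
    by (simp add: comm cscale.diff_left cscale.add_right cscale.diff_right cscale_mult_right algebra_simps)
qed

lemma system_unscaled:
  assumes y: "primitive y (\<lambda>t. w t - Q1 t ** y t)"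
    and w: "primitive w (\<lambda>t. cscale (- 2 * \<i> * \<rho>) (w t) + Q1 t ** w t - q t ** y t)"
  shows "system \<rho> (\<lambda>t. cscale (exp (\<i> * \<rho> * of_real t)) (y t)) (\<lambda>t. cscale (exp (\<i> * \<rho> * of_real t)) (w t))"
  unfolding system_def
proof
  show "primitive (\<lambda>t. cscale (exp (\<i> * \<rho> * of_real t)) (y t))
    (\<lambda>t. cscale (\<i> * \<rho>) (cscale (exp (\<i> * \<rho> * of_real t)) (y t)) - Q1 t ** cscale (exp (\<i> * \<rho> * of_real t)) (y t) +
      cscale (exp (\<i> * \<rho> * of_real t)) (w t))"
    by (rule primitive_cong[OF primitive_cscale_exp[OF y, of "\<i> * \<rho>"]])
      (simp_all add: matrix_algebra mult.commute)
  have c: "cscale (- 2 * \<i> * \<rho>) A + cscale (\<i> * \<rho>) A = - cscale (\<i> * \<rho>) A" for A :: "complex^'m^'m"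
    by (simp add: cscale.add_left[symmetric] cscale.minus_left[symmetric])
  show "primitive (\<lambda>t. cscale (exp (\<i> * \<rho> * of_real t)) (w t))
    (\<lambda>t. Q1 t ** cscale (exp (\<i> * \<rho> * of_real t)) (w t) - cscale (\<i> * \<rho>) (cscale (exp (\<i> * \<rho> * of_real t)) (w t)) -
      q t ** cscale (exp (\<i> * \<rho> * of_real t)) (y t))"
  proof (rule primitive_cong[OF primitive_cscale_exp[OF w, of "\<i> * \<rho>"]])
    fix t :: real
    have "cscale (- 2 * \<i> * \<rho>) (w t) + Q1 t ** w t - q t ** y t + cscale (\<i> * \<rho>) (w t) =
        Q1 t ** w t - cscale (\<i> * \<rho>) (w t) - q t ** y t"
      using c[of "w t"] by (simp add: algebra_simps)
    then show "cscale (exp (\<i> * \<rho> * of_real t)) (cscale (- 2 * \<i> * \<rho>) (w t) + Q1 t ** w t - q t ** y t + cscale (\<i> * \<rho>) (w t)) =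
      Q1 t ** cscale (exp (\<i> * \<rho> * of_real t)) (w t) - cscale (\<i> * \<rho>) (cscale (exp (\<i> * \<rho> * of_real t)) (w t)) -
      q t ** cscale (exp (\<i> * \<rho> * of_real t)) (y t)"
      by (simp only: cscale.diff_right cscale_mult_right cscale_cscale mult.commute)
  qed simp
qed

lemma system_mult_right:
  assumes "system \<rho> Y V"
  shows "system \<rho> (\<lambda>t. Y t ** C) (\<lambda>t. V t ** C)"
proof -
  have Y: "primitive Y (\<lambda>t. cscale (\<i> * \<rho>) (Y t) - Q1 t ** Y t + V t)"
    and V: "primitive V (\<lambda>t. Q1 t ** V t - cscale (\<i> * \<rho>) (V t) - q t ** Y t)"
    using assms by (auto simp: system_def)
  show ?thesis
    using primitive_linear[OF mm.bounded_linear_left Y, of C] primitive_linear[OF mm.bounded_linear_left V, of C]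
    by (simp add: system_def matrix_algebra)
qed

lemma pencil_U_system:
  assumes "system \<rho> Y V"
  shows "pencil_U h0 h1 \<rho> Y = (cscale (\<i> * \<rho>) (mat 1 + h1) + (h0 - Q1 0)) ** Y 0 + V 0"
  unfolding pencil_U_def system_deriv_half_line(2)[OF assms order_refl]
  by (simp add: matrix_algebra mat_matrix_mult)

text \<open>The decaying solution is \<open>Y = Pm z exp (\<i> \<rho> x)\<close>, \<open>V = w exp (\<i> \<rho> x)\<close>.\<close>

definition jost :: "(real \<Rightarrow> complex^'m^'m) \<Rightarrow> real \<Rightarrow> complex \<Rightarrow> (real \<Rightarrow> complex^'m^'m) \<Rightarrow> (real \<Rightarrow> complex^'m^'m) \<Rightarrow> bool" where
  "jost Pm C \<rho> z w \<longleftrightarrow> z 0 = mat 1 \<and> primitive (\<lambda>x. Pm x ** z x) (\<lambda>t. w t - Q1 t ** (Pm t ** z t)) \<and>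
     primitive w (\<lambda>t. cscale (- 2 * \<i> * \<rho>) (w t) + Q1 t ** w t - q t ** (Pm t ** z t)) \<and>
     (\<forall>x\<ge>0. norm (z x - mat 1) \<le> C / Im \<rho> \<and> norm (w x) \<le> C)"

lemma factored_exists: "\<exists>Pm Pm' Pp Pp' B N. factored Q1 q Pm Pm' Pp Pp' B N"
proof -
  have "(\<lambda>t. 0 - Q1 t) absolutely_integrable_on {0..}"
    using set_integral_diff(1)[OF absolutely_integrable_zero int(2)] .
  then have "(\<lambda>t. - Q1 t) absolutely_integrable_on {0..}" by simp
  from fundamental_matrix_exists[OF this] obtain Pm Pm' B1 where
    m: "Pm 0 = mat 1" "Pm' 0 = mat 1" "primitive Pm (\<lambda>t. - Q1 t ** Pm t)" "primitive Pm' (\<lambda>t. - (Pm' t ** - Q1 t))"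
     "\<forall>x\<ge>0. Pm' x ** Pm x = mat 1 \<and> Pm x ** Pm' x = mat 1 \<and> norm (Pm x) \<le> B1 \<and> norm (Pm' x) \<le> B1"
    by (elim exE conjE)
  from fundamental_matrix_exists[OF int(2)] obtain Pp Pp' B2 where
    p: "Pp 0 = mat 1" "Pp' 0 = mat 1" "primitive Pp (\<lambda>t. Q1 t ** Pp t)" "primitive Pp' (\<lambda>t. - (Pp' t ** Q1 t))"
     "\<forall>x\<ge>0. Pp' x ** Pp x = mat 1 \<and> Pp x ** Pp' x = mat 1 \<and> norm (Pp x) \<le> B2 \<and> norm (Pp' x) \<le> B2"
    by (elim exE conjE)
  have "factored Q1 q Pm Pm' Pp Pp' (max B1 B2) (integral {0..} (\<lambda>s. norm (q s)))"
    by unfold_locales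
      (use m p int(2) q_integrable in \<open>auto simp: matrix_algebra le_max_iff_disj\<close>)
  then show ?thesis by blast
qed

text \<open>If \<open>J\<close> is the decaying solution with \<open>J 0 = I\<close>, then \<open>\<Phi> = J U(J)\<^sup>-\<^sup>1\<close>, so the inverse of the Weyl
  matrix is \<open>U(J)\<close>.\<close>

lemma weyl_matrix_upper:
  assumes F: "factored Q1 q Pm Pm' Pp Pp' B N" and det: "det (mat 1 + h1) \<noteq> 0"
  shows "\<exists>C R. R > 0 \<and> (\<forall>\<rho>. Im \<rho> \<ge> R \<longrightarrow> \<rho> \<in> weyl_domain Q0 Q1 h0 h1 \<and>
     (\<exists>z w. jost Pm C \<rho> z w \<and>
       weyl_matrix Q0 Q1 h0 h1 \<rho> ** (cscale (\<i> * \<rho>) (mat 1 + h1) + (w 0 - Q1 0 + h0)) = mat 1))"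
proof -
  interpret F: factored Q1 q Pm Pm' Pp Pp' B N by (rule F)
  let ?I = "mat 1 :: complex^'m^'m"
  obtain H where H: "(mat 1 + h1) ** H = mat 1" "H ** (mat 1 + h1) = mat 1"
    using det unfolding invertible_det_nz[symmetric] invertible_def by (elim exE conjE)
  define C where "C = 2 * B ^ 4 * N * norm ?I + 2 * B ^ 3 * N * norm ?I"
  have C0: "0 \<le> 2 * B ^ 4 * N * norm ?I" "0 \<le> 2 * B ^ 3 * N * norm ?I"
    using F.B_nonneg F.N_nonneg by simp_all
  define c where "c = norm H * (C + norm (Q1 0) + norm h0)"
  \<comment> \<open>The entry \<open>2 * B ^ 4 * N\<close> provides the decaying solution;
    \<open>c + 1\<close> lets the leading term i\<rho>(I + h1) of its boundary value dominate the
    rest.\<close>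
  define R where "R = max 1 (max (2 * B ^ 4 * N) (c + 1))"
  have R_pos: "R > 0" by (simp add: R_def)
  have main: "\<rho> \<in> weyl_domain Q0 Q1 h0 h1 \<and> (\<exists>z w. jost Pm C \<rho> z w \<and>
       weyl_matrix Q0 Q1 h0 h1 \<rho> ** (cscale (\<i> * \<rho>) (mat 1 + h1) + (w 0 - Q1 0 + h0)) = mat 1)"
    if \<rho>: "Im \<rho> \<ge> R" for \<rho>
  proof -
    have \<tau>: "Im \<rho> > 0" "Im \<rho> \<ge> 2 * B ^ 4 * N" "Im \<rho> > c" using \<rho> by (auto simp: R_def)
    then have "\<rho> \<noteq> 0" by auto
    obtain z w where zw: "z 0 = ?I" "primitive (\<lambda>x. Pm x ** z x) (\<lambda>t. w t - Q1 t ** (Pm t ** z t))"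
       "primitive w (\<lambda>t. cscale (- 2 * \<i> * \<rho>) (w t) + Q1 t ** w t - q t ** (Pm t ** z t))"
       and zwle: "\<forall>x\<ge>0. norm (z x - ?I) \<le> 2 * B ^ 4 * N * norm ?I / Im \<rho> \<and> norm (z x) \<le> 2 * norm ?I \<and>
          norm (w x) \<le> 2 * B ^ 3 * N * norm ?I"
      using F.decaying_solution_exists[OF order_refl \<tau>(1) \<tau>(2)] by (elim exE conjE)
    have J: "jost Pm C \<rho> z w"
      unfolding jost_def
    proof (intro conjI allI impI zw)
      fix x :: real assume x: "x \<ge> 0"
      have "norm (z x - ?I) \<le> 2 * B ^ 4 * N * norm ?I / Im \<rho>" using zwle x by simp
      also have "\<dots> \<le> C / Im \<rho>" using \<tau>(1) C0 by (intro divide_right_mono) (auto simp: C_def)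
      finally show "norm (z x - ?I) \<le> C / Im \<rho>" .
      have "norm (w x) \<le> 2 * B ^ 3 * N * norm ?I" using zwle x by simp
      then show "norm (w x) \<le> C" unfolding C_def using C0 by linarith
    qed
    define D where "D = cscale (\<i> * \<rho>) (mat 1 + h1) + (w 0 - Q1 0 + h0)"
    have "norm (w 0) \<le> C" using J by (simp add: jost_def)
    \<comment> \<open>Factoring out the leading term writes the boundary value \<open>D\<close> as
      i\<rho>(I + h1)(I + X) with norm X < 1; its inverse is assembled from \<open>G\<close> and
      \<open>H\<close>.\<close>
    define X where "X = cscale (inverse (\<i> * \<rho>)) (H ** (w 0 - Q1 0 + h0))"
    have "norm (w 0 - Q1 0 + h0) \<le> norm (w 0) + norm (Q1 0) + norm h0"
      by (intro order_trans[OF norm_triangle_ineq] add_right_mono norm_triangle_ineq4)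
    then have "norm (H ** (w 0 - Q1 0 + h0)) \<le> norm H * (C + norm (Q1 0) + norm h0)"
      using \<open>norm (w 0) \<le> C\<close> by (intro norm_mm_le) auto
    then have "norm (H ** (w 0 - Q1 0 + h0)) < Im \<rho>" using \<tau>(3) by (simp add: c_def)
    also have "\<dots> \<le> norm \<rho>" using abs_Im_le_cmod[of \<rho>] by simp
    finally have "norm (H ** (w 0 - Q1 0 + h0)) / norm \<rho> < 1"
      using \<open>\<rho> \<noteq> 0\<close> by (simp add: divide_less_eq)
    moreover have "norm X = norm (H ** (w 0 - Q1 0 + h0)) / norm \<rho>"
      by (simp add: X_def norm_inverse norm_mult divide_inverse mult.commute)
    ultimately have "norm X < 1" by simp
    then obtain G where G: "G ** (mat 1 + X) = mat 1"
      using matrix_near_identity_invertible by blast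
    have "cscale (\<i> * \<rho>) X = H ** (w 0 - Q1 0 + h0)"
      using \<open>\<rho> \<noteq> 0\<close> by (simp add: X_def cscale_cscale cscale_one field_simps)
    then have "cscale (\<i> * \<rho>) ((mat 1 + h1) ** X) = (mat 1 + h1) ** (H ** (w 0 - Q1 0 + h0))"
      by (simp only: cscale_mult_right[symmetric])
    then have D: "D = cscale (\<i> * \<rho>) ((mat 1 + h1) ** (mat 1 + X))"
      using H by (simp add: D_def mm.add_right matrix_mul_assoc cscale.add_right)
    define M where "M = cscale (inverse (\<i> * \<rho>)) (G ** H)"
    have "M ** D = cscale (inverse (\<i> * \<rho>) * (\<i> * \<rho>)) (G ** (H ** (mat 1 + h1)) ** (mat 1 + X))"
      unfolding M_def D by (simp only: cscale_mult_left cscale_mult_right cscale_cscale matrix_mul_assoc mult.commute)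
    also have "inverse (\<i> * \<rho>) * (\<i> * \<rho>) = 1" by (rule left_inverse) (use \<open>\<rho> \<noteq> 0\<close> in simp)
    finally have MD: "M ** D = mat 1" using H(2) G by (simp add: cscale_one)
    then have DM: "D ** M = mat 1" by (simp add: matrix_left_right_inverse)
    define Y where "Y t = cscale (exp (\<i> * \<rho> * of_real t)) (Pm t ** z t)" for t
    define V where "V t = cscale (exp (\<i> * \<rho> * of_real t)) (w t)" for t
    have YV: "system \<rho> Y V"
      unfolding Y_def[abs_def] V_def[abs_def] by (rule system_unscaled[OF zw(2,3)])
    have Y0: "Y 0 = mat 1" and V0: "V 0 = w 0" using zw(1) F.init(1) by (simp_all add: Y_def V_def cscale_one)
    have UY: "pencil_U h0 h1 \<rho> (\<lambda>t. Y t ** K) = D ** K" for K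
      unfolding pencil_U_system[OF system_mult_right[OF YV]] Y0 V0 D_def by (simp add: matrix_algebra)
    have exists: "weyl_solution Q0 Q1 h0 h1 \<rho> (\<lambda>t. Y t ** M)"
      unfolding weyl_solution_def
    proof (intro conjI impI allI)
      show "pencil_solution Q0 Q1 \<rho> (\<lambda>t. Y t ** M)"
        by (rule system_imp_pencil_solution[OF system_mult_right[OF YV]])
      show "pencil_U h0 h1 \<rho> (\<lambda>t. Y t ** M) = mat 1" unfolding UY by (rule DM)
      fix i j
      show "(\<lambda>x. (Y x ** M) $ i $ j) \<in> O[at_top](\<lambda>x. exp (\<i> * \<rho> * of_real x))"
      proof (rule bigoI[of _ "B * (2 * norm ?I) * norm M"], rule eventually_mono[OF eventually_ge_at_top[of 0]])
        fix x :: real assume x: "x \<ge> 0"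
        have "norm (Pm x ** z x ** M) \<le> B * (2 * norm ?I) * norm M"
          by (intro norm_mm_le F.bound x order_refl) (use zwle x in simp)
        then have "norm (Y x ** M) \<le> norm (exp (\<i> * \<rho> * of_real x)) * (B * (2 * norm ?I) * norm M)"
          unfolding Y_def cscale_mult_left norm_cscale by (rule mult_left_mono) simp
        moreover have "norm ((Y x ** M) $ i $ j) \<le> norm (Y x ** M)"
          by (rule order_trans[OF Finite_Cartesian_Product.norm_nth_le Finite_Cartesian_Product.norm_nth_le])
        ultimately show "norm ((Y x ** M) $ i $ j) \<le> B * (2 * norm ?I) * norm M * norm (exp (\<i> * \<rho> * of_real x))"
          by (simp add: mult.commute)
      qed
    next
      assume "\<rho> \<in> Pi_minus"
      then show "(\<lambda>x. (Y x ** M) $ i $ j) \<in> O[at_top](\<lambda>x. exp (- \<i> * \<rho> * of_real x))" for i j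
        using \<tau>(1) by (simp add: Pi_minus_def)
    qed
    have unique: "\<Phi> 0 = M" if \<Phi>: "weyl_solution Q0 Q1 h0 h1 \<rho> \<Phi>" for \<Phi>
    proof -
      define V' where "V' t = deriv_half_line \<Phi> t - cscale (\<i> * \<rho>) (\<Phi> t) + Q1 t ** \<Phi> t" for t
      have sys: "system \<rho> \<Phi> V'"
        unfolding V'_def using \<Phi> by (intro pencil_solution_imp_system) (simp add: weyl_solution_def)
      have U\<Phi>: "pencil_U h0 h1 \<rho> \<Phi> = mat 1" using \<Phi> by (simp add: weyl_solution_def)
      have O: "(\<lambda>x. \<Phi> x $ i $ j) \<in> O[at_top](\<lambda>x. exp (\<i> * \<rho> * of_real x))" for i j
        using \<Phi> \<tau>(1) by (simp add: weyl_solution_def Pi_plus_def)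
      define E where "E t = exp (- (\<i> * \<rho>) * of_real t)" for t :: real
      have EE: "E t * exp (\<i> * \<rho> * of_real t) = 1" for t
        by (simp add: E_def exp_add[symmetric])
      define y where "y t = cscale (E t) (\<Phi> t)" for t
      define v where "v t = cscale (E t) (V' t)" for t
      have y: "primitive y (\<lambda>t. v t - Q1 t ** y t)"
        and v: "primitive v (\<lambda>t. cscale (- 2 * \<i> * \<rho>) (v t) + Q1 t ** v t - q t ** y t)"
      proof -
        have 1: "\<i> * \<rho> + - (\<i> * \<rho>) = 0" and 2: "\<i> * \<rho> - - (\<i> * \<rho>) = - (- 2 * \<i> * \<rho>)" by simp_all
        show "primitive y (\<lambda>t. v t - Q1 t ** y t)"
          by (rule primitive_cong[OF system_scaled(1)[OF sys, of "- (\<i> * \<rho>)", unfolded 1]])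
            (simp_all add: y_def v_def E_def cscale.zero_left)
        show "primitive v (\<lambda>t. cscale (- 2 * \<i> * \<rho>) (v t) + Q1 t ** v t - q t ** y t)"
          by (rule primitive_cong[OF system_scaled(2)[OF sys, of "- (\<i> * \<rho>)", unfolded 2]])
            (simp_all add: y_def v_def E_def cscale.minus_left)
      qed
      have ex: "\<exists>b. \<forall>x\<ge>0. norm (y x $ i $ j) \<le> b" for i j
      proof -
        obtain b where b: "\<forall>\<^sub>F x in at_top. norm (\<Phi> x $ i $ j) \<le> b * norm (exp (\<i> * \<rho> * of_real x))"
          using O[of i j] by (elim landau_o.bigE)
        have "\<forall>\<^sub>F x in at_top. norm (y x $ i $ j) \<le> b"
          using b
        proof eventually_elim
          case (elim x)
          have "norm (y x $ i $ j) = norm (E x) * norm (\<Phi> x $ i $ j)" by (simp add: y_def norm_mult)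
          also have "\<dots> \<le> norm (E x) * (b * norm (exp (\<i> * \<rho> * of_real x)))"
            using elim by (rule mult_left_mono) simp
          also have "\<dots> = b * norm (E x * exp (\<i> * \<rho> * of_real x))" by (simp only: norm_mult mult_ac)
          finally show ?case by (simp add: EE)
        qed
        moreover have "continuous_on {0..} (\<lambda>x. y x $ i $ j)"
          by (intro continuous_on_component primitive_continuous_on[OF y])
        ultimately show ?thesis by (intro eventually_bounded_imp_bounded)
      qed
      define b where "b i j = (SOME b. \<forall>x\<ge>0. norm (y x $ i $ j) \<le> b)" for i j
      have b: "norm (y x $ i $ j) \<le> b i j" if "x \<ge> 0" for i j x
        using someI_ex[OF ex[of i j]] that unfolding b_def by simp
      have yb: "norm (y x) \<le> (\<Sum>i\<in>UNIV. \<Sum>j\<in>UNIV. b i j)" if "x \<ge> 0" for x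
        by (rule order_trans[OF norm_matrix_le_sum]) (intro sum_mono b that)
      define K where "K = \<Phi> 0"
      \<comment> \<open>Both terms are bounded and agree at 0, so the difference is a bounded
        solution with initial value 0. Thus every Weyl solution is a right multiple of the decaying
        one.\<close>
      have "y x - (Pm x ** z x) ** K = 0" if x: "x \<ge> 0" for x
      proof (rule F.bounded_solution_zero[OF order_refl \<tau>(1) \<tau>(2), where y = "\<lambda>x. y x - (Pm x ** z x) ** K" and w = "\<lambda>x. v x - w x ** K"])
        show "primitive (\<lambda>x. y x - (Pm x ** z x) ** K) (\<lambda>t. (v t - w t ** K) - Q1 t ** (y t - (Pm t ** z t) ** K))"
          by (rule primitive_cong[OF primitive_diff[OF y primitive_linear[OF mm.bounded_linear_left zw(2), of K]]])
            (simp_all add: matrix_algebra)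
        show "primitive (\<lambda>x. v x - w x ** K) (\<lambda>t. cscale (- 2 * \<i> * \<rho>) (v t - w t ** K) + Q1 t ** (v t - w t ** K) -
            q t ** (y t - (Pm t ** z t) ** K))"
          by (rule primitive_cong[OF primitive_diff[OF v primitive_linear[OF mm.bounded_linear_left zw(3), of K]]])
            (simp_all add: matrix_algebra)
        show "y 0 - (Pm 0 ** z 0) ** K = 0"
          by (simp add: y_def E_def cscale_one zw(1) F.init K_def)
        show "norm (y x - (Pm x ** z x) ** K) \<le> (\<Sum>i\<in>UNIV. \<Sum>j\<in>UNIV. b i j) + B * (2 * norm ?I) * norm K" if "x \<ge> 0" for x
          by (intro order_trans[OF norm_triangle_ineq4] add_mono yb norm_mm_le F.bound that order_refl) (use zwle that in simp)
      qed (rule x)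
      then have yJ: "y x = (Pm x ** z x) ** K" if "x \<ge> 0" for x
        using that by simp
      have eq: "Y x ** K = \<Phi> x" if "x \<ge> 0" for x
      proof -
        have "Y x ** K = cscale (exp (\<i> * \<rho> * of_real x)) (y x)"
          unfolding yJ[OF that] Y_def cscale_mult_left ..
        also have "\<dots> = cscale (E x * exp (\<i> * \<rho> * of_real x)) (\<Phi> x)"
          unfolding y_def cscale_cscale by (simp only: mult.commute)
        finally show ?thesis unfolding EE cscale_one .
      qed
      \<comment> \<open>Equality is known only on the half-line, so the derivatives at 0 are
        compared within {0..}.\<close>
      have d: "((\<lambda>t. Y t ** K) has_vector_derivative deriv_half_line (\<lambda>t. Y t ** K) 0) (at 0 within {0..})"
        using system_deriv_half_line[OF system_mult_right[OF YV] order_refl, of K] by simp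
      have "(\<Phi> has_vector_derivative deriv_half_line (\<lambda>t. Y t ** K) 0) (at 0 within {0..})"
        by (rule has_vector_derivative_transform[OF _ _ d]) (simp_all add: eq)
      then have "deriv_half_line \<Phi> 0 = deriv_half_line (\<lambda>t. Y t ** K) 0"
        unfolding deriv_half_line_def[of \<Phi>] by (intro vector_derivative_within at_within_half_line_neq_bot) auto
      then have "D ** K = mat 1"
        using U\<Phi> UY[of K] eq[of 0] by (simp add: pencil_U_def)
      then have "M ** (D ** K) = M" by simp
      then show ?thesis using MD by (simp add: matrix_mul_assoc K_def)
    qed
    have "weyl_matrix Q0 Q1 h0 h1 \<rho> = M"
      unfolding weyl_matrix_def
    proof (rule the_equality)
      show "\<exists>\<Phi>. weyl_solution Q0 Q1 h0 h1 \<rho> \<Phi> \<and> M = \<Phi> 0"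
        by (rule exI[of _ "\<lambda>t. Y t ** M"], rule conjI[OF exists]) (simp add: Y0)
      fix M' assume "\<exists>\<Phi>. weyl_solution Q0 Q1 h0 h1 \<rho> \<Phi> \<and> M' = \<Phi> 0"
      then obtain \<Phi> where "weyl_solution Q0 Q1 h0 h1 \<rho> \<Phi>" "M' = \<Phi> 0" by (elim exE conjE)
      with unique[OF this(1)] show "M' = M" by simp
    qed
    then have W: "weyl_matrix Q0 Q1 h0 h1 \<rho> ** D = mat 1" using MD by simp
    have dom: "\<rho> \<in> weyl_domain Q0 Q1 h0 h1"
      unfolding weyl_domain_def
      by (rule CollectI, rule conjI, simp add: Pi_plus_def \<tau>(1), rule exI, rule exists)
    show ?thesis
      by (rule conjI[OF dom], rule exI[of _ z], rule exI[of _ w], rule conjI[OF J], rule W[unfolded D_def])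
  qed
  show ?thesis
    by (rule exI[of _ C], rule exI[of _ R], intro conjI[OF R_pos] allI impI, rule main)
qed

end

section \<open>The transfer matrix\<close>

lemma absolutely_integrable_Pair:
  fixes f :: "real \<Rightarrow> 'a::euclidean_space" and g :: "real \<Rightarrow> 'b::euclidean_space"
  assumes "f absolutely_integrable_on S" "g absolutely_integrable_on S"
  shows "(\<lambda>x. (f x, g x)) absolutely_integrable_on S"
proof -
  have "bounded_linear (\<lambda>a::'a. (a, 0::'b))" "bounded_linear (\<lambda>b::'b. (0::'a, b))"
    by (auto intro!: bounded_linear_intros)
  from set_integral_add(1)[OF absolutely_integrable_linear[OF assms(1) this(1)] absolutely_integrable_linear[OF assms(2) this(2)]]
  show ?thesis by (simp add: o_def)
qed

text \<open>The real slot \<open>e\<close>, always \<open>1\<close> in use, makes the operator bilinear although the coefficient of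
  \<open>V\<close> in \<open>Y'\<close> is the unit matrix.\<close>

fun system_op :: "complex \<times> real \<times> (complex^'m^'m) \<times> (complex^'m^'m) \<Rightarrow> (complex^'m^'m) \<times> (complex^'m^'m) \<Rightarrow>
    (complex^'m^'m) \<times> (complex^'m^'m)" where
  "system_op (s, e, Q, q) (Y, V) = (cscale s Y - Q ** Y + e *\<^sub>R V, Q ** V - cscale s V - q ** Y)"

lemma bounded_bilinear_system_op: "bounded_bilinear system_op"
  unfolding bilinear_conv_bounded_bilinear[symmetric] bilinear_def linear_iff
  by (simp add: split_paired_all matrix_algebra cscale.add_left scaleR_add_left scaleR_add_right scaleR_diff_right)

context pencil_system
begin

lemma system_iff_system_op:
  "system \<rho> Y V \<longleftrightarrow> primitive (\<lambda>t. (Y t, V t)) (\<lambda>t. system_op (\<i> * \<rho>, 1, Q1 t, q t) (Y t, V t))"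
proof
  assume "system \<rho> Y V"
  then show "primitive (\<lambda>t. (Y t, V t)) (\<lambda>t. system_op (\<i> * \<rho>, 1, Q1 t, q t) (Y t, V t))"
    unfolding system_def by (simp add: primitive_Pair)
next
  assume "primitive (\<lambda>t. (Y t, V t)) (\<lambda>t. system_op (\<i> * \<rho>, 1, Q1 t, q t) (Y t, V t))"
  from primitive_fst[OF this] primitive_snd[OF this] show "system \<rho> Y V"
    by (simp add: system_def)
qed

lemma system_coefficients_integrable:
  "T \<ge> 0 \<Longrightarrow> (\<lambda>t. (c :: complex, 1 :: real, Q1 t, q t)) absolutely_integrable_on {0..T}"
  by (intro absolutely_integrable_Pair absolutely_integrable_half_line_subset(1)[OF int(2)]
      absolutely_integrable_half_line_subset(1)[OF q_integrable] absolutely_integrable_continuous_real continuous_on_const)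

lemma system_exists: "\<exists>Y V. system \<rho> Y V \<and> Y 0 = Y0 \<and> V 0 = V0"
proof -
  obtain K where K: "K \<ge> 0" "\<And>a b. norm (system_op a b :: (complex^'m^'m) \<times> _) \<le> norm a * norm b * K"
    using bounded_bilinear.nonneg_bounded[OF bounded_bilinear_system_op] by blast
  then have K': "\<And>a b. norm (system_op a b :: (complex^'m^'m) \<times> _) \<le> K * norm a * norm b" by (simp add: mult_ac)
  obtain X where X: "X 0 = (Y0, V0)" "primitive X (\<lambda>t. system_op (\<i> * \<rho>, 1, Q1 t, q t) (X t))"
    using linear_ode_exists[OF bounded_bilinear_system_op K(1) K' system_coefficients_integrable] by blast
  have "system \<rho> (\<lambda>t. fst (X t)) (\<lambda>t. snd (X t))"
    unfolding system_iff_system_op using X(2) by simp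
  then show ?thesis using X(1) by (intro exI[of _ "\<lambda>t. fst (X t)"] exI[of _ "\<lambda>t. snd (X t)"]) simp
qed

lemma system_unique:
  assumes "system \<rho> Y V" "system \<rho> Y' V'" "Y 0 = Y' 0" "V 0 = V' 0" "x \<ge> 0"
  shows "Y x = Y' x"
proof -
  obtain K where K: "K \<ge> 0" "\<And>a b. norm (system_op a b :: (complex^'m^'m) \<times> _) \<le> norm a * norm b * K"
    using bounded_bilinear.nonneg_bounded[OF bounded_bilinear_system_op] by blast
  then have K': "\<And>a b. norm (system_op a b :: (complex^'m^'m) \<times> _) \<le> K * norm a * norm b" by (simp add: mult_ac)
  have "(Y x, V x) = (Y' x, V' x)"
    by (rule linear_ode_unique[OF bounded_bilinear_system_op K(1) K' system_coefficients_integrable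
          assms(1)[unfolded system_iff_system_op] assms(2)[unfolded system_iff_system_op]]) (use assms in auto)
  then show ?thesis by simp
qed

lemma uminus_system: "pencil_system Q0 (\<lambda>x. - Q1 x) (\<lambda>x. - Q1' x)"
proof
  show "primitive (\<lambda>x. - Q1 x) (\<lambda>x. - Q1' x)" by (rule primitive_minus[OF Q1])
  show "(\<lambda>x. - Q1 x) absolutely_integrable_on {0..}" "(\<lambda>x. - Q1' x) absolutely_integrable_on {0..}"
    using set_integral_diff(1)[OF absolutely_integrable_zero int(2)] set_integral_diff(1)[OF absolutely_integrable_zero int(3)]
    by simp_all
qed (rule int)

text \<open>The reflected system describes the same solution Y of the pencil, so the passage goes
  through the pencil equation. Only the second component differs: it is Y' + i\<rho>Y - Q1 Y instead
  of Y' - i\<rho>Y + Q1 Y.\<close>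

lemma system_uminus:
  assumes "pencil_system.system Q0 (\<lambda>x. - Q1 x) (\<lambda>x. - Q1' x) (- \<rho>) Y V"
  shows "\<exists>V'. system \<rho> Y V' \<and> (\<forall>x\<ge>0. V' x = V x + (2 *\<^sub>R Q1 x - cscale (2 * \<i> * \<rho>) (mat 1)) ** Y x)"
proof -
  interpret M: pencil_system Q0 "\<lambda>x. - Q1 x" "\<lambda>x. - Q1' x" by (rule uminus_system)
  have 1: "mat ((- \<rho>)\<^sup>2) + mat (2 * \<i> * (- \<rho>)) ** (- A) = mat (\<rho>\<^sup>2) + mat (2 * \<i> * \<rho>) ** A" for A :: "complex^'m^'m"
    by (simp add: mat_matrix_mult matrix_algebra cscale.minus_left)
  have "pencil_ell Q0 (\<lambda>x. - Q1 x) (- \<rho>) Y = pencil_ell Q0 Q1 \<rho> Y"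
    unfolding pencil_ell_def 1 ..
  then have "pencil_solution Q0 Q1 \<rho> Y"
    using M.system_imp_pencil_solution[OF assms] by (simp add: pencil_solution_def)
  then have "system \<rho> Y (\<lambda>t. deriv_half_line Y t - cscale (\<i> * \<rho>) (Y t) + Q1 t ** Y t)"
    by (rule pencil_solution_imp_system)
  moreover have "deriv_half_line Y x - cscale (\<i> * \<rho>) (Y x) + Q1 x ** Y x =
      V x + (2 *\<^sub>R Q1 x - cscale (2 * \<i> * \<rho>) (mat 1)) ** Y x" if "x \<ge> 0" for x
  proof -
    have "cscale (2 * \<i> * \<rho>) (Y x) = cscale (\<i> * \<rho>) (Y x) + cscale (\<i> * \<rho>) (Y x)"
      by (simp add: cscale.add_left[symmetric] mult.assoc)
    then have "(2 *\<^sub>R Q1 x - cscale (2 * \<i> * \<rho>) (mat 1)) ** Y x =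
        (Q1 x ** Y x + Q1 x ** Y x) - (cscale (\<i> * \<rho>) (Y x) + cscale (\<i> * \<rho>) (Y x))"
      by (simp only: mm.diff_left mm.add_left matrix_scaleR_left scaleR_2 cscale_mult_left matrix_mul_lid)
    then show ?thesis
      unfolding M.system_deriv_half_line(2)[OF assms that]
      by (simp add: mm.minus_left cscale.minus_left)
  qed
  ultimately show ?thesis by blast
qed

lemma jost_mono:
  assumes "jost Pm C \<rho> z w" "C \<le> C'" "Im \<rho> > 0"
  shows "jost Pm C' \<rho> z w"
proof -
  have "C / Im \<rho> \<le> C' / Im \<rho>" using assms(2,3) by (intro divide_right_mono) auto
  then show ?thesis using assms(1,2) unfolding jost_def by (meson order_trans)
qed

end

text \<open>The right-hand side of the equation \<open>P' = G P - P G\<^sup>~\<close> of a transfer matrix \<open>P = (A E; C D)\<close>, where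
  \<open>G\<close>, \<open>G\<^sup>~\<close> are the coefficient matrices of the two systems and \<open>s = 2 \<i> \<rho>\<close>. Being linear in \<open>\<rho>\<close> it makes
  \<open>P\<close> entire.\<close>

fun transfer_op :: "complex \<times> real \<times> ((complex^'m^'m) \<times> (complex^'m^'m)) \<times> ((complex^'m^'m) \<times> (complex^'m^'m)) \<Rightarrow>
    ((complex^'m^'m) \<times> (complex^'m^'m)) \<times> ((complex^'m^'m) \<times> (complex^'m^'m)) \<Rightarrow>
    ((complex^'m^'m) \<times> (complex^'m^'m)) \<times> ((complex^'m^'m) \<times> (complex^'m^'m))" where
  "transfer_op (s, e, (Q, Qt), (q, qt)) ((A, E), (C, D)) =
    ((A ** Qt - Q ** A + e *\<^sub>R C + E ** qt, cscale s E - Q ** E - E ** Qt + e *\<^sub>R (D - A)),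
     (Q ** C + C ** Qt - cscale s C - q ** A + D ** qt, Q ** D - D ** Qt - q ** E - e *\<^sub>R C))"

lemma bounded_bilinear_transfer_op: "bounded_bilinear transfer_op"
  unfolding bilinear_conv_bounded_bilinear[symmetric] bilinear_def linear_iff
  by (simp add: split_paired_all matrix_algebra cscale.add_left scaleR_add_left scaleR_add_right scaleR_diff_right mult.commute)

text \<open>Complex scalar multiplication on block matrices, the action with respect to which the
  derivative in \<rho> is formed.\<close>

fun block_scale :: "complex \<Rightarrow> ((complex^'m^'m) \<times> (complex^'m^'m)) \<times> ((complex^'m^'m) \<times> (complex^'m^'m)) \<Rightarrow>
    ((complex^'m^'m) \<times> (complex^'m^'m)) \<times> ((complex^'m^'m) \<times> (complex^'m^'m))" where
  "block_scale c ((A, E), (C, D)) = ((cscale c A, cscale c E), (cscale c C, cscale c D))"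

lemma bounded_bilinear_block_scale: "bounded_bilinear block_scale"
  unfolding bilinear_conv_bounded_bilinear[symmetric] bilinear_def linear_iff
  by (simp add: split_paired_all matrix_algebra cscale.add_left scaleR_add_left)

lemma transfer_op_block_scale: "transfer_op a (block_scale c v) = block_scale c (transfer_op a v)"
proof -
  obtain s e Q Qt q qt where a: "a = (s, e, (Q, Qt), (q, qt))" by (metis prod.exhaust)
  obtain A E C D where v: "v = ((A, E), (C, D))" by (metis prod.exhaust)
  show ?thesis unfolding a v by (simp add: matrix_algebra mult.commute)
qed

text \<open>The operator is affine in \<rho>; its slope is found by setting every slot of the
  coefficient except the scalar one to 0.\<close>

lemma transfer_op_shift:
  "transfer_op (2 * \<i> * \<rho>, 1, a, b) v = transfer_op (2 * \<i> * \<rho>', 1, a, b) v +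
     block_scale (\<rho> - \<rho>') (transfer_op (2 * \<i>, 0, 0, 0) v)"
proof -
  obtain Q Qt q qt where a: "a = (Q, Qt)" "b = (q, qt)" by (metis prod.exhaust)
  obtain A E C D where v: "v = ((A, E), (C, D))" by (metis prod.exhaust)
  have c: "cscale (2 * \<i> * \<rho>) X = cscale (2 * \<i> * \<rho>') X + cscale ((\<rho> - \<rho>') * (2 * \<i>)) X" for X :: "complex^'a^'a"
    by (simp add: cscale.add_left[symmetric] algebra_simps)
  show ?thesis unfolding a v zero_prod_def by (simp add: matrix_algebra c[of E] c[of C])
qed

section \<open>Transfer between two pencils\<close>

locale two_pencils = L: pencil_system Q0 Q1 Q1' + T: pencil_system Q0t Q1t Q1t'
  for Q0 Q1 Q1' Q0t Q1t Q1t' :: "real \<Rightarrow> complex^'m::finite^'m"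
begin

definition coeff :: "complex \<Rightarrow> real \<Rightarrow> complex \<times> real \<times> ((complex^'m^'m) \<times> (complex^'m^'m)) \<times> ((complex^'m^'m) \<times> (complex^'m^'m))" where
  "coeff \<rho> t = (2 * \<i> * \<rho>, 1, (Q1 t, Q1t t), (L.q t, T.q t))"

lemma coeff_integrable: "T \<ge> 0 \<Longrightarrow> coeff \<rho> absolutely_integrable_on {0..T}"
  unfolding coeff_def[abs_def]
  by (intro absolutely_integrable_Pair absolutely_integrable_half_line_subset(1)[OF L.int(2)]
      absolutely_integrable_half_line_subset(1)[OF T.int(2)] absolutely_integrable_half_line_subset(1)[OF L.q_integrable]
      absolutely_integrable_half_line_subset(1)[OF T.q_integrable] absolutely_integrable_continuous_real continuous_on_const)

lemma norm_coeff_le: "norm (coeff \<rho> t) \<le> norm (coeff 0 t) + 2 * norm \<rho>"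
proof -
  have "coeff \<rho> t = coeff 0 t + (2 * \<i> * \<rho>, 0)" by (simp add: coeff_def zero_prod_def)
  also have "norm \<dots> \<le> norm (coeff 0 t) + norm (2 * \<i> * \<rho>, 0 :: real \<times> ((complex^'m^'m) \<times> (complex^'m^'m)) \<times> ((complex^'m^'m) \<times> (complex^'m^'m)))"
    by (rule norm_triangle_ineq)
  finally show ?thesis by (simp add: norm_mult)
qed

text \<open>The initial value ((I, 0), (-k, I)) sends (Yt, Vt) at 0 to (Y, V) at 0, and the transfer
  equation propagates this to all x. As the initial value is free of \<rho>, the parameter lemmas
  give entire entries of exponential type. Only the top row is exported, since comparing the
  components Y is enough.\<close>

lemma transfer_exists:
  "\<exists>A E :: complex \<Rightarrow> real \<Rightarrow> complex^'m^'m.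
    (\<forall>x\<ge>0. \<forall>i j. (\<lambda>\<rho>. A \<rho> x $ i $ j) holomorphic_on UNIV \<and> (\<lambda>\<rho>. E \<rho> x $ i $ j) holomorphic_on UNIV) \<and>
    (\<forall>x\<ge>0. \<exists>C. \<forall>\<rho>. norm (A \<rho> x) \<le> C * exp (C * norm \<rho>) \<and> norm (E \<rho> x) \<le> C * exp (C * norm \<rho>)) \<and>
    (\<forall>\<rho> Y V Yt Vt x. L.system \<rho> Y V \<longrightarrow> T.system \<rho> Yt Vt \<longrightarrow> Yt 0 = Y 0 \<longrightarrow> Vt 0 = V 0 + k ** Y 0 \<longrightarrow> x \<ge> 0 \<longrightarrow>
       A \<rho> x ** Yt x + E \<rho> x ** Vt x = Y x)"
proof -
  let ?op = "transfer_op :: _ \<Rightarrow> ((complex^'m^'m) \<times> (complex^'m^'m)) \<times> ((complex^'m^'m) \<times> (complex^'m^'m)) \<Rightarrow> _"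
  obtain K where K: "K \<ge> 0" "\<And>a b. norm (?op a b) \<le> norm a * norm b * K"
    using bounded_bilinear.nonneg_bounded[OF bounded_bilinear_transfer_op] by blast
  then have K': "\<And>a b. norm (?op a b) \<le> K * norm a * norm b" by (simp add: mult_ac)
  let ?X0 = "((mat 1, 0), (- k, mat 1)) :: ((complex^'m^'m) \<times> (complex^'m^'m)) \<times> ((complex^'m^'m) \<times> (complex^'m^'m))"
  have ex: "\<exists>X. X 0 = ?X0 \<and> primitive X (\<lambda>t. ?op (coeff \<rho> t) (X t))" for \<rho>
    by (rule linear_ode_exists[OF bounded_bilinear_transfer_op K(1) K' coeff_integrable])
  define P where "P \<rho> = (SOME X. X 0 = ?X0 \<and> primitive X (\<lambda>t. ?op (coeff \<rho> t) (X t)))" for \<rho>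
  have P0: "P \<rho> 0 = ?X0" and P: "primitive (P \<rho>) (\<lambda>t. ?op (coeff \<rho> t) (P \<rho> t))" for \<rho>
    using someI_ex[OF ex[of \<rho>]] unfolding P_def by auto
  define A where "A \<rho> x = fst (fst (P \<rho> x))" for \<rho> x
  define E where "E \<rho> x = snd (fst (P \<rho> x))" for \<rho> x
  define C where "C \<rho> x = fst (snd (P \<rho> x))" for \<rho> x
  define D where "D \<rho> x = snd (snd (P \<rho> x))" for \<rho> x
  have Peq: "P \<rho> x = ((A \<rho> x, E \<rho> x), (C \<rho> x, D \<rho> x))" for \<rho> x
    by (simp add: A_def E_def C_def D_def)
  have shift: "?op (coeff \<rho> t) v = ?op (coeff \<rho>0 t) v + block_scale (\<rho> - \<rho>0) (?op (2 * \<i>, 0, 0, 0) v)" for \<rho> \<rho>0 t v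
    unfolding coeff_def by (rule transfer_op_shift)
  note hol = linear_ode_holomorphic[OF bounded_bilinear_transfer_op K(1) K' coeff_integrable norm_coeff_le _ P P0
      bounded_bilinear_block_scale transfer_op_block_scale shift]
  have bl: "bounded_linear (\<lambda>A :: complex^'m^'m. A $ i $ j)" for i j
    by (rule bounded_linear_compose[OF bounded_linear_vec_nth bounded_linear_vec_nth])
  have "(\<lambda>\<rho>. A \<rho> x $ i $ j) holomorphic_on UNIV" if "x \<ge> 0" for x i j
    unfolding A_def
  proof (rule hol[where \<phi> = "\<lambda>v. fst (fst v) $ i $ j"])
    show "bounded_linear (\<lambda>v. fst (fst v) $ i $ j :: complex)"
      by (intro bounded_linear_compose[OF bl] bounded_linear_compose[OF bounded_linear_fst] bounded_linear_fst)
    show "fst (fst (block_scale \<zeta> v)) $ i $ j = \<zeta> * fst (fst v) $ i $ j" for \<zeta> and v :: "((complex^'m^'m) \<times> (complex^'m^'m)) \<times> ((complex^'m^'m) \<times> (complex^'m^'m))"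
      by (cases v) (auto split: prod.splits)
  qed (use that in simp_all)
  moreover have "(\<lambda>\<rho>. E \<rho> x $ i $ j) holomorphic_on UNIV" if "x \<ge> 0" for x i j
    unfolding E_def
  proof (rule hol[where \<phi> = "\<lambda>v. snd (fst v) $ i $ j"])
    show "bounded_linear (\<lambda>v. snd (fst v) $ i $ j :: complex)"
      by (intro bounded_linear_compose[OF bl] bounded_linear_compose[OF bounded_linear_snd] bounded_linear_fst)
    show "snd (fst (block_scale \<zeta> v)) $ i $ j = \<zeta> * snd (fst v) $ i $ j" for \<zeta> and v :: "((complex^'m^'m) \<times> (complex^'m^'m)) \<times> ((complex^'m^'m) \<times> (complex^'m^'m))"
      by (cases v) (auto split: prod.splits)
  qed (use that in simp_all)
  moreover have "\<exists>C. \<forall>\<rho>. norm (A \<rho> x) \<le> C * exp (C * norm \<rho>) \<and> norm (E \<rho> x) \<le> C * exp (C * norm \<rho>)" if x: "x \<ge> 0" for x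
  proof -
    define I0 where "I0 = integral {0..x} (\<lambda>s. norm (coeff 0 s))"
    define C1 where "C1 = 2 * norm ?X0 * exp (2 * (K * I0))"
    define C2 where "C2 = 4 * K * x"
    have C12: "C1 \<ge> 0" "C2 \<ge> 0" using K x by (simp_all add: C1_def C2_def)
    have Pb: "norm (P \<rho> x) \<le> (C1 + C2) * exp ((C1 + C2) * norm \<rho>)" for \<rho>
    proof -
      have "norm (P \<rho> x) \<le> 2 * norm ?X0 * exp (2 * (K * (I0 + 2 * norm \<rho> * x)))"
        unfolding I0_def
        by (rule linear_ode_exponential_type[OF bounded_bilinear_transfer_op K(1) K' coeff_integrable norm_coeff_le _ P P0])
          (use x in auto)
      also have "\<dots> = C1 * exp (C2 * norm \<rho>)"
        by (simp add: C1_def C2_def exp_add[symmetric] algebra_simps)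
      also have "\<dots> \<le> (C1 + C2) * exp ((C1 + C2) * norm \<rho>)"
        using C12 by (intro mult_mono) (auto intro: mult_right_mono)
      finally show ?thesis .
    qed
    have "norm (A \<rho> x) \<le> (C1 + C2) * exp ((C1 + C2) * norm \<rho>)" for \<rho>
      by (rule order_trans[OF order_trans[OF norm_fst_le norm_fst_le] Pb[unfolded Peq]])
    moreover have "norm (E \<rho> x) \<le> (C1 + C2) * exp ((C1 + C2) * norm \<rho>)" for \<rho>
      by (rule order_trans[OF order_trans[OF norm_snd_le norm_fst_le] Pb[unfolded Peq]])
    ultimately show ?thesis by (intro exI[of _ "C1 + C2"]) simp
  qed
  moreover have "A \<rho> x ** Yt x + E \<rho> x ** Vt x = Y x"
    if Y: "L.system \<rho> Y V" and Yt: "T.system \<rho> Yt Vt" and init: "Yt 0 = Y 0" "Vt 0 = V 0 + k ** Y 0" and x: "x \<ge> 0"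
    for \<rho> Y V Yt Vt x
  proof -
    have p: "primitive (A \<rho>) (\<lambda>t. A \<rho> t ** Q1t t - Q1 t ** A \<rho> t + C \<rho> t + E \<rho> t ** T.q t)"
      "primitive (E \<rho>) (\<lambda>t. cscale (2 * \<i> * \<rho>) (E \<rho> t) - Q1 t ** E \<rho> t - E \<rho> t ** Q1t t + (D \<rho> t - A \<rho> t))"
      "primitive (C \<rho>) (\<lambda>t. Q1 t ** C \<rho> t + C \<rho> t ** Q1t t - cscale (2 * \<i> * \<rho>) (C \<rho> t) - L.q t ** A \<rho> t + D \<rho> t ** T.q t)"
      "primitive (D \<rho>) (\<lambda>t. Q1 t ** D \<rho> t - D \<rho> t ** Q1t t - L.q t ** E \<rho> t - C \<rho> t)"
      using primitive_fst[OF primitive_fst[OF P[of \<rho>]]] primitive_snd[OF primitive_fst[OF P[of \<rho>]]]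
        primitive_fst[OF primitive_snd[OF P[of \<rho>]]] primitive_snd[OF primitive_snd[OF P[of \<rho>]]]
      by (simp_all add: Peq coeff_def)
    have y: "primitive Yt (\<lambda>t. cscale (\<i> * \<rho>) (Yt t) - Q1t t ** Yt t + Vt t)"
      and v: "primitive Vt (\<lambda>t. Q1t t ** Vt t - cscale (\<i> * \<rho>) (Vt t) - T.q t ** Yt t)"
      using Yt by (auto simp: T.system_def)
    note bb = primitive_bilinear[OF mm.bounded_bilinear_axioms]
    have c: "cscale (2 * \<i> * \<rho>) X = cscale (\<i> * \<rho>) X + cscale (\<i> * \<rho>) X" for X :: "complex^'m^'m"
      by (simp add: cscale.add_left[symmetric] mult.assoc)
    \<comment> \<open>The coefficients of the second system cancel in the product rule, so the
      images solve the first system; uniqueness then identifies the first image with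
      \<open>Y\<close>.\<close>
    have sys: "L.system \<rho> (\<lambda>t. A \<rho> t ** Yt t + E \<rho> t ** Vt t) (\<lambda>t. C \<rho> t ** Yt t + D \<rho> t ** Vt t)"
      unfolding L.system_def
    proof
      show "primitive (\<lambda>t. A \<rho> t ** Yt t + E \<rho> t ** Vt t) (\<lambda>t. cscale (\<i> * \<rho>) (A \<rho> t ** Yt t + E \<rho> t ** Vt t) -
          Q1 t ** (A \<rho> t ** Yt t + E \<rho> t ** Vt t) + (C \<rho> t ** Yt t + D \<rho> t ** Vt t))"
        by (rule primitive_cong[OF primitive_add[OF bb[OF p(1) y] bb[OF p(2) v]]], simp_all only: matrix_algebra c) simp
      show "primitive (\<lambda>t. C \<rho> t ** Yt t + D \<rho> t ** Vt t) (\<lambda>t. Q1 t ** (C \<rho> t ** Yt t + D \<rho> t ** Vt t) -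
          cscale (\<i> * \<rho>) (C \<rho> t ** Yt t + D \<rho> t ** Vt t) - L.q t ** (A \<rho> t ** Yt t + E \<rho> t ** Vt t))"
        by (rule primitive_cong[OF primitive_add[OF bb[OF p(3) y] bb[OF p(4) v]]], simp_all only: matrix_algebra c) simp
    qed
    have "A \<rho> 0 = mat 1" "E \<rho> 0 = 0" "C \<rho> 0 = - k" "D \<rho> 0 = mat 1"
      by (simp_all add: A_def E_def C_def D_def P0)
    then show ?thesis
      by (intro L.system_unique[OF sys Y _ _ x]) (simp_all add: init matrix_algebra)
  qed
  ultimately show ?thesis by (intro exI[of _ A] exI[of _ E]) simp
qed

text \<open>\<open>A\<close> and \<open>E\<close> range over arbitrary matrices with the transfer
  property at the one point \<open>x\<close>, so that the reflected matrices are covered as well.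
  The property is tested on the decaying pair and on a growing pair, which after scaling gives the
  two equations of \<open>transfer_matrix_estimate\<close>.\<close>

lemma transfer_upper_estimate:
  assumes FL: "factored Q1 L.q Pm Pm' Pp Pp' B N" and FT: "factored Q1t T.q Pmt Pmt' Ppt Ppt' Bt Nt"
  shows "\<exists>K R. R > 0 \<and> (\<forall>\<rho> A E x z w zt wt. Im \<rho> \<ge> R \<longrightarrow> x \<ge> 0 \<longrightarrow>
     (\<forall>Y V Yt Vt. L.system \<rho> Y V \<longrightarrow> T.system \<rho> Yt Vt \<longrightarrow> Yt 0 = Y 0 \<longrightarrow> Vt 0 = V 0 + k ** Y 0 \<longrightarrow>
       A ** Yt x + E ** Vt x = Y x) \<longrightarrow>
     L.jost Pm C \<rho> z w \<longrightarrow> T.jost Pmt C \<rho> zt wt \<longrightarrow> wt 0 = w 0 + k \<longrightarrow>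
     norm A \<le> K \<and> norm E \<le> K / Im \<rho> \<and> norm (A - Pm x ** Pmt' x) \<le> K / Im \<rho>)"
proof -
  interpret FL: factored Q1 L.q Pm Pm' Pp Pp' B N by (rule FL)
  interpret FT: factored Q1t T.q Pmt Pmt' Ppt Ppt' Bt Nt by (rule FT)
  define n where "n = norm (mat 1 :: complex^'m^'m)"
  have n: "n \<ge> 0" by (simp add: n_def)
  define d where "d = Max {B, Bt, C, B ^ 3 * n, Bt ^ 3 * n, Bt ^ 4 * Nt * n}"
  have d: "B \<le> d" "Bt \<le> d" "C \<le> d" "B ^ 3 * n \<le> d" "Bt ^ 3 * n \<le> d" "Bt ^ 4 * Nt * n \<le> d"
    by (simp_all add: d_def)
  have d0: "d \<ge> 0" using FL.B_nonneg d(1) by linarith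
  define a0 where "a0 = 2 * (d * (2 * n + 1) + 4 * d ^ 3)"
  define e0 where "e0 = 2 * d + 2 * a0 * d\<^sup>2"
  have a0: "a0 \<ge> 0" and e0: "e0 \<ge> 0" using d0 n by (simp_all add: a0_def e0_def)
  define K where "K = a0 * d + e0 * d + (d\<^sup>2 + a0 * d + e0 * d\<^sup>2) * d"
  have Kt: "0 \<le> a0 * d" "0 \<le> e0 * d" "0 \<le> (d\<^sup>2 + a0 * d + e0 * d\<^sup>2) * d"
    using a0 e0 d0 by simp_all
  define R where "R = Max {1, 2 * d, 8 * d ^ 4, 2 * B ^ 4 * N, 2 * Bt ^ 4 * Nt}"
  have R: "1 \<le> R" "2 * d \<le> R" "8 * d ^ 4 \<le> R" "2 * B ^ 4 * N \<le> R" "2 * Bt ^ 4 * Nt \<le> R"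
    by (simp_all add: R_def)
  have main: "norm A \<le> K \<and> norm E \<le> K / Im \<rho> \<and> norm (A - Pm x ** Pmt' x) \<le> K / Im \<rho>"
    if \<rho>: "Im \<rho> \<ge> R" and x: "x \<ge> 0"
      and tr: "\<forall>Y V Yt Vt. L.system \<rho> Y V \<longrightarrow> T.system \<rho> Yt Vt \<longrightarrow> Yt 0 = Y 0 \<longrightarrow> Vt 0 = V 0 + k ** Y 0 \<longrightarrow>
       A ** Yt x + E ** Vt x = Y x"
      and J: "L.jost Pm C \<rho> z w" and Jt: "T.jost Pmt C \<rho> zt wt" and k: "wt 0 = w 0 + k"
    for \<rho> A E x z w zt wt
  proof -
    define \<tau> where "\<tau> = Im \<rho>"
    have \<tau>: "\<tau> > 0" "\<tau> \<ge> 2 * d" "\<tau> \<ge> 8 * d ^ 4" "\<tau> \<ge> 1" "\<tau> \<ge> 2 * B ^ 4 * N" "\<tau> \<ge> 2 * Bt ^ 4 * Nt"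
      using \<rho> R by (auto simp: \<tau>_def)
    have im: "Im \<rho> \<ge> \<tau>" by (simp add: \<tau>_def)
    let ?e = "\<lambda>t::real. exp (\<i> * \<rho> * of_real t)"
    have sJ: "L.system \<rho> (\<lambda>t. cscale (?e t) (Pm t ** z t)) (\<lambda>t. cscale (?e t) (w t))"
      using J by (intro L.system_unscaled) (auto simp: L.jost_def)
    have sJt: "T.system \<rho> (\<lambda>t. cscale (?e t) (Pmt t ** zt t)) (\<lambda>t. cscale (?e t) (wt t))"
      using Jt by (intro T.system_unscaled) (auto simp: T.jost_def)
    have z0: "z 0 = mat 1" "zt 0 = mat 1" using J Jt by (auto simp: L.jost_def T.jost_def)
    have "A ** cscale (?e x) (Pmt x ** zt x) + E ** cscale (?e x) (wt x) = cscale (?e x) (Pm x ** z x)"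
      using tr[THEN spec, THEN spec, THEN spec, THEN spec, THEN mp, OF sJ, THEN mp, OF sJt]
      by (simp add: z0 k cscale_one FL.init FT.init)
    then have "cscale (exp (- (\<i> * \<rho> * of_real x))) (cscale (?e x) (A ** (Pmt x ** zt x) + E ** wt x)) =
        cscale (exp (- (\<i> * \<rho> * of_real x))) (cscale (?e x) (Pm x ** z x))"
      by (simp only: cscale_mult_right cscale.add_right)
    then have eqJ: "A ** (Pmt x ** zt x) + E ** wt x = Pm x ** z x"
      by (simp only: cscale_cscale exp_add[symmetric]) (simp add: cscale_one)
    \<comment> \<open>The growing pair starts from \<open>Y 0 = 0\<close>, so the term
      \<open>k ** Y 0\<close> vanishes and both solutions have the same initial values.\<close>
    obtain Y V where YV: "L.system \<rho> Y V" "Y 0 = 0" "V 0 = mat 1"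
      using L.system_exists by blast
    obtain Yt Vt where YVt: "T.system \<rho> Yt Vt" "Yt 0 = 0" "Vt 0 = mat 1"
      using T.system_exists by blast
    have eqG0: "A ** Yt x + E ** Vt x = Y x"
      using tr[THEN spec, THEN spec, THEN spec, THEN spec, THEN mp, OF YV(1), THEN mp, OF YVt(1)] YV YVt by simp
    have two: "\<i> * \<rho> + \<i> * \<rho> = 2 * \<i> * \<rho>" "\<i> * \<rho> - \<i> * \<rho> = 0" by simp_all
    have gL: "primitive (\<lambda>t. cscale (?e t) (Y t)) (\<lambda>t. cscale (2 * \<i> * \<rho>) (cscale (?e t) (Y t)) - Q1 t ** cscale (?e t) (Y t) + cscale (?e t) (V t))"
      "primitive (\<lambda>t. cscale (?e t) (V t)) (\<lambda>t. Q1 t ** cscale (?e t) (V t) - L.q t ** cscale (?e t) (Y t))"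
      using L.system_scaled[OF YV(1), of "\<i> * \<rho>"] unfolding two by (simp_all only: cscale.zero_left diff_0_right)
    have gT: "primitive (\<lambda>t. cscale (?e t) (Yt t)) (\<lambda>t. cscale (2 * \<i> * \<rho>) (cscale (?e t) (Yt t)) - Q1t t ** cscale (?e t) (Yt t) + cscale (?e t) (Vt t))"
      "primitive (\<lambda>t. cscale (?e t) (Vt t)) (\<lambda>t. Q1t t ** cscale (?e t) (Vt t) - T.q t ** cscale (?e t) (Yt t))"
      using T.system_scaled[OF YVt(1), of "\<i> * \<rho>"] unfolding two by (simp_all only: cscale.zero_left diff_0_right)
    have Y0: "cscale (?e 0) (Y 0) = 0" "cscale (?e 0) (V 0) = mat 1" "cscale (?e 0) (Yt 0) = 0" "cscale (?e 0) (Vt 0) = mat 1"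
      using YV YVt by (simp_all add: cscale_one cscale.zero_right)
    have bL: "norm (cscale (?e x) (Y x)) \<le> B ^ 3 * n / \<tau>"
      unfolding n_def
      by (rule FL.growing_solution_bounds(1)[OF im \<tau>(1) \<tau>(5) gL(1) Y0(1) gL(2) Y0(2) x])
    have bT: "norm (cscale (?e x) (Yt x)) \<le> Bt ^ 3 * n / \<tau>" "norm (Ppt' x ** cscale (?e x) (Vt x) - mat 1) \<le> Bt ^ 4 * Nt * n / \<tau>"
      unfolding n_def
      by (rule FT.growing_solution_bounds[OF im \<tau>(1) \<tau>(6) gT(1) Y0(3) gT(2) Y0(4) x])+
    have "Ppt x ** (Ppt' x ** cscale (?e x) (Vt x)) = cscale (?e x) (Vt x)"
      using x by (simp add: matrix_mul_assoc FT.inv)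
    then have eqG: "A ** cscale (?e x) (Yt x) + E ** (Ppt x ** (Ppt' x ** cscale (?e x) (Vt x))) = cscale (?e x) (Y x)"
      by (simp add: cscale_mult_right cscale.add_right[symmetric] eqG0)
    have le\<tau>: "u / \<tau> \<le> d / \<tau>" if "u \<le> d" for u using that \<tau>(1) by (intro divide_right_mono) auto
    have Jb: "norm (z x - mat 1) \<le> d / \<tau>" "norm (zt x - mat 1) \<le> d / \<tau>" "norm (wt x) \<le> d"
      using J Jt x le\<tau>[OF d(3)] d(3) unfolding L.jost_def T.jost_def \<tau>_def by (auto intro: order_trans)
    note est = transfer_matrix_estimate[OF \<tau>(1-4) order_trans[OF FL.bound(1)[OF x] d(1)] order_trans[OF FT.bound(1)[OF x] d(2)]
        order_trans[OF FT.bound(2)[OF x] d(2)] order_trans[OF FT.bound(3)[OF x] d(2)] order_trans[OF FT.bound(4)[OF x] d(2)]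
        FT.inv(1)[OF x] FT.inv(3)[OF x] Jb order_trans[OF bL le\<tau>[OF d(4)]] order_trans[OF bT(1) le\<tau>[OF d(5)]]
        order_trans[OF bT(2) le\<tau>[OF d(6)]] eqJ eqG, folded n_def, folded a0_def, folded e0_def]
    have "norm A \<le> K" using est(1) Kt by (simp add: K_def)
    moreover have "e0 * d / \<tau> \<le> K / \<tau>" "(d\<^sup>2 + a0 * d + e0 * d\<^sup>2) * d / \<tau> \<le> K / \<tau>"
      using \<tau>(1) Kt by (auto intro!: divide_right_mono simp: K_def)
    ultimately show ?thesis using est(2,3) unfolding \<tau>_def by linarith
  qed
  have "R > 0" using R(1) by simp
  show ?thesis
    by (rule exI[of _ K], rule exI[of _ R], rule conjI[OF \<open>R > 0\<close>], intro allI impI, rule main)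
qed

end

section \<open>Comparison of the Weyl matrices\<close>

lemma norm_le_div_imp_zero:
  fixes u :: "'a::real_normed_vector"
  assumes "\<And>\<tau>. \<tau> \<ge> R \<Longrightarrow> norm u \<le> K / \<tau>"
  shows "u = 0"
proof (rule ccontr)
  assume "u \<noteq> 0"
  then have u: "norm u > 0" by simp
  define \<tau> where "\<tau> = max (max R 1) (2 * \<bar>K\<bar> / norm u)"
  have \<tau>: "\<tau> \<ge> R" "\<tau> \<ge> 1" "\<tau> \<ge> 2 * \<bar>K\<bar> / norm u" by (simp_all add: \<tau>_def)
  have "2 * \<bar>K\<bar> \<le> \<tau> * norm u" using \<tau>(3) u by (simp add: divide_le_eq)
  moreover have "norm u * \<tau> \<le> K" using assms[OF \<tau>(1)] \<tau>(2) by (simp add: le_divide_eq)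
  moreover have "\<tau> * norm u > 0" using u \<tau>(2) by simp
  ultimately show False by (simp add: mult.commute abs_if split: if_splits)
qed

context two_pencils
begin

text \<open>Both boundary values invert the common Weyl matrix, hence they coincide for large Im
  \<rho>. Divided by \<rho>, only h1 and h1t survive in the limit along the imaginary axis. With
  these removed, the two values \<open>w 0\<close> differ by a matrix free of \<rho>, which makes a
  transfer matrix with fixed initial value possible.\<close>

lemma weyl_matrix_comparison:
  assumes FL: "factored Q1 L.q Pm Pm' Pp Pp' B N" and FT: "factored Q1t T.q Pmt Pmt' Ppt Ppt' Bt Nt"
    and det: "det (mat 1 + h1) \<noteq> 0" "det (mat 1 + h1t) \<noteq> 0"
    and eq: "\<forall>\<rho> \<in> weyl_domain Q0 Q1 h0 h1 \<inter> weyl_domain Q0t Q1t h0t h1t.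
           weyl_matrix Q0 Q1 h0 h1 \<rho> = weyl_matrix Q0t Q1t h0t h1t \<rho>"
  shows "\<exists>C R. R > 0 \<and> h1 = h1t \<and> (\<forall>\<rho>. Im \<rho> \<ge> R \<longrightarrow> (\<exists>z w zt wt. L.jost Pm C \<rho> z w \<and> T.jost Pmt C \<rho> zt wt \<and>
     wt 0 = w 0 + (h0 - Q1 0 - (h0t - Q1t 0))))"
proof -
  obtain C1 R1 where 1: "R1 > 0" "\<forall>\<rho>. Im \<rho> \<ge> R1 \<longrightarrow> \<rho> \<in> weyl_domain Q0 Q1 h0 h1 \<and>
     (\<exists>z w. L.jost Pm C1 \<rho> z w \<and>
       weyl_matrix Q0 Q1 h0 h1 \<rho> ** (cscale (\<i> * \<rho>) (mat 1 + h1) + (w 0 - Q1 0 + h0)) = mat 1)"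
    using L.weyl_matrix_upper[OF FL det(1), of h0] by (elim exE conjE)
  obtain C2 R2 where 2: "R2 > 0" "\<forall>\<rho>. Im \<rho> \<ge> R2 \<longrightarrow> \<rho> \<in> weyl_domain Q0t Q1t h0t h1t \<and>
     (\<exists>z w. T.jost Pmt C2 \<rho> z w \<and>
       weyl_matrix Q0t Q1t h0t h1t \<rho> ** (cscale (\<i> * \<rho>) (mat 1 + h1t) + (w 0 - Q1t 0 + h0t)) = mat 1)"
    using T.weyl_matrix_upper[OF FT det(2), of h0t] by (elim exE conjE)
  define C where "C = max C1 C2"
  define R where "R = max R1 R2"
  have main: "\<exists>z w zt wt. L.jost Pm C \<rho> z w \<and> T.jost Pmt C \<rho> zt wt \<and>
      cscale (\<i> * \<rho>) (mat 1 + h1) + (w 0 - Q1 0 + h0) = cscale (\<i> * \<rho>) (mat 1 + h1t) + (wt 0 - Q1t 0 + h0t)"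
    if \<rho>: "Im \<rho> \<ge> R" for \<rho>
  proof -
    have \<rho>12: "Im \<rho> \<ge> R1" "Im \<rho> \<ge> R2" "Im \<rho> > 0" using \<rho> 1(1) by (auto simp: R_def)
    obtain z w where zw: "L.jost Pm C1 \<rho> z w"
       "weyl_matrix Q0 Q1 h0 h1 \<rho> ** (cscale (\<i> * \<rho>) (mat 1 + h1) + (w 0 - Q1 0 + h0)) = mat 1"
      using 1(2)[THEN spec, THEN mp, OF \<rho>12(1), THEN conjunct2] by (elim exE conjE)
    obtain zt wt where zwt: "T.jost Pmt C2 \<rho> zt wt"
       "weyl_matrix Q0t Q1t h0t h1t \<rho> ** (cscale (\<i> * \<rho>) (mat 1 + h1t) + (wt 0 - Q1t 0 + h0t)) = mat 1"
      using 2(2)[THEN spec, THEN mp, OF \<rho>12(2), THEN conjunct2] by (elim exE conjE)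
    define M where "M = weyl_matrix Q0 Q1 h0 h1 \<rho>"
    define D where "D = cscale (\<i> * \<rho>) (mat 1 + h1) + (w 0 - Q1 0 + h0)"
    define Dt where "Dt = cscale (\<i> * \<rho>) (mat 1 + h1t) + (wt 0 - Q1t 0 + h0t)"
    have "weyl_matrix Q0t Q1t h0t h1t \<rho> = M"
      unfolding M_def
      using bspec[OF eq IntI[OF 1(2)[THEN spec, THEN mp, OF \<rho>12(1), THEN conjunct1] 2(2)[THEN spec, THEN mp, OF \<rho>12(2), THEN conjunct1]]] ..
    then have MD: "M ** D = mat 1" "M ** Dt = mat 1"
      using zw(2) zwt(2) by (simp_all only: M_def D_def Dt_def)
    then have "D ** M = mat 1" by (simp add: matrix_left_right_inverse)
    then have "Dt = D ** (M ** Dt)" by (simp add: matrix_mul_assoc)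
    then have DDt: "D = Dt" using MD(2) by simp
    show ?thesis
      by (rule exI[of _ z], rule exI[of _ w], rule exI[of _ zt], rule exI[of _ wt])
        (intro conjI L.jost_mono[OF zw(1) _ \<rho>12(3)] T.jost_mono[OF zwt(1) _ \<rho>12(3)] DDt[unfolded D_def Dt_def];
          simp add: C_def)
  qed
  have h1: "h1 = h1t"
  proof -
    define S where "S = (C + norm (Q1t 0) + norm h0t) + (C + norm (Q1 0) + norm h0)"
    have "norm (h1 - h1t) \<le> S / \<tau>" if \<tau>: "\<tau> \<ge> max R 1" for \<tau>
    proof -
      define \<rho> where "\<rho> = \<i> * of_real \<tau>"
      have im: "Im \<rho> \<ge> R" "norm \<rho> = \<tau>" using \<tau> by (simp_all add: \<rho>_def norm_mult)
      obtain z w zt wt where J: "L.jost Pm C \<rho> z w" "T.jost Pmt C \<rho> zt wt"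
        and e: "cscale (\<i> * \<rho>) (mat 1 + h1) + (w 0 - Q1 0 + h0) = cscale (\<i> * \<rho>) (mat 1 + h1t) + (wt 0 - Q1t 0 + h0t)"
        using main[OF im(1)] by (elim exE conjE)
      have w: "norm (w 0) \<le> C" "norm (wt 0) \<le> C"
        using J by (simp_all add: L.jost_def T.jost_def)
      have "cscale (\<i> * \<rho>) (h1 - h1t) = (wt 0 - Q1t 0 + h0t) - (w 0 - Q1 0 + h0)"
        using e by (simp add: cscale.add_right cscale.diff_right algebra_simps)
      then have "norm (\<i> * \<rho>) * norm (h1 - h1t) \<le> norm (wt 0 - Q1t 0 + h0t) + norm (w 0 - Q1 0 + h0)"
        using norm_triangle_ineq4[of "wt 0 - Q1t 0 + h0t" "w 0 - Q1 0 + h0"] by (simp flip: norm_cscale)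
      also have "\<dots> \<le> (norm (wt 0) + norm (Q1t 0) + norm h0t) + (norm (w 0) + norm (Q1 0) + norm h0)"
        by (intro add_mono order_trans[OF norm_triangle_ineq] norm_triangle_ineq4 order_refl)
      also have "\<dots> \<le> S" using w by (simp add: S_def)
      finally have "\<tau> * norm (h1 - h1t) \<le> S" by (simp add: norm_mult im)
      then show ?thesis using \<tau> by (simp add: le_divide_eq mult.commute)
    qed
    then have "h1 - h1t = 0" by (rule norm_le_div_imp_zero)
    then show ?thesis by simp
  qed
  have "\<exists>z w zt wt. L.jost Pm C \<rho> z w \<and> T.jost Pmt C \<rho> zt wt \<and> wt 0 = w 0 + (h0 - Q1 0 - (h0t - Q1t 0))"
    if \<rho>: "Im \<rho> \<ge> R" for \<rho>
  proof -
    obtain z w zt wt where J: "L.jost Pm C \<rho> z w" "T.jost Pmt C \<rho> zt wt"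
      and e: "cscale (\<i> * \<rho>) (mat 1 + h1) + (w 0 - Q1 0 + h0) = cscale (\<i> * \<rho>) (mat 1 + h1t) + (wt 0 - Q1t 0 + h0t)"
      using main[OF \<rho>] by (elim exE conjE)
    have "w 0 - Q1 0 + h0 = wt 0 - Q1t 0 + h0t" using e unfolding h1 by simp
    then have "wt 0 = w 0 + (h0 - Q1 0 - (h0t - Q1t 0))" by (simp add: algebra_simps)
    then show ?thesis
      by (intro exI conjI) (rule J)+
  qed
  note jost = this
  have "R > 0" using 1(1) by (simp add: R_def)
  show ?thesis
    by (rule exI[of _ C], rule exI[of _ R], intro conjI[OF \<open>R > 0\<close>] conjI[OF h1] allI impI, rule jost)
qed

end

section \<open>Combination of the two half-planes and recovery of the coefficients\<close>

theorem theorem2: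
  fixes Q0 Q1 Q0t Q1t :: "real \<Rightarrow> complex^'m::finite^'m"
    and h0 h1 h0t h1t :: "complex^'m^'m"
  assumes "class_V Q0 Q1" and "class_V Q0t Q1t"
    and "det (mat 1 + h1) \<noteq> 0" and "det (mat 1 - h1) \<noteq> 0"
    and "det (mat 1 + h1t) \<noteq> 0" and "det (mat 1 - h1t) \<noteq> 0"
    and "\<forall>\<rho> \<in> weyl_domain Q0 Q1 h0 h1 \<inter> weyl_domain Q0t Q1t h0t h1t.
           weyl_matrix Q0 Q1 h0 h1 \<rho> = weyl_matrix Q0t Q1t h0t h1t \<rho>"
  shows "(\<forall>x>0. Q1 x = Q1t x) \<and> (AE x in lebesgue. x > 0 \<longrightarrow> Q0 x = Q0t x) \<and>
         h0 = h0t \<and> h1 = h1t"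
proof -
  obtain Q1' where V: "primitive Q1 Q1'" "Q0 absolutely_integrable_on {0..}" "Q1 absolutely_integrable_on {0..}"
     "Q1' absolutely_integrable_on {0..}" using class_V_primitive[OF assms(1)] by (elim exE conjE)
  obtain Q1t' where Vt: "primitive Q1t Q1t'" "Q0t absolutely_integrable_on {0..}" "Q1t absolutely_integrable_on {0..}"
     "Q1t' absolutely_integrable_on {0..}" using class_V_primitive[OF assms(2)] by (elim exE conjE)
  interpret U: two_pencils Q0 Q1 Q1' Q0t Q1t Q1t' by unfold_locales (fact V Vt)+
  interpret D: two_pencils Q0 "\<lambda>x. - Q1 x" "\<lambda>x. - Q1' x" Q0t "\<lambda>x. - Q1t x" "\<lambda>x. - Q1t' x"
    unfolding two_pencils_def by (rule conjI[OF U.L.uminus_system U.T.uminus_system])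
  obtain Pm Pm' Pp Pp' B N where FL: "factored Q1 U.L.q Pm Pm' Pp Pp' B N"
    using U.L.factored_exists by (elim exE)
  obtain Pmt Pmt' Ppt Ppt' Bt Nt where FT: "factored Q1t U.T.q Pmt Pmt' Ppt Ppt' Bt Nt"
    using U.T.factored_exists by (elim exE)
  obtain Sm Sm' Sp Sp' B2 N2 where GL: "factored (\<lambda>x. - Q1 x) D.L.q Sm Sm' Sp Sp' B2 N2"
    using D.L.factored_exists by (elim exE)
  obtain Smt Smt' Spt Spt' B2t N2t where GT: "factored (\<lambda>x. - Q1t x) D.T.q Smt Smt' Spt Spt' B2t N2t"
    using D.T.factored_exists by (elim exE)
  interpret FL: factored Q1 U.L.q Pm Pm' Pp Pp' B N by (rule FL)
  interpret FT: factored Q1t U.T.q Pmt Pmt' Ppt Ppt' Bt Nt by (rule FT)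
  interpret GL: factored "\<lambda>x. - Q1 x" D.L.q Sm Sm' Sp Sp' B2 N2 by (rule GL)
  interpret GT: factored "\<lambda>x. - Q1t x" D.T.q Smt Smt' Spt Spt' B2t N2t by (rule GT)
  define k where "k = h0 - Q1 0 - (h0t - Q1t 0)"
  define k2 where "k2 = h0 - - Q1 0 - (h0t - - Q1t 0)"
  \<comment> \<open>\<open>k\<close> and \<open>k2\<close> are the initial differences of the second
    components for the original and the reflected pencils. They differ by the \<open>Q1\<close> part
    of the shift in \<open>system_uminus\<close> at 0.\<close>
  have kk2: "k = k2 + (2 *\<^sub>R Q1t 0 - 2 *\<^sub>R Q1 0)"
    unfolding k_def k2_def scaleR_2 by (simp add: algebra_simps)
  obtain C R1 where h1: "h1 = h1t" and J: "\<forall>\<rho>. Im \<rho> \<ge> R1 \<longrightarrow> (\<exists>z w zt wt. U.L.jost Pm C \<rho> z w \<and> U.T.jost Pmt C \<rho> zt wt \<and>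
     wt 0 = w 0 + k)"
    using U.weyl_matrix_comparison[OF FL FT assms(3,5,7)] unfolding k_def by (elim exE conjE)
  have neg: "\<forall>\<rho> \<in> weyl_domain Q0 (\<lambda>x. - Q1 x) h0 (- h1) \<inter> weyl_domain Q0t (\<lambda>x. - Q1t x) h0t (- h1t).
           weyl_matrix Q0 (\<lambda>x. - Q1 x) h0 (- h1) \<rho> = weyl_matrix Q0t (\<lambda>x. - Q1t x) h0t (- h1t) \<rho>"
  proof
    fix \<rho> assume \<rho>: "\<rho> \<in> weyl_domain Q0 (\<lambda>x. - Q1 x) h0 (- h1) \<inter> weyl_domain Q0t (\<lambda>x. - Q1t x) h0t (- h1t)"
    then have "- \<rho> \<in> weyl_domain Q0 Q1 h0 h1 \<inter> weyl_domain Q0t Q1t h0t h1t"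
      using weyl_domain_uminus[of "- \<rho>" Q0 Q1 h0 h1] weyl_domain_uminus[of "- \<rho>" Q0t Q1t h0t h1t] by simp
    from bspec[OF assms(7) this] show "weyl_matrix Q0 (\<lambda>x. - Q1 x) h0 (- h1) \<rho> = weyl_matrix Q0t (\<lambda>x. - Q1t x) h0t (- h1t) \<rho>"
      using weyl_matrix_uminus[of Q0 Q1 h0 h1 "- \<rho>"] weyl_matrix_uminus[of Q0t Q1t h0t h1t "- \<rho>"] by simp
  qed
  have det: "det (mat 1 + - h1) \<noteq> 0" "det (mat 1 + - h1t) \<noteq> 0" using assms(4,6) by simp_all
  obtain C2 R2 where J2: "\<forall>\<rho>. Im \<rho> \<ge> R2 \<longrightarrow> (\<exists>z w zt wt. D.L.jost Sm C2 \<rho> z w \<and> D.T.jost Smt C2 \<rho> zt wt \<and>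
     wt 0 = w 0 + k2)"
    using D.weyl_matrix_comparison[OF GL GT det neg] unfolding k2_def by (elim exE conjE)
  obtain K R3 where est: "\<forall>\<rho> A E x z w zt wt. Im \<rho> \<ge> R3 \<longrightarrow> x \<ge> 0 \<longrightarrow>
     (\<forall>Y V Yt Vt. U.L.system \<rho> Y V \<longrightarrow> U.T.system \<rho> Yt Vt \<longrightarrow> Yt 0 = Y 0 \<longrightarrow> Vt 0 = V 0 + k ** Y 0 \<longrightarrow>
       A ** Yt x + E ** Vt x = Y x) \<longrightarrow>
     U.L.jost Pm C \<rho> z w \<longrightarrow> U.T.jost Pmt C \<rho> zt wt \<longrightarrow> wt 0 = w 0 + k \<longrightarrow>
     norm A \<le> K \<and> norm E \<le> K / Im \<rho> \<and> norm (A - Pm x ** Pmt' x) \<le> K / Im \<rho>"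
    using U.transfer_upper_estimate[OF FL FT, of k C] by (elim exE conjE)
  obtain K2 R4 where est2: "\<forall>\<rho> A E x z w zt wt. Im \<rho> \<ge> R4 \<longrightarrow> x \<ge> 0 \<longrightarrow>
     (\<forall>Y V Yt Vt. D.L.system \<rho> Y V \<longrightarrow> D.T.system \<rho> Yt Vt \<longrightarrow> Yt 0 = Y 0 \<longrightarrow> Vt 0 = V 0 + k2 ** Y 0 \<longrightarrow>
       A ** Yt x + E ** Vt x = Y x) \<longrightarrow>
     D.L.jost Sm C2 \<rho> z w \<longrightarrow> D.T.jost Smt C2 \<rho> zt wt \<longrightarrow> wt 0 = w 0 + k2 \<longrightarrow>
     norm A \<le> K2 \<and> norm E \<le> K2 / Im \<rho> \<and> norm (A - Sm x ** Smt' x) \<le> K2 / Im \<rho>"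
    using D.transfer_upper_estimate[OF GL GT, of k2 C2] by (elim exE conjE)
  \<comment> \<open>One pair \<open>A\<close>, \<open>E\<close> serves both half-planes; since its
    entries are entire, the two sets of bounds can be combined.\<close>
  obtain A E :: "complex \<Rightarrow> real \<Rightarrow> complex^'m^'m" where
    hol: "\<forall>x\<ge>0. \<forall>i j. (\<lambda>\<rho>. A \<rho> x $ i $ j) holomorphic_on UNIV \<and> (\<lambda>\<rho>. E \<rho> x $ i $ j) holomorphic_on UNIV"
    and exp_type: "\<forall>x\<ge>0. \<exists>C. \<forall>\<rho>. norm (A \<rho> x) \<le> C * exp (C * norm \<rho>) \<and> norm (E \<rho> x) \<le> C * exp (C * norm \<rho>)"
    and transfer: "\<forall>\<rho> Y V Yt Vt x. U.L.system \<rho> Y V \<longrightarrow> U.T.system \<rho> Yt Vt \<longrightarrow> Yt 0 = Y 0 \<longrightarrow> Vt 0 = V 0 + k ** Y 0 \<longrightarrow> x \<ge> 0 \<longrightarrow>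
       A \<rho> x ** Yt x + E \<rho> x ** Vt x = Y x"
    using U.transfer_exists[of k] by (elim exE conjE)
  define R where "R = Max {1, R1, R2, R3, R4}"
  have R: "1 \<le> R" "R1 \<le> R" "R2 \<le> R" "R3 \<le> R" "R4 \<le> R" by (simp_all add: R_def)
  have upper: "norm (A \<rho> x) \<le> K" "norm (E \<rho> x) \<le> K / Im \<rho>" "norm (A \<rho> x - Pm x ** Pmt' x) \<le> K / Im \<rho>"
    if \<rho>: "Im \<rho> \<ge> R" and x: "x \<ge> 0" for \<rho> x
  proof -
    have im: "Im \<rho> \<ge> R1" "Im \<rho> \<ge> R3" using \<rho> R by linarith+
    obtain z w zt wt where j: "U.L.jost Pm C \<rho> z w" "U.T.jost Pmt C \<rho> zt wt" "wt 0 = w 0 + k"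
      using J[THEN spec, THEN mp, OF im(1)] by (elim exE conjE)
    have "norm (A \<rho> x) \<le> K \<and> norm (E \<rho> x) \<le> K / Im \<rho> \<and> norm (A \<rho> x - Pm x ** Pmt' x) \<le> K / Im \<rho>"
      by (rule est[rule_format, OF im(2) x _ j]) (rule transfer[rule_format, OF _ _ _ _ x])
    then show "norm (A \<rho> x) \<le> K" "norm (E \<rho> x) \<le> K / Im \<rho>" "norm (A \<rho> x - Pm x ** Pmt' x) \<le> K / Im \<rho>" by simp_all
  qed
  \<comment> \<open>The reflected systems use \<open>Y' + \<i> \<rho> Y - Q\<^sub>1 Y\<close> in place of \<open>V\<close>: \<open>E\<close> is unchanged, \<open>A\<close> becomes \<open>A2\<close>.\<close>
  define A2 where "A2 \<rho> x = A \<rho> x + E \<rho> x ** (2 *\<^sub>R Q1t x - cscale (2 * \<i> * \<rho>) (mat 1))" for \<rho> x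
  have lower: "norm (A2 \<rho> x) \<le> K2" "norm (E \<rho> x) \<le> K2 / Im (- \<rho>)" "norm (A2 \<rho> x - Sm x ** Smt' x) \<le> K2 / Im (- \<rho>)"
    if \<rho>: "Im (- \<rho>) \<ge> R" and x: "x \<ge> 0" for \<rho> x
  proof -
    have im: "Im (- \<rho>) \<ge> R2" "Im (- \<rho>) \<ge> R4" using \<rho> R by linarith+
    obtain z w zt wt where j: "D.L.jost Sm C2 (- \<rho>) z w" "D.T.jost Smt C2 (- \<rho>) zt wt" "wt 0 = w 0 + k2"
      using J2[THEN spec, THEN mp, OF im(1)] by (elim exE conjE)
    have tr: "A2 \<rho> x ** Yt x + E \<rho> x ** Vt x = Y x"
      if Y: "D.L.system (- \<rho>) Y V" and Yt: "D.T.system (- \<rho>) Yt Vt" and init: "Yt 0 = Y 0" "Vt 0 = V 0 + k2 ** Y 0" for Y V Yt Vt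
    proof -
      obtain V' where V': "U.L.system \<rho> Y V'" "\<forall>x\<ge>0. V' x = V x + (2 *\<^sub>R Q1 x - cscale (2 * \<i> * \<rho>) (mat 1)) ** Y x"
        using U.L.system_uminus[OF Y] by (elim exE conjE)
      obtain Vt' where Vt': "U.T.system \<rho> Yt Vt'" "\<forall>x\<ge>0. Vt' x = Vt x + (2 *\<^sub>R Q1t x - cscale (2 * \<i> * \<rho>) (mat 1)) ** Yt x"
        using U.T.system_uminus[OF Yt] by (elim exE conjE)
      \<comment> \<open>The parts of the two shifts that contain \<rho> cancel because
        \<open>Yt 0 = Y 0\<close>; the remaining parts are accounted for by
        \<open>kk2\<close>.\<close>
      have "Vt' 0 = V' 0 + k ** Y 0"
        using V'(2)[THEN spec, of 0] Vt'(2)[THEN spec, of 0] init by (simp add: kk2 mm.add_left mm.diff_left)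
      with transfer[rule_format, OF V'(1) Vt'(1) init(1) _ x] have "A \<rho> x ** Yt x + E \<rho> x ** Vt' x = Y x" by simp
      then show ?thesis
        using Vt'(2)[THEN spec, THEN mp, OF x] by (simp add: A2_def mm.add_left mm.add_right matrix_mul_assoc algebra_simps)
    qed
    have "norm (A2 \<rho> x) \<le> K2 \<and> norm (E \<rho> x) \<le> K2 / Im (- \<rho>) \<and> norm (A2 \<rho> x - Sm x ** Smt' x) \<le> K2 / Im (- \<rho>)"
      by (rule est2[rule_format, OF im(2) x _ j]) (rule tr)
    then show "norm (A2 \<rho> x) \<le> K2" "norm (E \<rho> x) \<le> K2 / Im (- \<rho>)" "norm (A2 \<rho> x - Sm x ** Smt' x) \<le> K2 / Im (- \<rho>)" by simp_all
  qed
  have nth: "norm (M $ i $ j) \<le> norm M" for M :: "complex^'m^'m" and i j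
    by (rule order_trans[OF Finite_Cartesian_Product.norm_nth_le Finite_Cartesian_Product.norm_nth_le])
  have E0: "E \<rho> x = 0" if x: "x \<ge> 0" for \<rho> x
  proof -
    obtain Ce where Ce: "\<forall>\<rho>. norm (A \<rho> x) \<le> Ce * exp (Ce * norm \<rho>) \<and> norm (E \<rho> x) \<le> Ce * exp (Ce * norm \<rho>)"
      using exp_type[THEN spec, THEN mp, OF x] by (elim exE)
    have "E \<rho> x $ i $ j = 0" for i j
    proof (rule norm_le_div_imp_zero)
      fix \<tau> assume \<tau>: "\<tau> \<ge> R"
      \<comment> \<open>Constancy permits comparison with the value at height \<tau> on the
        imaginary axis, where the bound tends to 0.\<close>
      have "E \<rho> x $ i $ j = E (\<i> * of_real \<tau>) x $ i $ j"
      proof (rule entire_bounded_off_strip_const[where f = "\<lambda>\<rho>. E \<rho> x $ i $ j" and R = R and M = "\<bar>K\<bar> + \<bar>K2\<bar>"])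
        show "(\<lambda>\<rho>. E \<rho> x $ i $ j) holomorphic_on UNIV" using hol x by simp
        show "norm (E z x $ i $ j) \<le> Ce * exp (Ce * norm z)" for z
          using Ce order_trans[OF nth] by simp
        fix z assume z: "\<bar>Im z\<bar> \<ge> R"
        have le: "u / s \<le> \<bar>K\<bar> + \<bar>K2\<bar>" if "s \<ge> 1" "\<bar>u\<bar> \<le> \<bar>K\<bar> + \<bar>K2\<bar>" for u s :: real
        proof -
          have "u \<le> (\<bar>K\<bar> + \<bar>K2\<bar>) * 1" using that by simp
          also have "\<dots> \<le> (\<bar>K\<bar> + \<bar>K2\<bar>) * s" using that by (intro mult_left_mono) auto
          finally show ?thesis using that by (simp add: divide_le_eq)
        qed
        have "norm (E z x) \<le> \<bar>K\<bar> + \<bar>K2\<bar>"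
        proof (cases "Im z \<ge> 0")
          case True
          then have "Im z \<ge> R" using z by simp
          from upper(2)[OF this x] show ?thesis
            using le[of "Im z" K] \<open>Im z \<ge> R\<close> R(1) by simp
        next
          case False
          then have "Im (- z) \<ge> R" using z by simp
          from lower(2)[OF this x] show ?thesis
            using le[of "Im (- z)" K2] \<open>Im (- z) \<ge> R\<close> R(1) by simp
        qed
        then show "norm (E z x $ i $ j) \<le> \<bar>K\<bar> + \<bar>K2\<bar>" using nth order_trans by blast
      qed
      also have "norm (E (\<i> * of_real \<tau>) x $ i $ j) \<le> K / \<tau>"
        using upper(2)[of "\<i> * of_real \<tau>" x] \<tau> x order_trans[OF nth] by simp
      finally show "norm (E \<rho> x $ i $ j) \<le> K / \<tau>" .
    qed
    then show ?thesis by (simp add: vec_eq_iff)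
  qed
  \<comment> \<open>As long as \<open>E\<close> could be nonzero, \<open>A2\<close> and
    \<open>A\<close> differed by a term with a factor \<rho>, and the lower half-plane bound for
    \<open>A2\<close> gave no uniform bound for \<open>A\<close>.\<close>
  have A2: "A2 \<rho> x = A \<rho> x" if "x \<ge> 0" for \<rho> x
    by (simp add: A2_def E0[OF that])
  have A_const: "A \<rho> x = A \<rho>' x" if x: "x \<ge> 0" for \<rho> \<rho>' x
  proof -
    obtain Ce where Ce: "\<forall>\<rho>. norm (A \<rho> x) \<le> Ce * exp (Ce * norm \<rho>) \<and> norm (E \<rho> x) \<le> Ce * exp (Ce * norm \<rho>)"
      using exp_type[THEN spec, THEN mp, OF x] by (elim exE)
    have "A \<rho> x $ i $ j = A \<rho>' x $ i $ j" for i j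
    proof (rule entire_bounded_off_strip_const[where f = "\<lambda>\<rho>. A \<rho> x $ i $ j" and R = R and M = "max K K2"])
      show "(\<lambda>\<rho>. A \<rho> x $ i $ j) holomorphic_on UNIV" using hol x by simp
      show "norm (A z x $ i $ j) \<le> Ce * exp (Ce * norm z)" for z
        using Ce order_trans[OF nth] by simp
      fix z assume z: "\<bar>Im z\<bar> \<ge> R"
      have "norm (A z x) \<le> max K K2"
      proof (cases "Im z \<ge> 0")
        case True
        then show ?thesis using upper(1)[OF _ x, of z] z by simp
      next
        case False
        then show ?thesis using lower(1)[OF _ x, of z] z A2[OF x] by simp
      qed
      then show "norm (A z x $ i $ j) \<le> max K K2" using nth order_trans by blast
    qed
    then show ?thesis by (simp add: vec_eq_iff)
  qed
  have A_up: "A 0 x = Pm x ** Pmt' x" if x: "x \<ge> 0" for x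
  proof -
    have "A 0 x - Pm x ** Pmt' x = 0"
    proof (rule norm_le_div_imp_zero)
      fix \<tau> assume "\<tau> \<ge> R"
      then show "norm (A 0 x - Pm x ** Pmt' x) \<le> K / \<tau>"
        using upper(3)[of "\<i> * of_real \<tau>" x] x A_const[OF x, of 0 "\<i> * of_real \<tau>"] by simp
    qed
    then show ?thesis by simp
  qed
  have A_down: "A 0 x = Sm x ** Smt' x" if x: "x \<ge> 0" for x
  proof -
    have "A 0 x - Sm x ** Smt' x = 0"
    proof (rule norm_le_div_imp_zero)
      fix \<tau> assume "\<tau> \<ge> R"
      then show "norm (A 0 x - Sm x ** Smt' x) \<le> K2 / \<tau>"
        using lower(3)[of "- (\<i> * of_real \<tau>)" x] x A_const[OF x, of 0 "- (\<i> * of_real \<tau>)"] A2[OF x] by simp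
    qed
    then show ?thesis by simp
  qed
  have A_I: "A 0 x = mat 1" if x: "x \<ge> 0" for x
  proof -
    have "primitive (\<lambda>x. Pm x ** Pmt' x) (\<lambda>t. Pm t ** (Pmt' t ** Q1t t) + - (Q1 t ** Pm t) ** Pmt' t)"
      by (rule primitive_bilinear[OF mm.bounded_bilinear_axioms FL.Pm FT.Pm'])
    then have 1: "primitive (A 0) (\<lambda>t. A 0 t ** Q1t t - Q1 t ** A 0 t)"
      by (rule primitive_cong) (simp_all add: A_up matrix_algebra)
    have "primitive (\<lambda>x. Sm x ** Smt' x) (\<lambda>t. Sm t ** (Smt' t ** - Q1t t) + - (- Q1 t ** Sm t) ** Smt' t)"
      by (rule primitive_bilinear[OF mm.bounded_bilinear_axioms GL.Pm GT.Pm'])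
    then have 2: "primitive (A 0) (\<lambda>t. - (A 0 t ** Q1t t - Q1 t ** A 0 t))"
      by (rule primitive_cong) (simp_all add: A_down matrix_algebra)
    \<comment> \<open>The two integrands are opposite, so twice \<open>A\<close> has derivative zero
      and \<open>A\<close> keeps its initial value.\<close>
    have "primitive (\<lambda>t. A 0 t + A 0 t) (\<lambda>t. 0)" using primitive_add[OF 1 2] by simp
    from primitive_zero_imp_const[OF this x] have "2 *\<^sub>R A 0 x = 2 *\<^sub>R A 0 0" by (simp add: scaleR_2)
    then have "A 0 x = A 0 0" by (rule scaleR_left_imp_eq[rotated]) simp
    then show ?thesis by (simp add: A_up FL.init FT.init)
  qed
  have Pm_eq: "Pm x = Pmt x" if x: "x \<ge> 0" for x
  proof -
    have "Pm x ** Pmt' x = mat 1" using trans[OF A_up[OF x, symmetric] A_I[OF x]] .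
    then have "Pm x ** Pmt' x ** Pmt x = Pmt x" by simp
    then show ?thesis using FT.inv(2)[OF x] by (simp add: matrix_mul_assoc[symmetric])
  qed
  \<comment> \<open>Continuity of both derivatives yields \<open>Q1 = Q1t\<close> at every point of
    the closed half-line, including 0, rather than almost everywhere.\<close>
  have cont: "continuous_on {0..} (\<lambda>t. - (Q1 t ** Pm t))" "continuous_on {0..} (\<lambda>t. - (Q1t t ** Pmt t))"
    by (intro continuous_on_minus mm.continuous_on primitive_continuous_on[OF V(1)] primitive_continuous_on[OF Vt(1)]
        FL.P_cont(1) FT.P_cont(1))+
  have Q1_eq: "Q1 x = Q1t x" if x: "x \<ge> 0" for x
  proof -
    have "primitive Pm (\<lambda>t. - (Q1t t ** Pmt t))"
      by (rule primitive_cong[OF FT.Pm]) (simp_all add: Pm_eq)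
    from primitive_has_vector_derivative[OF this cont(2) x] primitive_has_vector_derivative[OF FL.Pm cont(1) x]
    have "Q1 x ** Pm x = Q1t x ** Pm x"
      using vector_derivative_unique_within[OF at_within_half_line_neq_bot[OF x]] Pm_eq[OF x] by (metis neg_equal_iff_equal)
    then have "(Q1 x ** Pm x) ** Pm' x = (Q1t x ** Pm x) ** Pm' x" by simp
    then show ?thesis using FL.inv(1)[OF x] by (simp add: matrix_mul_assoc[symmetric])
  qed
  \<comment> \<open>From here a single spectral parameter suffices. It is chosen with
    \<open>Im \<rho> > \<bar>C\<bar>\<close>, so that \<open>z\<close> stays at distance less than 1
    from the identity and can be cancelled at the end.\<close>
  define \<rho> where "\<rho> = \<i> * of_real (max R (\<bar>C\<bar> + 1))"
  have \<rho>: "Im \<rho> \<ge> R1" "Im \<rho> > \<bar>C\<bar>" "Im \<rho> > 0" using R by (auto simp: \<rho>_def)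
  obtain z w zt wt where j: "U.L.jost Pm C \<rho> z w" "U.T.jost Pmt C \<rho> zt wt" and wt0: "wt 0 = w 0 + k"
    using J[THEN spec, THEN mp, OF \<rho>(1)] by (elim exE conjE)
  have y: "primitive (\<lambda>x. Pm x ** z x) (\<lambda>t. w t - Q1 t ** (Pm t ** z t))"
    and w: "primitive w (\<lambda>t. cscale (- 2 * \<i> * \<rho>) (w t) + Q1 t ** w t - U.L.q t ** (Pm t ** z t))"
    and yt: "primitive (\<lambda>x. Pmt x ** zt x) (\<lambda>t. wt t - Q1t t ** (Pmt t ** zt t))"
    and wt: "primitive wt (\<lambda>t. cscale (- 2 * \<i> * \<rho>) (wt t) + Q1t t ** wt t - U.T.q t ** (Pmt t ** zt t))"
    and z0: "z 0 = mat 1" "zt 0 = mat 1" and zle: "\<forall>x\<ge>0. norm (z x - mat 1) \<le> C / Im \<rho>"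
    using j by (auto simp: U.L.jost_def U.T.jost_def)
  \<comment> \<open>With \<open>A = mat 1\<close> and \<open>E = 0\<close> the transfer relation
    identifies the first components of the two decaying solutions.\<close>
  have y_eq: "Pm x ** z x = Pmt x ** zt x" if x: "x \<ge> 0" for x
  proof -
    let ?e = "\<lambda>t::real. exp (\<i> * \<rho> * of_real t)"
    have "A \<rho> x ** cscale (?e x) (Pmt x ** zt x) + E \<rho> x ** cscale (?e x) (wt x) = cscale (?e x) (Pm x ** z x)"
      using transfer[rule_format, OF U.L.system_unscaled[OF y w] U.T.system_unscaled[OF yt wt] _ _ x]
      by (simp add: z0 wt0 cscale_one FL.init FT.init)
    then have "cscale (?e x) (Pmt x ** zt x) = cscale (?e x) (Pm x ** z x)"
      using A_const[OF x, of \<rho> 0] A_I[OF x] E0[OF x] by simp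
    then have "cscale (exp (- (\<i> * \<rho> * of_real x))) (cscale (?e x) (Pmt x ** zt x)) =
        cscale (exp (- (\<i> * \<rho> * of_real x))) (cscale (?e x) (Pm x ** z x))" by simp
    then show ?thesis by (simp only: cscale_cscale exp_add[symmetric]) (simp add: cscale_one)
  qed
  have w_eq: "w x = wt x" if x: "x \<ge> 0" for x
  proof -
    have c1: "continuous_on {0..} (\<lambda>t. w t - Q1 t ** (Pm t ** z t))"
      by (intro continuous_on_diff mm.continuous_on[OF primitive_continuous_on[OF V(1)] primitive_continuous_on[OF y]] primitive_continuous_on[OF w])
    have c2: "continuous_on {0..} (\<lambda>t. wt t - Q1t t ** (Pmt t ** zt t))"
      by (intro continuous_on_diff mm.continuous_on[OF primitive_continuous_on[OF Vt(1)] primitive_continuous_on[OF yt]] primitive_continuous_on[OF wt])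
    have "primitive (\<lambda>x. Pm x ** z x) (\<lambda>t. wt t - Q1t t ** (Pmt t ** zt t))"
      by (rule primitive_cong[OF yt]) (simp_all add: y_eq)
    from vector_derivative_unique_within[OF at_within_half_line_neq_bot[OF x] primitive_has_vector_derivative[OF y c1 x]
        primitive_has_vector_derivative[OF this c2 x]]
    show ?thesis using Q1_eq[OF x] y_eq[OF x] by simp
  qed
  \<comment> \<open>Equality of the second components at 0 annihilates the matching constant, which
    reduces to \<open>h0 - h0t\<close> once the \<open>Q1\<close> agree.\<close>
  have "k = 0" using wt0 w_eq[of 0] by simp
  then have h0: "h0 = h0t" using Q1_eq[of 0] by (simp add: k_def)
  \<comment> \<open>The same \<open>w\<close> now has two integrands. They agree almost everywhere
    and differ only in the factor \<open>q\<close> in front of \<open>Pm z\<close>.\<close>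
  have "primitive w (\<lambda>t. cscale (- 2 * \<i> * \<rho>) (wt t) + Q1t t ** wt t - U.T.q t ** (Pmt t ** zt t))"
    by (rule primitive_cong[OF wt]) (simp_all add: w_eq)
  note q_AE = primitive_AE_unique[OF w this]
  \<comment> \<open>\<open>q\<close> contains the derivative of \<open>Q1\<close>, so the two
    derivatives must be identified as well before \<open>Q0\<close> can be read off.\<close>
  have "primitive Q1 Q1t'" by (rule primitive_cong[OF Vt(1)]) (simp_all add: Q1_eq)
  note Q1'_AE = primitive_AE_unique[OF V(1) this]
  have "AE x in lebesgue. x > 0 \<longrightarrow> Q0 x = Q0t x"
    using q_AE Q1'_AE
  proof eventually_elim
    case (elim x)
    show ?case
    proof
      assume "x > 0"
      then have x: "x \<ge> 0" by simp
      have "norm (z x - mat 1) \<le> C / Im \<rho>" using zle x by simp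
      also have "\<dots> < 1" using \<rho> by (simp add: divide_less_eq)
      finally obtain G where "G ** (mat 1 + (z x - mat 1)) = mat 1"
        using matrix_near_identity_invertible by blast
      then have G: "z x ** G = mat 1" by (simp add: matrix_left_right_inverse)
      have "U.L.q x ** (Pm x ** z x) = U.T.q x ** (Pm x ** z x)"
        using elim(1) \<open>x > 0\<close> w_eq[OF x] Q1_eq[OF x] y_eq[OF x] by simp
      then have "(U.L.q x ** (Pm x ** z x)) ** (G ** Pm' x) = (U.T.q x ** (Pm x ** z x)) ** (G ** Pm' x)" by simp
      moreover have "(M ** (Pm x ** z x)) ** (G ** Pm' x) = M" for M :: "complex^'m^'m"
      proof -
        have "(M ** (Pm x ** z x)) ** (G ** Pm' x) = M ** (Pm x ** (z x ** G) ** Pm' x)" by (simp only: matrix_mul_assoc)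
        then show ?thesis unfolding G by (simp add: FL.inv(1)[OF x])
      qed
      ultimately have "U.L.q x = U.T.q x" by simp
      then show "Q0 x = Q0t x"
        using elim(2) \<open>x > 0\<close> Q1_eq[OF x] by (simp add: U.L.q_def U.T.q_def)
    qed
  qed
  then show ?thesis using Q1_eq h0 h1 by simp
qed

end
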